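(* Let $E$ be an arbitrary graph, $K$ a field, and let $P$ be a prime ideal of $L_K(E)$. Put $T=L_K(E)/P$. Then either $T$ is isomorphic to a Leavitt path algebra or $T/\mathrm{Soc}(T)$ is isomorphic to a Leavitt path algebra. In the latter case, $\mathrm{Soc}(T)$ is a simple ring, being a direct sum of isomorphic simple left ideals of $T$. (That is: either $T$ is isomorphic to a Leavitt path algebra, or $T/\mathrm{Soc}(T)$ is isomorphic to a Leavitt path algebra and $\mathrm{Soc}(T)$ is a simple ring which is a direct sum of isomorphic simple left ideals of $T$.)
   Context: A graph $E=(E^0,E^1,r,s)$ consists of a set $E^0$ of vertices, a set $E^1$ of edges and maps $r,s:E^1\to E^0$ (range and source); no cardinality restrictions are imposed. A vertex $v$ is regular if $0<|s^{-1}(v)|<\infty$. The Leavitt path algebra $L_K(E)$ is the (not necessarily unital) $K$-algebra generated by pairwise orthogonal idempotents $v\in E^0$ and elements $e,e^*$ ($e\in E^1$) subject to: $s(e)e=e=er(e)$; $r(e)e^*=e^*=e^*s(e)$; $e^*e=r(e)$ and $e^*f=0$ for edges $e\ne f$; $v=\sum_{s(e)=v}ee^*$ for every regular vertex $v$. The zero algebra is regarded as the Leavitt path algebra of the empty graph. Ideals are two-sided unless qualified. A proper ideal $P$ is prime if, for ideals $A,B$, $AB\subseteq P$ implies $A\subseteq P$ or $B\subseteq P$. $\mathrm{Soc}(T)$ is the socle of $T$, the sum of all simple (minimal) left ideals of $T$. *)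

theory Defs
  imports
    "HOL-Algebra.Ideal_Product"
    "HOL-Algebra.Generated_Groups"
    "HOL-Algebra.Module"
    "HOL-Algebra.QuotRing"
    "Graph_Theory.Digraph"
begin

section \<open>Rings without identity\<close>

text \<open>
  Leavitt path algebras need not have an identity, whereas the locales \<open>ring\<close>, \<open>ideal\<close>, \<open>primeideal\<close>
  of HOL-Algebra require one. We keep the records of HOL-Algebra, with the field \<open>one\<close>
  never used (and left \<open>undefined\<close> in the constructions below).
\<close>

locale rng = abelian_group R for R (structure) +
  assumes mult_closed: "\<lbrakk>x \<in> carrier R; y \<in> carrier R\<rbrakk> \<Longrightarrow> x \<otimes> y \<in> carrier R"
    and mult_assoc: "\<lbrakk>x \<in> carrier R; y \<in> carrier R; z \<in> carrier R\<rbrakk>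
          \<Longrightarrow> (x \<otimes> y) \<otimes> z = x \<otimes> (y \<otimes> z)"
    and distrib_right: "\<lbrakk>x \<in> carrier R; y \<in> carrier R; z \<in> carrier R\<rbrakk>
          \<Longrightarrow> (x \<oplus> y) \<otimes> z = x \<otimes> z \<oplus> y \<otimes> z"
    and distrib_left: "\<lbrakk>x \<in> carrier R; y \<in> carrier R; z \<in> carrier R\<rbrakk>
          \<Longrightarrow> z \<otimes> (x \<oplus> y) = z \<otimes> x \<oplus> z \<otimes> y"

locale rng_left_ideal = additive_subgroup I R for I and R (structure) +
  assumes left_closed: "\<lbrakk>x \<in> I; a \<in> carrier R\<rbrakk> \<Longrightarrow> a \<otimes> x \<in> I"

locale rng_ideal = rng_left_ideal I R for I and R (structure) +
  assumes right_closed: "\<lbrakk>x \<in> I; a \<in> carrier R\<rbrakk> \<Longrightarrow> x \<otimes> a \<in> I"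

definition rng_prime_ideal :: "'a set \<Rightarrow> ('a, 'm) ring_scheme \<Rightarrow> bool" where
  "rng_prime_ideal P R \<longleftrightarrow>
     rng_ideal P R \<and> P \<noteq> carrier R \<and>
     (\<forall>I J. rng_ideal I R \<longrightarrow> rng_ideal J R \<longrightarrow> I \<cdot>\<^bsub>R\<^esub> J \<subseteq> P \<longrightarrow> I \<subseteq> P \<or> J \<subseteq> P)"

text \<open>As usual without an identity, a simple ring is required to have nonzero multiplication.\<close>

definition simple_rng :: "('a, 'm) ring_scheme \<Rightarrow> bool" where
  "simple_rng R \<longleftrightarrow>
     rng R \<and>
     (\<exists>x \<in> carrier R. \<exists>y \<in> carrier R. x \<otimes>\<^bsub>R\<^esub> y \<noteq> \<zero>\<^bsub>R\<^esub>) \<and>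
     (\<forall>I. rng_ideal I R \<longrightarrow> I = {\<zero>\<^bsub>R\<^esub>} \<or> I = carrier R)"

definition simple_left_ideal :: "'a set \<Rightarrow> ('a, 'm) ring_scheme \<Rightarrow> bool" where
  "simple_left_ideal S R \<longleftrightarrow>
     rng_left_ideal S R \<and> S \<noteq> {\<zero>\<^bsub>R\<^esub>} \<and>
     (\<forall>J. rng_left_ideal J R \<longrightarrow> J \<subseteq> S \<longrightarrow> J = {\<zero>\<^bsub>R\<^esub>} \<or> J = S)"

definition sum_of_subgroups :: "('a, 'm) ring_scheme \<Rightarrow> 'a set set \<Rightarrow> 'a set" where
  "sum_of_subgroups R \<S> = generate (add_monoid R) (\<Union>\<S>)"

definition socle :: "('a, 'm) ring_scheme \<Rightarrow> 'a set" where
  "socle R = sum_of_subgroups R {S. simple_left_ideal S R}"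

definition isomorphic_left_ideals :: "('a, 'm) ring_scheme \<Rightarrow> 'a set \<Rightarrow> 'a set \<Rightarrow> bool" where
  "isomorphic_left_ideals R S S' \<longleftrightarrow>
     (\<exists>\<phi> \<in> iso ((add_monoid R)\<lparr>carrier := S\<rparr>) ((add_monoid R)\<lparr>carrier := S'\<rparr>).
        \<forall>a \<in> carrier R. \<forall>x \<in> S. \<phi> (a \<otimes>\<^bsub>R\<^esub> x) = a \<otimes>\<^bsub>R\<^esub> \<phi> x)"

text \<open>
  The summands of an internal direct sum form a set rather than an indexed family; for nonzero
  summands there is no difference, since no nonzero summand can occur twice.
\<close>

definition internal_direct_sum :: "('a, 'm) ring_scheme \<Rightarrow> 'a set set \<Rightarrow> 'a set \<Rightarrow> bool" where
  "internal_direct_sum R \<S> M \<longleftrightarrow>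
     M = sum_of_subgroups R \<S> \<and>
     (\<forall>S \<in> \<S>. S \<inter> sum_of_subgroups R (\<S> - {S}) = {\<zero>\<^bsub>R\<^esub>})"

definition direct_sum_of_isomorphic_simple_left_ideals ::
    "('a, 'm) ring_scheme \<Rightarrow> 'a set \<Rightarrow> bool" where
  "direct_sum_of_isomorphic_simple_left_ideals R M \<longleftrightarrow>
     (\<exists>\<S>. (\<forall>S \<in> \<S>. simple_left_ideal S R) \<and>
          (\<forall>S \<in> \<S>. \<forall>S' \<in> \<S>. isomorphic_left_ideals R S S') \<and>
          internal_direct_sum R \<S> M)"


section \<open>Algebras without identity\<close>

text \<open>
  The scalar action is \<open>k \<odot> (I +> x) = I +> (k \<odot> x)\<close>, written without choosing
  representatives in the same way as \<^const>\<open>rcoset_mult\<close>. This is the intended action only if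
  \<open>I\<close> is closed under scalars, which is automatic for ring ideals of an algebra with
  local units such as a Leavitt path algebra or a quotient of one: if \<open>x = u \<otimes> x\<close> then
  \<open>k \<odot> x = (k \<odot> u) \<otimes> x\<close>.
\<close>

definition quotient_algebra :: "('k, 'a) module \<Rightarrow> 'a set \<Rightarrow> ('k, 'a set) module" where
  "quotient_algebra A I =
     \<lparr>carrier = a_rcosets\<^bsub>A\<^esub> I, mult = rcoset_mult A I, one = undefined, zero = I,
      add = set_add A, smult = (\<lambda>k X. \<Union>x\<in>X. I +>\<^bsub>A\<^esub> (k \<odot>\<^bsub>A\<^esub> x))\<rparr>"

definition algebra_isomorphic ::
    "('k, 'm) ring_scheme \<Rightarrow> ('k, 'a) module \<Rightarrow> ('k, 'b) module \<Rightarrow> bool" where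
  "algebra_isomorphic K A B \<longleftrightarrow>
     (\<exists>h. h \<in> iso (add_monoid A) (add_monoid B) \<and> h \<in> hom A B \<and>
          (\<forall>k \<in> carrier K. \<forall>x \<in> carrier A. h (k \<odot>\<^bsub>A\<^esub> x) = k \<odot>\<^bsub>B\<^esub> h x))"

text \<open>
  The free algebra without identity on \<open>X\<close>: finitely supported functions on the nonempty words
  over \<open>X\<close>, multiplied by convolution along concatenation of words.
\<close>

definition free_algebra :: "('k, 'm) ring_scheme \<Rightarrow> 'x set \<Rightarrow> ('k, 'x list \<Rightarrow> 'k) module" where
  "free_algebra K X =
     \<lparr>carrier = {f. (\<forall>w. f w \<in> carrier K) \<and> finite {w. f w \<noteq> \<zero>\<^bsub>K\<^esub>} \<and>
                    (\<forall>w. f w \<noteq> \<zero>\<^bsub>K\<^esub> \<longrightarrow> w \<noteq> [] \<and> set w \<subseteq> X)},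
      mult = (\<lambda>f g w. \<Oplus>\<^bsub>K\<^esub>i\<in>{..length w}. f (take i w) \<otimes>\<^bsub>K\<^esub> g (drop i w)),
      one = undefined,
      zero = (\<lambda>w. \<zero>\<^bsub>K\<^esub>),
      add = (\<lambda>f g w. f w \<oplus>\<^bsub>K\<^esub> g w),
      smult = (\<lambda>k f w. k \<otimes>\<^bsub>K\<^esub> f w)\<rparr>"

definition free_gen :: "('k, 'm) ring_scheme \<Rightarrow> 'x \<Rightarrow> 'x list \<Rightarrow> 'k" where
  "free_gen K x = (\<lambda>w. if w = [x] then \<one>\<^bsub>K\<^esub> else \<zero>\<^bsub>K\<^esub>)"


section \<open>Leavitt path algebras\<close>

text \<open>
  Graphs are the directed multigraphs \<^locale>\<open>wf_digraph\<close> (of arbitrary cardinality); the source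
  and range of an edge are its \<^const>\<open>tail\<close> and \<^const>\<open>head\<close>.
\<close>

definition regular_vertex :: "('v, 'e) pre_digraph \<Rightarrow> 'v \<Rightarrow> bool" where
  "regular_vertex E v \<longleftrightarrow> v \<in> verts E \<and> out_arcs E v \<noteq> {} \<and> finite (out_arcs E v)"

text \<open>\<open>Ghost e\<close> stands for \<open>e\<^sup>*\<close>.\<close>

datatype ('v, 'e) leavitt_gen = Vertex 'v | Edge 'e | Ghost 'e

definition leavitt_gens :: "('v, 'e) pre_digraph \<Rightarrow> ('v, 'e) leavitt_gen set" where
  "leavitt_gens E = Vertex ` verts E \<union> Edge ` arcs E \<union> Ghost ` arcs E"

inductive leavitt_relation ::
    "('a, 'm) ring_scheme \<Rightarrow> (('v, 'e) leavitt_gen \<Rightarrow> 'a) \<Rightarrow> ('v, 'e) pre_digraph \<Rightarrow> 'a \<Rightarrow> 'a \<Rightarrow> bool"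
  for A (structure) and \<iota> and E where
  vertex_idem:
    "v \<in> verts E \<Longrightarrow> leavitt_relation A \<iota> E (\<iota> (Vertex v) \<otimes> \<iota> (Vertex v)) (\<iota> (Vertex v))"
| vertex_orth:
    "\<lbrakk>v \<in> verts E; w \<in> verts E; v \<noteq> w\<rbrakk> \<Longrightarrow>
       leavitt_relation A \<iota> E (\<iota> (Vertex v) \<otimes> \<iota> (Vertex w)) \<zero>"
| source_edge:
    "e \<in> arcs E \<Longrightarrow> leavitt_relation A \<iota> E (\<iota> (Vertex (tail E e)) \<otimes> \<iota> (Edge e)) (\<iota> (Edge e))"
| edge_range:
    "e \<in> arcs E \<Longrightarrow> leavitt_relation A \<iota> E (\<iota> (Edge e) \<otimes> \<iota> (Vertex (head E e))) (\<iota> (Edge e))"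
| range_ghost:
    "e \<in> arcs E \<Longrightarrow> leavitt_relation A \<iota> E (\<iota> (Vertex (head E e)) \<otimes> \<iota> (Ghost e)) (\<iota> (Ghost e))"
| ghost_source:
    "e \<in> arcs E \<Longrightarrow> leavitt_relation A \<iota> E (\<iota> (Ghost e) \<otimes> \<iota> (Vertex (tail E e))) (\<iota> (Ghost e))"
| ghost_edge:
    "e \<in> arcs E \<Longrightarrow> leavitt_relation A \<iota> E (\<iota> (Ghost e) \<otimes> \<iota> (Edge e)) (\<iota> (Vertex (head E e)))"
| ghost_edge_orth:
    "\<lbrakk>e \<in> arcs E; f \<in> arcs E; e \<noteq> f\<rbrakk> \<Longrightarrow>
       leavitt_relation A \<iota> E (\<iota> (Ghost e) \<otimes> \<iota> (Edge f)) \<zero>"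
| regular:
    "regular_vertex E v \<Longrightarrow>
       leavitt_relation A \<iota> E (\<iota> (Vertex v)) (\<Oplus>e\<in>out_arcs E v. \<iota> (Edge e) \<otimes> \<iota> (Ghost e))"

text \<open>
  The relations generate an ideal of the algebra, i.e. an ideal closed under scalars. The free
  algebra has no local units, so here \<^const>\<open>submodule\<close> does not follow from \<^const>\<open>rng_ideal\<close>.
\<close>

definition leavitt_ideal ::
    "('k, 'm) ring_scheme \<Rightarrow> ('v, 'e) pre_digraph \<Rightarrow> (('v, 'e) leavitt_gen list \<Rightarrow> 'k) set" where
  "leavitt_ideal K E =
     (let F = free_algebra K (leavitt_gens E)
      in \<Inter>{I. rng_ideal I F \<and> submodule I K F \<and>
               (\<forall>a b. leavitt_relation F (free_gen K) E a b \<longrightarrow> a \<ominus>\<^bsub>F\<^esub> b \<in> I)})"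

definition leavitt_path_algebra ::
    "('k, 'm) ring_scheme \<Rightarrow> ('v, 'e) pre_digraph
      \<Rightarrow> ('k, (('v, 'e) leavitt_gen list \<Rightarrow> 'k) set) module" where
  "leavitt_path_algebra K E =
     quotient_algebra (free_algebra K (leavitt_gens E)) (leavitt_ideal K E)"

text \<open>
  \<open>A\<close> is isomorphic, as a \<open>K\<close>-algebra, to the Leavitt path algebra over \<open>K\<close> of some graph.
  Existential quantification over types is not available, so the vertices and edges of the graph
  are taken in the element type of \<open>A\<close>. This loses no generality: the vertices of a graph
  are distinct elements of its Leavitt path algebra, and so are its edges; hence a graph \<open>F\<close> on
  any types with \<open>L\<^sub>K(F)\<close> isomorphic to \<open>A\<close> can be relabelled by the images of its vertices
  and edges in \<open>A\<close>. The empty graph is allowed, and gives the zero algebra.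
\<close>

definition isomorphic_to_leavitt_path_algebra ::
    "('k, 'm) ring_scheme \<Rightarrow> ('k, 'a) module \<Rightarrow> bool" where
  "isomorphic_to_leavitt_path_algebra K A \<longleftrightarrow>
     (\<exists>F :: ('a, 'a) pre_digraph.
        wf_digraph F \<and> algebra_isomorphic K A (leavitt_path_algebra K F))"

end

theory Submission
  imports
    Defs
    "HOL-Algebra.Finite_Extensions"
    "HOL-Library.Sublist"
    "Graph_Theory.Arc_Walk"
begin

text \<open>
  Discarding the vertices that vanish in \<open>T\<close>, and splitting each vertex \<open>v\<close> that keeps only finitely many
  edges into \<open>\<Sum> e e\<^sup>*\<close> and \<open>v - \<Sum> e e\<^sup>*\<close>, gives a graph \<open>F\<close> and a surjection \<open>\<rho>\<close> from \<open>L\<^sub>K(F)\<close> onto \<open>T\<close>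
  that kills no vertex.
  By induction on the ghost degree, an ideal \<open>N\<close> of \<open>L\<^sub>K(F)\<close> without vertices lies in the ideal generated
  by the vertices \<open>v\<close> for which \<open>N\<close> contains some \<open>k v + \<Sum> l\<^sub>\<tau> \<tau>\<close> with \<open>k \<noteq> 0\<close> and nontrivial closed paths
  \<open>\<tau>\<close> at \<open>v\<close>. If there is no such vertex for \<open>N = ker \<rho>\<close>, then \<open>\<rho>\<close> is an isomorphism.

  Otherwise multiplying such a relation by \<open>\<nu>\<^sup>*\<close> and \<open>\<nu>\<close> shows that every path \<open>\<nu>\<close> starting at \<open>v\<close> is a
  prefix of a power of one cycle \<open>c\<close>. Hence \<open>v T v\<close> is spanned by the powers of \<open>c\<close> and \<open>c\<^sup>* = c\<^sup>-\<^sup>1\<close>; as \<open>T\<close> is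
  prime it is a commutative domain, and as \<open>c\<close> is algebraic it is a field. So \<open>T v\<close> is a simple left ideal and
  \<open>Soc T = T v T\<close>. The preimage of \<open>Soc T\<close> in \<open>L\<^sub>K(F)\<close> is therefore generated by vertices, and the
  quotient of a Leavitt path algebra by such an ideal is a Leavitt path algebra.
\<close>

section \<open>Algebras without identity\<close>

text \<open>No basis of a Leavitt path algebra is used anywhere. Maps are defined on generators by
  the universal property, and injectivity is obtained from a factorization through a surjection;
  what must be known about a kernel is then only an inclusion: it lies in every ideal containing
  certain vertices. The obstacle is that a prime ideal need not be generated by vertices and
  splittings of vertices: after the splitting the kernel may still contain a polynomial in a cycle.
  Its nonzero constant term is the decisive feature. If \<nu> is a prefix of no
  \<open>\<tau>\<nu>\<close>, compressing the relation by \<nu> leaves a nonzero multiple of the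
  vertex r(\<nu>), which would have to vanish. Finiteness of the set of \<tau> upgrades this to
  comparability of any two paths from v, so the cycle has no exit. The splitting serves twice, for
  \<open>T\<close> over E and for \<open>T/Soc(T)\<close> over F. In the second use vertices die
  again, and an infinite emitter may keep only finitely many edges, so restricting the graph to the
  surviving vertices would not do.\<close>

context rng
begin

lemma mult_zero_left: "x \<in> carrier R \<Longrightarrow> \<zero> \<otimes> x = \<zero>"
proof -
  assume x: "x \<in> carrier R"
  have "\<zero> \<otimes> x \<oplus> \<zero> \<otimes> x = \<zero> \<otimes> x"
    using distrib_right[of \<zero> \<zero> x] x by simp
  then show ?thesis
    using x mult_closed[of \<zero> x] add.l_cancel_one by simp
qed

lemma mult_zero_right: "x \<in> carrier R \<Longrightarrow> x \<otimes> \<zero> = \<zero>"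
proof -
  assume x: "x \<in> carrier R"
  have "x \<otimes> \<zero> \<oplus> x \<otimes> \<zero> = x \<otimes> \<zero>"
    using distrib_left[of \<zero> \<zero> x] x by simp
  then show ?thesis
    using x mult_closed[of x \<zero>] add.l_cancel_one by simp
qed

lemma mult_minus_left: "x \<in> carrier R \<Longrightarrow> y \<in> carrier R \<Longrightarrow> (\<ominus> x) \<otimes> y = \<ominus> (x \<otimes> y)"
proof -
  assume a: "x \<in> carrier R" "y \<in> carrier R"
  have "(\<ominus> x) \<otimes> y \<oplus> x \<otimes> y = \<zero>"
    using a by (simp add: distrib_right[symmetric] l_neg mult_zero_left)
  then show ?thesis
    using a mult_closed by (simp add: add.inv_equality)
qed

lemma mult_minus_right: "x \<in> carrier R \<Longrightarrow> y \<in> carrier R \<Longrightarrow> x \<otimes> (\<ominus> y) = \<ominus> (x \<otimes> y)"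
proof -
  assume a: "x \<in> carrier R" "y \<in> carrier R"
  have "x \<otimes> (\<ominus> y) \<oplus> x \<otimes> y = \<zero>"
    using a by (simp add: distrib_left[symmetric] l_neg mult_zero_right)
  then show ?thesis
    using a mult_closed by (simp add: add.inv_equality)
qed

lemma mult_diff_left:
  "x \<in> carrier R \<Longrightarrow> y \<in> carrier R \<Longrightarrow> z \<in> carrier R \<Longrightarrow> (x \<ominus> y) \<otimes> z = x \<otimes> z \<ominus> y \<otimes> z"
  by (simp add: minus_eq distrib_right mult_minus_left)

lemma mult_diff_right:
  "x \<in> carrier R \<Longrightarrow> y \<in> carrier R \<Longrightarrow> z \<in> carrier R \<Longrightarrow> z \<otimes> (x \<ominus> y) = z \<otimes> x \<ominus> z \<otimes> y"
  by (simp add: minus_eq distrib_left mult_minus_right)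

lemma diff_eq_zero_iff:
  "x \<in> carrier R \<Longrightarrow> y \<in> carrier R \<Longrightarrow> x \<ominus> y = \<zero> \<longleftrightarrow> x = y"
  by (metis add.inv_solve_right' minus_eq add.inv_closed l_zero zero_closed)

lemma diff_add_cancel: "x \<in> carrier R \<Longrightarrow> y \<in> carrier R \<Longrightarrow> (x \<ominus> y) \<oplus> y = x"
  by (simp add: minus_eq a_assoc l_neg)

lemma diff_self: "x \<in> carrier R \<Longrightarrow> x \<ominus> x = \<zero>"
  by (simp add: diff_eq_zero_iff)

lemma diff_zero: "x \<in> carrier R \<Longrightarrow> x \<ominus> \<zero> = x"
  using diff_add_cancel[of x \<zero>] by simp

lemma add_diff_cancel_left: "x \<in> carrier R \<Longrightarrow> y \<in> carrier R \<Longrightarrow> (x \<oplus> y) \<ominus> x = y"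
  by (simp add: minus_eq a_comm[of x y] a_assoc r_neg)

lemma diff_add_diff:
  "x \<in> carrier R \<Longrightarrow> y \<in> carrier R \<Longrightarrow> z \<in> carrier R \<Longrightarrow> (x \<ominus> y) \<oplus> (y \<ominus> z) = x \<ominus> z"
  by (simp add: minus_eq a_assoc r_neg1 r_neg2)

lemma finsum_mult_left:
  assumes "finite S" "f \<in> S \<rightarrow> carrier R" "y \<in> carrier R"
  shows "finsum R f S \<otimes> y = (\<Oplus>i\<in>S. f i \<otimes> y)"
  using assms
  by (induction S rule: finite_induct)
     (auto simp: mult_zero_left Pi_iff distrib_right mult_closed)

lemma finsum_mult_right:
  assumes "finite S" "f \<in> S \<rightarrow> carrier R" "y \<in> carrier R"
  shows "y \<otimes> finsum R f S = (\<Oplus>i\<in>S. y \<otimes> f i)"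
  using assms
  by (induction S rule: finite_induct)
     (auto simp: mult_zero_right Pi_iff distrib_left mult_closed)

lemma finsum_single:
  assumes "finite S" "i \<in> S" "f \<in> S \<rightarrow> carrier R" "\<And>j. j \<in> S \<Longrightarrow> j \<noteq> i \<Longrightarrow> f j = \<zero>"
  shows "finsum R f S = f i"
proof -
  have "finsum R f S = finsum R (\<lambda>j. if i = j then f j else \<zero>) S"
    using assms by (intro finsum_cong') (auto simp: Pi_iff)
  also have "\<dots> = f i"
    using assms by (intro finsum_singleton) auto
  finally show ?thesis .
qed

lemma additive_subgroupI':
  assumes "I \<subseteq> carrier R" "\<zero> \<in> I" "\<And>x y. x \<in> I \<Longrightarrow> y \<in> I \<Longrightarrow> x \<oplus> y \<in> I"
    "\<And>x. x \<in> I \<Longrightarrow> \<ominus> x \<in> I"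
  shows "additive_subgroup I R"
  using assms
  by (intro additive_subgroup.intro add.subgroupI) (auto simp: a_inv_def)

lemma rng_left_idealI:
  assumes "I \<subseteq> carrier R" "\<zero> \<in> I" "\<And>x y. x \<in> I \<Longrightarrow> y \<in> I \<Longrightarrow> x \<oplus> y \<in> I"
    "\<And>x. x \<in> I \<Longrightarrow> \<ominus> x \<in> I" "\<And>x a. x \<in> I \<Longrightarrow> a \<in> carrier R \<Longrightarrow> a \<otimes> x \<in> I"
  shows "rng_left_ideal I R"
  using assms
  by (intro rng_left_ideal.intro additive_subgroupI' rng_left_ideal_axioms.intro) auto

lemma rng_idealI:
  assumes "I \<subseteq> carrier R" "\<zero> \<in> I" "\<And>x y. x \<in> I \<Longrightarrow> y \<in> I \<Longrightarrow> x \<oplus> y \<in> I"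
    "\<And>x. x \<in> I \<Longrightarrow> \<ominus> x \<in> I" "\<And>x a. x \<in> I \<Longrightarrow> a \<in> carrier R \<Longrightarrow> a \<otimes> x \<in> I"
    "\<And>x a. x \<in> I \<Longrightarrow> a \<in> carrier R \<Longrightarrow> x \<otimes> a \<in> I"
  shows "rng_ideal I R"
  using assms
  by (intro rng_ideal.intro rng_left_idealI rng_ideal_axioms.intro) auto

end

lemma rng_ideal_additive_subgroup: "rng_ideal I R \<Longrightarrow> additive_subgroup I R"
  by (simp add: rng_ideal_def rng_left_ideal_def)

lemma rng_left_ideal_additive_subgroup: "rng_left_ideal I R \<Longrightarrow> additive_subgroup I R"
  by (simp add: rng_left_ideal_def)

section \<open>Algebras over a field: subspaces and ideals\<close>

locale rng_algebra = rng A + K: field K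
  for K :: "('k, 'm) ring_scheme" and A :: "('k, 'a) module" (structure) +
  assumes smult_closed: "\<lbrakk>k \<in> carrier K; x \<in> carrier A\<rbrakk> \<Longrightarrow> k \<odot> x \<in> carrier A"
    and smult_l_distr: "\<lbrakk>k \<in> carrier K; l \<in> carrier K; x \<in> carrier A\<rbrakk>
          \<Longrightarrow> (k \<oplus>\<^bsub>K\<^esub> l) \<odot> x = k \<odot> x \<oplus> l \<odot> x"
    and smult_r_distr: "\<lbrakk>k \<in> carrier K; x \<in> carrier A; y \<in> carrier A\<rbrakk>
          \<Longrightarrow> k \<odot> (x \<oplus> y) = k \<odot> x \<oplus> k \<odot> y"
    and smult_assoc: "\<lbrakk>k \<in> carrier K; l \<in> carrier K; x \<in> carrier A\<rbrakk>
          \<Longrightarrow> (k \<otimes>\<^bsub>K\<^esub> l) \<odot> x = k \<odot> (l \<odot> x)"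
    and smult_one: "x \<in> carrier A \<Longrightarrow> \<one>\<^bsub>K\<^esub> \<odot> x = x"
    and smult_mult_left: "\<lbrakk>k \<in> carrier K; x \<in> carrier A; y \<in> carrier A\<rbrakk>
          \<Longrightarrow> (k \<odot> x) \<otimes> y = k \<odot> (x \<otimes> y)"
    and smult_mult_right: "\<lbrakk>k \<in> carrier K; x \<in> carrier A; y \<in> carrier A\<rbrakk>
          \<Longrightarrow> x \<otimes> (k \<odot> y) = k \<odot> (x \<otimes> y)"
begin

lemma smult_zero_left: "x \<in> carrier A \<Longrightarrow> \<zero>\<^bsub>K\<^esub> \<odot> x = \<zero>"
proof -
  assume x: "x \<in> carrier A"
  have "\<zero>\<^bsub>K\<^esub> \<odot> x \<oplus> \<zero>\<^bsub>K\<^esub> \<odot> x = \<zero>\<^bsub>K\<^esub> \<odot> x"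
    using smult_l_distr[of "\<zero>\<^bsub>K\<^esub>" "\<zero>\<^bsub>K\<^esub>" x] x by simp
  then show ?thesis
    using x smult_closed[of "\<zero>\<^bsub>K\<^esub>" x] add.l_cancel_one by simp
qed

lemma smult_zero_right: "k \<in> carrier K \<Longrightarrow> k \<odot> \<zero> = \<zero>"
proof -
  assume k: "k \<in> carrier K"
  have "k \<odot> \<zero> \<oplus> k \<odot> \<zero> = k \<odot> \<zero>"
    using smult_r_distr[of k \<zero> \<zero>] k by simp
  then show ?thesis
    using k smult_closed[of k \<zero>] add.l_cancel_one by simp
qed

lemma smult_minus_one: "x \<in> carrier A \<Longrightarrow> (\<ominus>\<^bsub>K\<^esub> \<one>\<^bsub>K\<^esub>) \<odot> x = \<ominus> x"
proof -
  assume x: "x \<in> carrier A"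
  have "(\<ominus>\<^bsub>K\<^esub> \<one>\<^bsub>K\<^esub>) \<odot> x \<oplus> x = (\<ominus>\<^bsub>K\<^esub> \<one>\<^bsub>K\<^esub> \<oplus>\<^bsub>K\<^esub> \<one>\<^bsub>K\<^esub>) \<odot> x"
    using x by (simp add: smult_l_distr smult_one)
  also have "\<dots> = \<zero>"
    using x by (simp add: K.l_neg smult_zero_left)
  finally show ?thesis
    using x smult_closed by (simp add: add.inv_equality)
qed

lemma smult_minus: "k \<in> carrier K \<Longrightarrow> x \<in> carrier A \<Longrightarrow> k \<odot> (\<ominus> x) = \<ominus> (k \<odot> x)"
proof -
  assume a: "k \<in> carrier K" "x \<in> carrier A"
  have "k \<odot> ((\<ominus>\<^bsub>K\<^esub> \<one>\<^bsub>K\<^esub>) \<odot> x) = (\<ominus>\<^bsub>K\<^esub> \<one>\<^bsub>K\<^esub>) \<odot> (k \<odot> x)"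
    using a by (metis smult_assoc K.m_comm K.one_closed K.a_inv_closed)
  then show ?thesis
    using a by (simp add: smult_minus_one smult_closed)
qed

lemma smult_diff:
  "k \<in> carrier K \<Longrightarrow> x \<in> carrier A \<Longrightarrow> y \<in> carrier A \<Longrightarrow> k \<odot> (x \<ominus> y) = k \<odot> x \<ominus> k \<odot> y"
  by (simp add: minus_eq smult_r_distr smult_minus)

lemma smult_eq_zero:
  assumes "k \<in> carrier K" "k \<noteq> \<zero>\<^bsub>K\<^esub>" "x \<in> carrier A" "k \<odot> x = \<zero>"
  shows "x = \<zero>"
proof -
  have k: "k \<in> Units K" using assms by (simp add: K.field_Units)
  have "x = (inv\<^bsub>K\<^esub> k \<otimes>\<^bsub>K\<^esub> k) \<odot> x"
    using k assms by (simp add: smult_one)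
  also have "\<dots> = \<zero>"
    using k assms by (simp add: smult_assoc smult_zero_right del: K.Units_l_inv)
  finally show ?thesis .
qed

lemma finsum_smult:
  assumes "finite S" "f \<in> S \<rightarrow> carrier A" "k \<in> carrier K"
  shows "k \<odot> finsum A f S = (\<Oplus>i\<in>S. k \<odot> f i)"
  using assms
  by (induction S rule: finite_induct)
     (auto simp: smult_zero_right Pi_iff smult_r_distr smult_closed)

text \<open>Negatives are multiples by the scalar -1. Subspaces, not subgroups, are the sets on
  which the induction principles below operate.\<close>

definition subspace :: "'a set \<Rightarrow> bool" where
  "subspace S \<longleftrightarrow> S \<subseteq> carrier A \<and> \<zero> \<in> S \<and> (\<forall>x\<in>S. \<forall>y\<in>S. x \<oplus> y \<in> S) \<and>
     (\<forall>k\<in>carrier K. \<forall>x\<in>S. k \<odot> x \<in> S)"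

lemma subspace_minus: "subspace S \<Longrightarrow> x \<in> S \<Longrightarrow> \<ominus> x \<in> S"
  unfolding subspace_def
  by (metis smult_minus_one subsetD K.one_closed K.a_inv_closed)

lemma subspace_diff: "subspace S \<Longrightarrow> x \<in> S \<Longrightarrow> y \<in> S \<Longrightarrow> x \<ominus> y \<in> S"
  using subspace_minus[of S y] unfolding minus_eq by (auto simp: subspace_def)

lemma subspace_finsum:
  assumes "subspace S" "\<And>i. i \<in> I \<Longrightarrow> f i \<in> S"
  shows "finsum A f I \<in> S"
proof (cases "finite I")
  case True
  then show ?thesis
    using assms(2)
  proof (induction I rule: finite_induct)
    case empty
    then show ?case using assms(1) by (simp add: subspace_def)
  next
    case (insert i I)
    then have "f \<in> insert i I \<rightarrow> carrier A"
      using assms(1) by (auto simp: subspace_def)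
    then show ?case
      using insert assms(1) by (simp add: subspace_def)
  qed
next
  case False
  then show ?thesis using assms(1) by (simp add: subspace_def finsum_infinite)
qed

text \<open>The same pair of conditions cuts out the ideals intersected in
  \<open>leavitt_ideal\<close>, so the minimality of that ideal can be played against any
  \<open>alg_ideal\<close>, in particular against a kernel.\<close>

definition alg_ideal :: "'a set \<Rightarrow> bool" where
  "alg_ideal I \<longleftrightarrow> rng_ideal I A \<and> submodule I K A"

lemma alg_idealI:
  assumes "subspace I" "\<And>x a. x \<in> I \<Longrightarrow> a \<in> carrier A \<Longrightarrow> a \<otimes> x \<in> I"
    "\<And>x a. x \<in> I \<Longrightarrow> a \<in> carrier A \<Longrightarrow> x \<otimes> a \<in> I"
  shows "alg_ideal I"
proof -
  have "rng_ideal I A"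
    using assms subspace_minus[OF assms(1)] by (intro rng_idealI) (auto simp: subspace_def)
  then have "subgroup I (add_monoid A)"
    by (simp add: rng_ideal_def rng_left_ideal_def additive_subgroup_def)
  with \<open>rng_ideal I A\<close> show ?thesis
    using assms(1)
    by (simp add: alg_ideal_def submodule_def submodule_axioms_def subspace_def)
qed

lemma alg_ideal_additive_subgroup: "alg_ideal I \<Longrightarrow> additive_subgroup I A"
  by (simp add: alg_ideal_def rng_ideal_additive_subgroup)

lemma alg_ideal_subspace: "alg_ideal I \<Longrightarrow> subspace I"
  using additive_subgroup.a_subset[of I A] additive_subgroup.a_closed[of I A]
    additive_subgroup.zero_closed[of I A] alg_ideal_additive_subgroup[of I]
  by (auto simp: alg_ideal_def subspace_def submodule_def submodule_axioms_def)

lemma alg_ideal_left: "alg_ideal I \<Longrightarrow> x \<in> I \<Longrightarrow> a \<in> carrier A \<Longrightarrow> a \<otimes> x \<in> I"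
  by (simp add: alg_ideal_def rng_ideal_def rng_left_ideal.left_closed)

lemma alg_ideal_right: "alg_ideal I \<Longrightarrow> x \<in> I \<Longrightarrow> a \<in> carrier A \<Longrightarrow> x \<otimes> a \<in> I"
  by (simp add: alg_ideal_def rng_ideal.right_closed)

end

section \<open>Homomorphisms of algebras\<close>

locale rng_algebra_hom = A: rng_algebra K A + B: rng_algebra K B
  for K :: "('k, 'm) ring_scheme" and A :: "('k, 'a) module" and B :: "('k, 'b) module" and h +
  assumes hom_closed: "x \<in> carrier A \<Longrightarrow> h x \<in> carrier B"
    and hom_add: "\<lbrakk>x \<in> carrier A; y \<in> carrier A\<rbrakk> \<Longrightarrow> h (x \<oplus>\<^bsub>A\<^esub> y) = h x \<oplus>\<^bsub>B\<^esub> h y"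
    and hom_mult: "\<lbrakk>x \<in> carrier A; y \<in> carrier A\<rbrakk> \<Longrightarrow> h (x \<otimes>\<^bsub>A\<^esub> y) = h x \<otimes>\<^bsub>B\<^esub> h y"
    and hom_smult: "\<lbrakk>k \<in> carrier K; x \<in> carrier A\<rbrakk> \<Longrightarrow> h (k \<odot>\<^bsub>A\<^esub> x) = k \<odot>\<^bsub>B\<^esub> h x"
begin

lemma hom_zero: "h \<zero>\<^bsub>A\<^esub> = \<zero>\<^bsub>B\<^esub>"
proof -
  have "h \<zero>\<^bsub>A\<^esub> \<oplus>\<^bsub>B\<^esub> h \<zero>\<^bsub>A\<^esub> = h \<zero>\<^bsub>A\<^esub>"
    using hom_add[of "\<zero>\<^bsub>A\<^esub>" "\<zero>\<^bsub>A\<^esub>"] by simp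
  then show ?thesis
    using hom_closed[of "\<zero>\<^bsub>A\<^esub>"] B.add.l_cancel_one by simp
qed

lemma hom_minus: "x \<in> carrier A \<Longrightarrow> h (\<ominus>\<^bsub>A\<^esub> x) = \<ominus>\<^bsub>B\<^esub> h x"
  using hom_smult[of "\<ominus>\<^bsub>K\<^esub> \<one>\<^bsub>K\<^esub>" x] hom_closed[of x]
  by (simp add: A.smult_minus_one B.smult_minus_one)

lemma hom_diff: "x \<in> carrier A \<Longrightarrow> y \<in> carrier A \<Longrightarrow> h (x \<ominus>\<^bsub>A\<^esub> y) = h x \<ominus>\<^bsub>B\<^esub> h y"
  by (simp add: A.minus_eq B.minus_eq hom_add hom_minus)

lemma hom_finsum: "f \<in> S \<rightarrow> carrier A \<Longrightarrow> h (finsum A f S) = finsum B (\<lambda>i. h (f i)) S"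
proof (induction S rule: infinite_finite_induct)
  case (infinite S)
  then show ?case by (simp add: A.finsum_infinite B.finsum_infinite hom_zero)
next
  case empty
  then show ?case by (simp add: hom_zero)
next
  case (insert i S)
  then show ?case
    using hom_closed by (simp add: hom_add Pi_iff)
qed

definition kernel :: "'a set" where "kernel = {x \<in> carrier A. h x = \<zero>\<^bsub>B\<^esub>}"

lemma alg_ideal_kernel: "A.alg_ideal kernel"
  by (rule A.alg_idealI)
     (auto simp: kernel_def A.subspace_def hom_add hom_zero hom_smult hom_mult hom_closed
        A.smult_closed A.mult_closed B.smult_zero_right B.mult_zero_left B.mult_zero_right)

lemma inj_on_kernel: "kernel \<subseteq> {\<zero>\<^bsub>A\<^esub>} \<Longrightarrow> inj_on h (carrier A)"
proof (rule inj_onI)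
  fix x y assume k: "kernel \<subseteq> {\<zero>\<^bsub>A\<^esub>}" and xy: "x \<in> carrier A" "y \<in> carrier A" "h x = h y"
  then have "x \<ominus>\<^bsub>A\<^esub> y \<in> kernel"
    using hom_closed by (simp add: kernel_def hom_diff B.diff_eq_zero_iff)
  then show "x = y" using k xy A.diff_eq_zero_iff by blast
qed

lemma subspace_vimage:
  assumes "B.subspace S"
  shows "A.subspace {x \<in> carrier A. h x \<in> S}"
  using assms
  by (auto simp: A.subspace_def B.subspace_def hom_add hom_zero hom_smult A.smult_closed)

lemma subspace_image:
  assumes "A.subspace S"
  shows "B.subspace (h ` S)"
  unfolding B.subspace_def
proof (intro conjI ballI)
  show "h ` S \<subseteq> carrier B"
    using assms hom_closed by (auto simp: A.subspace_def)
  show "\<zero>\<^bsub>B\<^esub> \<in> h ` S"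
    using assms hom_zero by (auto simp: A.subspace_def intro!: image_eqI[of _ h "\<zero>\<^bsub>A\<^esub>"])
next
  fix x y assume "x \<in> h ` S" "y \<in> h ` S"
  then obtain a b where "a \<in> S" "b \<in> S" "x = h a" "y = h b" by auto
  then have "x \<oplus>\<^bsub>B\<^esub> y = h (a \<oplus>\<^bsub>A\<^esub> b)" "a \<oplus>\<^bsub>A\<^esub> b \<in> S"
    using assms by (auto simp: A.subspace_def subset_iff hom_add)
  then show "x \<oplus>\<^bsub>B\<^esub> y \<in> h ` S" by simp
next
  fix k x assume k: "k \<in> carrier K" and "x \<in> h ` S"
  then obtain a where "a \<in> S" "x = h a" by auto
  then have "k \<odot>\<^bsub>B\<^esub> x = h (k \<odot>\<^bsub>A\<^esub> a)" "k \<odot>\<^bsub>A\<^esub> a \<in> S"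
    using assms k by (auto simp: A.subspace_def subset_iff hom_smult)
  then show "k \<odot>\<^bsub>B\<^esub> x \<in> h ` S" by simp
qed

end

lemma rng_algebra_hom_comp:
  assumes "rng_algebra_hom K A B g" "rng_algebra_hom K B C h"
  shows "rng_algebra_hom K A C (\<lambda>x. h (g x))"
proof -
  interpret g: rng_algebra_hom K A B g by fact
  interpret h: rng_algebra_hom K B C h by fact
  show ?thesis
    by unfold_locales
       (auto simp: g.hom_closed h.hom_closed g.hom_add h.hom_add g.hom_mult h.hom_mult
         g.hom_smult h.hom_smult)
qed

text \<open>The axioms of an algebra are closure conditions and equations, so they pass to any
  structure that is the image of an algebra under a map respecting the operations; the negative of
  \<open>h x\<close> is \<open>h (\<ominus> x)\<close>. Nothing is assumed about \<open>B\<close>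
  itself: this is how \<open>quotient_algebra\<close> is seen to be an algebra.\<close>

lemma (in rng_algebra) surj_image_hom:
  fixes B :: "('k, 'b) module"
  assumes surj: "h ` carrier A = carrier B"
    and zero: "h \<zero> = \<zero>\<^bsub>B\<^esub>"
    and add: "\<And>x y. \<lbrakk>x \<in> carrier A; y \<in> carrier A\<rbrakk> \<Longrightarrow> h (x \<oplus> y) = h x \<oplus>\<^bsub>B\<^esub> h y"
    and mult: "\<And>x y. \<lbrakk>x \<in> carrier A; y \<in> carrier A\<rbrakk> \<Longrightarrow> h (x \<otimes> y) = h x \<otimes>\<^bsub>B\<^esub> h y"
    and smult: "\<And>k x. \<lbrakk>k \<in> carrier K; x \<in> carrier A\<rbrakk> \<Longrightarrow> h (k \<odot> x) = k \<odot>\<^bsub>B\<^esub> h x"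
  shows "rng_algebra_hom K A B h"
proof -
  have ex: "\<exists>a\<in>carrier A. b = h a" if "b \<in> carrier B" for b
    using that surj by blast
  have cl: "h x \<in> carrier B" if "x \<in> carrier A" for x
    using that surj by blast
  note sym = add[symmetric] mult[symmetric] smult[symmetric]
  have ab: "abelian_group B"
  proof (rule abelian_groupI)
    show "\<zero>\<^bsub>B\<^esub> \<in> carrier B" using cl[of \<zero>] zero by simp
  next
    fix x y assume "x \<in> carrier B" "y \<in> carrier B"
    then obtain a b where "a \<in> carrier A" "b \<in> carrier A" "x = h a" "y = h b" using ex by metis
    then show "x \<oplus>\<^bsub>B\<^esub> y \<in> carrier B" "x \<oplus>\<^bsub>B\<^esub> y = y \<oplus>\<^bsub>B\<^esub> x"
      by (simp_all add: add[symmetric] cl a_comm)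
  next
    fix x y z assume "x \<in> carrier B" "y \<in> carrier B" "z \<in> carrier B"
    then obtain a b c where "a \<in> carrier A" "b \<in> carrier A" "c \<in> carrier A" "x = h a" "y = h b" "z = h c"
      using ex by metis
    then show "x \<oplus>\<^bsub>B\<^esub> y \<oplus>\<^bsub>B\<^esub> z = x \<oplus>\<^bsub>B\<^esub> (y \<oplus>\<^bsub>B\<^esub> z)"
      by (simp add: add[symmetric] a_assoc)
  next
    fix x assume "x \<in> carrier B"
    then obtain a where a: "a \<in> carrier A" "x = h a" using ex by metis
    then show "\<zero>\<^bsub>B\<^esub> \<oplus>\<^bsub>B\<^esub> x = x"
      by (simp add: add[symmetric] zero[symmetric])
    show "\<exists>y\<in>carrier B. y \<oplus>\<^bsub>B\<^esub> x = \<zero>\<^bsub>B\<^esub>"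
      using a by (intro bexI[of _ "h (\<ominus> a)"]) (simp_all add: add[symmetric] zero[symmetric] cl l_neg)
  qed
  have B: "rng_algebra K B"
  proof (intro rng_algebra.intro rng.intro ab rng_axioms.intro rng_algebra_axioms.intro K.field_axioms)
    fix x y assume "x \<in> carrier B" "y \<in> carrier B"
    then obtain a b where "a \<in> carrier A" "b \<in> carrier A" "x = h a" "y = h b" using ex by metis
    then show "x \<otimes>\<^bsub>B\<^esub> y \<in> carrier B" by (simp add: mult[symmetric] cl mult_closed)
  next
    fix x y z assume "x \<in> carrier B" "y \<in> carrier B" "z \<in> carrier B"
    then obtain a b c where "a \<in> carrier A" "b \<in> carrier A" "c \<in> carrier A" "x = h a" "y = h b" "z = h c"
      using ex by metis
    then show "x \<otimes>\<^bsub>B\<^esub> y \<otimes>\<^bsub>B\<^esub> z = x \<otimes>\<^bsub>B\<^esub> (y \<otimes>\<^bsub>B\<^esub> z)"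
      "(x \<oplus>\<^bsub>B\<^esub> y) \<otimes>\<^bsub>B\<^esub> z = x \<otimes>\<^bsub>B\<^esub> z \<oplus>\<^bsub>B\<^esub> y \<otimes>\<^bsub>B\<^esub> z"
      "z \<otimes>\<^bsub>B\<^esub> (x \<oplus>\<^bsub>B\<^esub> y) = z \<otimes>\<^bsub>B\<^esub> x \<oplus>\<^bsub>B\<^esub> z \<otimes>\<^bsub>B\<^esub> y"
      by (simp_all add: sym mult_assoc mult_closed distrib_left distrib_right)
  next
    fix k l x assume kl: "k \<in> carrier K" "l \<in> carrier K" and "x \<in> carrier B"
    then obtain a where a: "a \<in> carrier A" "x = h a" using ex by metis
    with kl show "(k \<oplus>\<^bsub>K\<^esub> l) \<odot>\<^bsub>B\<^esub> x = k \<odot>\<^bsub>B\<^esub> x \<oplus>\<^bsub>B\<^esub> l \<odot>\<^bsub>B\<^esub> x"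
      "(k \<otimes>\<^bsub>K\<^esub> l) \<odot>\<^bsub>B\<^esub> x = k \<odot>\<^bsub>B\<^esub> (l \<odot>\<^bsub>B\<^esub> x)"
      by (simp_all add: sym smult_closed smult_l_distr smult_assoc)
  next
    fix k x y assume kl: "k \<in> carrier K" and "x \<in> carrier B" "y \<in> carrier B"
    then obtain a b where a: "a \<in> carrier A" "x = h a" "b \<in> carrier A" "y = h b" using ex by metis
    with kl show "k \<odot>\<^bsub>B\<^esub> (x \<oplus>\<^bsub>B\<^esub> y) = k \<odot>\<^bsub>B\<^esub> x \<oplus>\<^bsub>B\<^esub> k \<odot>\<^bsub>B\<^esub> y"
      "(k \<odot>\<^bsub>B\<^esub> x) \<otimes>\<^bsub>B\<^esub> y = k \<odot>\<^bsub>B\<^esub> (x \<otimes>\<^bsub>B\<^esub> y)"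
      "x \<otimes>\<^bsub>B\<^esub> (k \<odot>\<^bsub>B\<^esub> y) = k \<odot>\<^bsub>B\<^esub> (x \<otimes>\<^bsub>B\<^esub> y)"
      by (simp_all add: sym smult_closed smult_r_distr smult_mult_left smult_mult_right mult_closed)
  next
    fix k x assume kl: "k \<in> carrier K" and "x \<in> carrier B"
    then obtain a where a: "a \<in> carrier A" "x = h a" using ex by metis
    with kl show "k \<odot>\<^bsub>B\<^esub> x \<in> carrier B" by (simp add: sym smult_closed cl)
  next
    fix x assume "x \<in> carrier B"
    then obtain a where a: "a \<in> carrier A" "x = h a" using ex by metis
    then show "\<one>\<^bsub>K\<^esub> \<odot>\<^bsub>B\<^esub> x = x" by (simp add: sym smult_one)
  qed
  interpret B: rng_algebra K B by (fact B)
  show ?thesis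
    by unfold_locales (auto simp: cl add mult smult)
qed

section \<open>Cosets and quotient algebras\<close>

lemma (in abelian_group) coset_eq_iff:
  assumes "additive_subgroup I G" "x \<in> carrier G" "y \<in> carrier G"
  shows "I +> x = I +> y \<longleftrightarrow> x \<ominus> y \<in> I"
proof -
  interpret I: additive_subgroup I G by fact
  show ?thesis
  proof
    assume "I +> x = I +> y"
    then have "I +> (x \<oplus> \<ominus> y) = I"
      by (rule a_coset_add_inv2) (use assms I.a_subset in auto)
    then show "x \<ominus> y \<in> I"
      using a_coset_join1[of I "x \<oplus> \<ominus> y"] assms I.a_subgroup by (simp add: minus_eq)
  next
    assume "x \<ominus> y \<in> I"
    then have "I +> (x \<oplus> \<ominus> y) = I"
      using a_coset_join2[of "x \<oplus> \<ominus> y" I] assms I.a_subgroup by (simp add: minus_eq)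
    then show "I +> x = I +> y"
      by (rule a_coset_add_inv1) (use assms I.a_subset in auto)
  qed
qed

text \<open>Product and scalar action of the quotient are unions over all representatives. They are
  single cosets because \<open>a \<otimes> b\<close> and \<open>x \<otimes> y\<close> differ by
  \<open>(a \<ominus> x) \<otimes> b \<oplus> x \<otimes> (b \<ominus> y)\<close>, and
  \<open>k \<odot> a\<close> and \<open>k \<odot> x\<close> by
  \<open>k \<odot> (a \<ominus> x)\<close>. The last element lies in \<open>I\<close> because
  \<open>I\<close> is a subspace.\<close>

lemma (in rng_algebra) quotient_hom:
  assumes I: "alg_ideal I"
  shows "rng_algebra_hom K A (quotient_algebra A I) (\<lambda>x. I +> x)"
    and "(\<lambda>x. I +> x) ` carrier A = carrier (quotient_algebra A I)"
    and "x \<in> carrier A \<Longrightarrow> I +> x = \<zero>\<^bsub>quotient_algebra A I\<^esub> \<longleftrightarrow> x \<in> I"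
proof -
  note sub = alg_ideal_additive_subgroup[OF I]
  interpret I: additive_subgroup I A by (rule sub)
  interpret I: abelian_subgroup I A by (rule abelian_subgroupI3) (rule sub, rule abelian_group_axioms)
  note sI = alg_ideal_subspace[OF I]
  have rep: "a \<in> carrier A \<and> a \<ominus> x \<in> I" if "x \<in> carrier A" "a \<in> I +> x" for a x
  proof -
    have "a \<in> carrier A" using that a_r_coset_subset_G[OF I.a_subset that(1)] by blast
    moreover have "I +> x = I +> a"
      using that I.a_subgroup by (intro a_repr_independence)
    ultimately show ?thesis using coset_eq_iff[OF sub, of a x] that by simp
  qed
  have self: "x \<in> I +> x" if "x \<in> carrier A" for x
    using that I.a_rcos_self by blast
  show im: "(\<lambda>x. I +> x) ` carrier A = carrier (quotient_algebra A I)"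
    by (auto simp: quotient_algebra_def A_RCOSETS_def RCOSETS_def a_r_coset_def)
  have mult: "I +> (x \<otimes> y) = (I +> x) \<otimes>\<^bsub>quotient_algebra A I\<^esub> (I +> y)"
    if xy: "x \<in> carrier A" "y \<in> carrier A" for x y
  proof -
    have "I +> (a \<otimes> b) = I +> (x \<otimes> y)" if ab: "a \<in> I +> x" "b \<in> I +> y" for a b
    proof -
      have c: "a \<in> carrier A" "b \<in> carrier A" "a \<ominus> x \<in> I" "b \<ominus> y \<in> I"
        using rep xy ab by blast+
      have "(a \<ominus> x) \<otimes> b \<oplus> x \<otimes> (b \<ominus> y) = a \<otimes> b \<ominus> x \<otimes> y"
        using c xy mult_closed[of a b] mult_closed[of x b] mult_closed[of x y]
        by (simp add: mult_diff_left mult_diff_right diff_add_diff)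
      moreover have "(a \<ominus> x) \<otimes> b \<oplus> x \<otimes> (b \<ominus> y) \<in> I"
        using c xy alg_ideal_left[OF I] alg_ideal_right[OF I] by simp
      ultimately show ?thesis
        using c xy mult_closed by (simp add: coset_eq_iff[OF sub])
    qed
    then have "rcoset_mult A I (I +> x) (I +> y) = (\<Union>a\<in>I +> x. \<Union>b\<in>I +> y. I +> (x \<otimes> y))"
      unfolding rcoset_mult_def by (intro SUP_cong refl)
    also have "\<dots> = I +> (x \<otimes> y)"
      using self[OF xy(1)] self[OF xy(2)] by blast
    finally have "rcoset_mult A I (I +> x) (I +> y) = I +> (x \<otimes> y)" .
    then show ?thesis by (simp add: quotient_algebra_def)
  qed
  have smult: "I +> (k \<odot> x) = k \<odot>\<^bsub>quotient_algebra A I\<^esub> (I +> x)"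
    if kx: "k \<in> carrier K" "x \<in> carrier A" for k x
  proof -
    have "I +> (k \<odot> a) = I +> (k \<odot> x)" if a: "a \<in> I +> x" for a
    proof -
      have c: "a \<in> carrier A" "a \<ominus> x \<in> I"
        using rep kx a by blast+
      have "k \<odot> a \<ominus> k \<odot> x = k \<odot> (a \<ominus> x)"
        using c kx by (simp add: smult_diff)
      moreover have "k \<odot> (a \<ominus> x) \<in> I"
        using c kx sI by (simp add: subspace_def)
      ultimately show ?thesis
        using c kx smult_closed by (simp add: coset_eq_iff[OF sub])
    qed
    then have "(\<Union>a\<in>I +> x. I +> (k \<odot> a)) = (\<Union>a\<in>I +> x. I +> (k \<odot> x))"
      by (intro SUP_cong refl)
    also have "\<dots> = I +> (k \<odot> x)"
      using self[OF kx(2)] by blast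
    finally have "(\<Union>a\<in>I +> x. I +> (k \<odot> a)) = I +> (k \<odot> x)" .
    then show ?thesis by (simp add: quotient_algebra_def)
  qed
  show "rng_algebra_hom K A (quotient_algebra A I) (\<lambda>x. I +> x)"
    by (rule surj_image_hom)
       (use im I.a_subset in \<open>auto simp: mult smult quotient_algebra_def I.a_rcos_sum\<close>)
  show "x \<in> carrier A \<Longrightarrow> I +> x = \<zero>\<^bsub>quotient_algebra A I\<^esub> \<longleftrightarrow> x \<in> I"
    using coset_eq_iff[OF sub, of x \<zero>] diff_add_cancel[of x \<zero>] I.a_subset
    by (simp add: quotient_algebra_def)
qed

section \<open>The free algebra\<close>

context field
begin

text \<open>The product of the free algebra detached from the support conditions: the algebraic laws
  hold for arbitrary functions into the field, and supports are treated separately through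
  \<open>convolution_nonzero\<close>.\<close>

definition convolution :: "('x list \<Rightarrow> 'a) \<Rightarrow> ('x list \<Rightarrow> 'a) \<Rightarrow> 'x list \<Rightarrow> 'a" where
  "convolution f g w = (\<Oplus>i\<in>{..length w}. f (take i w) \<otimes> g (drop i w))"

lemma convolution_Nil:
  "f [] \<in> carrier R \<Longrightarrow> g [] \<in> carrier R \<Longrightarrow> convolution f g [] = f [] \<otimes> g []"
  by (simp add: convolution_def)

lemma convolution_Cons:
  assumes "f \<in> UNIV \<rightarrow> carrier R" "g \<in> UNIV \<rightarrow> carrier R"
  shows "convolution f g (x # w) = f [] \<otimes> g (x # w) \<oplus> convolution (\<lambda>u. f (x # u)) g w"
proof -
  have "convolution f g (x # w) = (\<Oplus>i\<in>{..Suc (length w)}. f (take i (x # w)) \<otimes> g (drop i (x # w)))"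
    by (simp add: convolution_def)
  also have "\<dots> = (\<Oplus>i\<in>{..length w}. f (x # take i w) \<otimes> g (drop i w)) \<oplus> f [] \<otimes> g (x # w)"
    using assms by (subst finsum_Suc2) (auto simp: Pi_iff)
  finally show ?thesis
    using assms by (simp add: convolution_def a_comm Pi_iff)
qed

lemma convolution_closed:
  "f \<in> UNIV \<rightarrow> carrier R \<Longrightarrow> g \<in> UNIV \<rightarrow> carrier R \<Longrightarrow> convolution f g w \<in> carrier R"
  unfolding convolution_def by (intro finsum_closed) (auto simp: Pi_iff)

lemma convolution_add_left:
  assumes "f \<in> UNIV \<rightarrow> carrier R" "g \<in> UNIV \<rightarrow> carrier R" "h \<in> UNIV \<rightarrow> carrier R"
  shows "convolution (\<lambda>w. f w \<oplus> g w) h w = convolution f h w \<oplus> convolution g h w"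
  using assms unfolding convolution_def
  by (simp add: l_distr Pi_iff)

lemma convolution_add_right:
  assumes "f \<in> UNIV \<rightarrow> carrier R" "g \<in> UNIV \<rightarrow> carrier R" "h \<in> UNIV \<rightarrow> carrier R"
  shows "convolution h (\<lambda>w. f w \<oplus> g w) w = convolution h f w \<oplus> convolution h g w"
  using assms unfolding convolution_def
  by (simp add: r_distr Pi_iff)

lemma convolution_smult_left:
  assumes "f \<in> UNIV \<rightarrow> carrier R" "h \<in> UNIV \<rightarrow> carrier R" "k \<in> carrier R"
  shows "convolution (\<lambda>w. k \<otimes> f w) h w = k \<otimes> convolution f h w"
  using assms unfolding convolution_def
  by (simp add: finsum_rdistr m_assoc Pi_iff)

lemma convolution_smult_right:
  assumes "f \<in> UNIV \<rightarrow> carrier R" "h \<in> UNIV \<rightarrow> carrier R" "k \<in> carrier R"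
  shows "convolution h (\<lambda>w. k \<otimes> f w) w = k \<otimes> convolution h f w"
  using assms unfolding convolution_def
  by (simp add: finsum_rdistr m_lcomm Pi_iff)

text \<open>Splitting off the first letter replaces the left factor \<open>f\<close> by
  \<open>\<lambda>u. f (x # u)\<close>, up to a term with the scalar \<open>f []\<close>. Induction
  on the word works because the claim is made for all \<open>f\<close> at once.\<close>

lemma convolution_assoc:
  fixes f g h :: "'x list \<Rightarrow> 'a"
  assumes "f \<in> UNIV \<rightarrow> carrier R" "g \<in> UNIV \<rightarrow> carrier R" "h \<in> UNIV \<rightarrow> carrier R"
  shows "convolution (convolution f g) h w = convolution f (convolution g h) w"
  using assms
proof (induction w arbitrary: f g)
  case Nil
  then show ?case
    by (simp add: convolution_Nil convolution_closed m_assoc Pi_iff)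
next
  case (Cons x w)
  let ?f = "\<lambda>u. f (x # u)" and ?g = "\<lambda>u. g (x # u)"
  have fg: "?f \<in> UNIV \<rightarrow> carrier R" "?g \<in> UNIV \<rightarrow> carrier R"
    using Cons.prems by auto
  have c: "convolution a b \<in> UNIV \<rightarrow> carrier R"
    if "a \<in> UNIV \<rightarrow> carrier R" "b \<in> UNIV \<rightarrow> carrier R" for a b :: "'x list \<Rightarrow> 'a"
    using convolution_closed[OF that] by auto
  have m: "(\<lambda>w. f [] \<otimes> ?g w) \<in> UNIV \<rightarrow> carrier R"
    using Cons.prems by auto
  have "(\<lambda>u. convolution f g (x # u)) = (\<lambda>u. f [] \<otimes> ?g u \<oplus> convolution ?f g u)"
    using Cons.prems by (simp add: convolution_Cons)
  then have "convolution (\<lambda>u. convolution f g (x # u)) h w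
    = f [] \<otimes> convolution ?g h w \<oplus> convolution ?f (convolution g h) w"
    using convolution_add_left[OF m c[OF fg(1) Cons.prems(2)] Cons.prems(3)]
      convolution_smult_left[OF fg(2) Cons.prems(3), of "f []"] Cons.IH[OF fg(1) Cons.prems(2,3)]
      funcset_mem[OF Cons.prems(1) UNIV_I, of "[]"]
    by simp
  moreover have "f [] \<in> carrier R" "g [] \<in> carrier R" "h (x # w) \<in> carrier R"
    "convolution ?g h w \<in> carrier R" "convolution ?f (convolution g h) w \<in> carrier R"
    using Cons.prems c fg by (auto intro!: convolution_closed)
  ultimately show ?case
    using Cons.prems fg c
    by (simp add: convolution_Cons convolution_Nil convolution_closed r_distr m_assoc a_assoc Pi_iff)
qed

lemma convolution_nonzero:
  assumes "f \<in> UNIV \<rightarrow> carrier R" "g \<in> UNIV \<rightarrow> carrier R" "convolution f g w \<noteq> \<zero>"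
  shows "\<exists>u v. w = u @ v \<and> f u \<noteq> \<zero> \<and> g v \<noteq> \<zero>"
proof (rule ccontr)
  assume no: "\<not> ?thesis"
  have "f (take i w) \<otimes> g (drop i w) = \<zero>" for i
    using no assms(1,2) by (metis append_take_drop_id PiE UNIV_I l_null r_null)
  then have "convolution f g w = \<zero>"
    by (simp add: convolution_def)
  then show False using assms by simp
qed

definition free_monomial :: "'x list \<Rightarrow> 'x list \<Rightarrow> 'a" where
  "free_monomial u = (\<lambda>w. if w = u then \<one> else \<zero>)"

lemma free_gen_monomial: "free_gen R x = free_monomial [x]"
  by (auto simp: free_gen_def free_monomial_def)

text \<open>Only the split of the word at position \<open>length u\<close> can contribute to the
  sum.\<close>

lemma convolution_monomial:
  "convolution (free_monomial u) (free_monomial v) = free_monomial (u @ v)"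
proof
  fix w
  show "convolution (free_monomial u) (free_monomial v) w = free_monomial (u @ v) w"
  proof (cases "w = u @ v")
    case True
    have "convolution (free_monomial u) (free_monomial v) w
      = (\<Oplus>i\<in>{..length w}. if length u = i then \<one> else \<zero>)"
      unfolding convolution_def
    proof (intro finsum_cong')
      fix i assume i: "i \<in> {..length w}"
      have "take i w = u \<longleftrightarrow> length u = i"
      proof
        assume "take i w = u"
        then have "length (take i w) = length u" by simp
        then show "length u = i" using i by simp
      qed (use True in auto)
      then show "free_monomial u (take i w) \<otimes> free_monomial v (drop i w) = (if length u = i then \<one> else \<zero>)"
        using True by (auto simp: free_monomial_def)
    qed auto
    also have "\<dots> = \<one>"
      by (rule finsum_singleton) (use True in auto)
    finally show ?thesis using True by (simp add: free_monomial_def)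
  next
    case False
    have "convolution (free_monomial u) (free_monomial v) w = \<zero>"
    proof (rule ccontr)
      assume "convolution (free_monomial u) (free_monomial v) w \<noteq> \<zero>"
      then obtain a b where "w = a @ b" "free_monomial u a \<noteq> \<zero>" "free_monomial v b \<noteq> \<zero>"
        using convolution_nonzero[of "free_monomial u" "free_monomial v" w]
        by (auto simp: free_monomial_def)
      then show False using False by (auto simp: free_monomial_def split: if_splits)
    qed
    then show ?thesis using False by (simp add: free_monomial_def)
  qed
qed

lemma free_algebra_carrier:
  "f \<in> carrier (free_algebra R Y) \<longleftrightarrow> (\<forall>w. f w \<in> carrier R) \<and> finite {w. f w \<noteq> \<zero>} \<and>
     (\<forall>w. f w \<noteq> \<zero> \<longrightarrow> w \<noteq> [] \<and> set w \<subseteq> Y)"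
  by (simp add: free_algebra_def)

lemma free_algebra_simps:
  "\<zero>\<^bsub>free_algebra R Y\<^esub> = (\<lambda>w. \<zero>)"
  "f \<oplus>\<^bsub>free_algebra R Y\<^esub> g = (\<lambda>w. f w \<oplus> g w)"
  "f \<otimes>\<^bsub>free_algebra R Y\<^esub> g = convolution f g"
  "k \<odot>\<^bsub>free_algebra R Y\<^esub> f = (\<lambda>w. k \<otimes> f w)"
  by (auto simp: free_algebra_def convolution_def)

lemma free_algebra_Pi: "f \<in> carrier (free_algebra R Y) \<Longrightarrow> f \<in> UNIV \<rightarrow> carrier R"
  by (simp add: free_algebra_carrier Pi_iff)

lemma free_algebra_closed:
  shows free_zero: "(\<lambda>w. \<zero>) \<in> carrier (free_algebra R Y)"
    and free_add: "f \<in> carrier (free_algebra R Y) \<Longrightarrow> g \<in> carrier (free_algebra R Y)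
          \<Longrightarrow> (\<lambda>w. f w \<oplus> g w) \<in> carrier (free_algebra R Y)"
    and free_smult: "k \<in> carrier R \<Longrightarrow> f \<in> carrier (free_algebra R Y)
          \<Longrightarrow> (\<lambda>w. k \<otimes> f w) \<in> carrier (free_algebra R Y)"
    and free_mult: "f \<in> carrier (free_algebra R Y) \<Longrightarrow> g \<in> carrier (free_algebra R Y)
          \<Longrightarrow> convolution f g \<in> carrier (free_algebra R Y)"
    and free_monomial_closed: "w \<noteq> [] \<Longrightarrow> set w \<subseteq> Y \<Longrightarrow> free_monomial w \<in> carrier (free_algebra R Y)"
proof -
  show "(\<lambda>w. \<zero>) \<in> carrier (free_algebra R Y)" by (simp add: free_algebra_carrier)
next
  assume f: "f \<in> carrier (free_algebra R Y)" and g: "g \<in> carrier (free_algebra R Y)"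
  have "finite {w. f w \<oplus> g w \<noteq> \<zero>}"
    by (rule finite_subset[of _ "{w. f w \<noteq> \<zero>} \<union> {w. g w \<noteq> \<zero>}"])
       (use f g in \<open>auto simp: free_algebra_carrier\<close>)
  moreover have "w \<noteq> [] \<and> set w \<subseteq> Y" if "f w \<oplus> g w \<noteq> \<zero>" for w
    using that f g by (metis free_algebra_carrier l_zero zero_closed)
  ultimately show "(\<lambda>w. f w \<oplus> g w) \<in> carrier (free_algebra R Y)"
    using f g by (simp add: free_algebra_carrier)
  have fg: "f \<in> UNIV \<rightarrow> carrier R" "g \<in> UNIV \<rightarrow> carrier R"
    using f g by (simp_all add: free_algebra_Pi)
  have "finite {w. convolution f g w \<noteq> \<zero>}"
  proof (rule finite_subset)
    show "{w. convolution f g w \<noteq> \<zero>} \<subseteq> (\<lambda>(u, v). u @ v) ` ({w. f w \<noteq> \<zero>} \<times> {w. g w \<noteq> \<zero>})"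
    proof
      fix w assume "w \<in> {w. convolution f g w \<noteq> \<zero>}"
      then obtain u v where "w = u @ v" "f u \<noteq> \<zero>" "g v \<noteq> \<zero>"
        using convolution_nonzero[OF fg, of w] by auto
      then show "w \<in> (\<lambda>(u, v). u @ v) ` ({w. f w \<noteq> \<zero>} \<times> {w. g w \<noteq> \<zero>})"
        by (intro image_eqI[of _ _ "(u, v)"]) auto
    qed
    show "finite ((\<lambda>(u, v). u @ v) ` ({w. f w \<noteq> \<zero>} \<times> {w. g w \<noteq> \<zero>}))"
      using f g by (simp add: free_algebra_carrier)
  qed
  moreover have "w \<noteq> [] \<and> set w \<subseteq> Y" if "convolution f g w \<noteq> \<zero>" for w
  proof -
    obtain u v where "w = u @ v" "f u \<noteq> \<zero>" "g v \<noteq> \<zero>"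
      using convolution_nonzero[OF fg \<open>convolution f g w \<noteq> \<zero>\<close>] by auto
    moreover from this have "u \<noteq> []" "set u \<subseteq> Y" "set v \<subseteq> Y"
      using f g unfolding free_algebra_carrier by blast+
    ultimately show ?thesis by simp
  qed
  ultimately show "convolution f g \<in> carrier (free_algebra R Y)"
    using convolution_closed[OF fg] by (simp add: free_algebra_carrier)
next
  assume f: "f \<in> carrier (free_algebra R Y)" and k: "k \<in> carrier R"
  have "finite {w. k \<otimes> f w \<noteq> \<zero>}"
    by (rule finite_subset[of _ "{w. f w \<noteq> \<zero>}"]) (use f k in \<open>auto simp: free_algebra_carrier\<close>)
  moreover have "f w \<noteq> \<zero>" if "k \<otimes> f w \<noteq> \<zero>" for w
    using that k by auto
  ultimately show "(\<lambda>w. k \<otimes> f w) \<in> carrier (free_algebra R Y)"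
    using f k by (simp add: free_algebra_carrier)
next
  assume "w \<noteq> []" "set w \<subseteq> Y"
  then show "free_monomial w \<in> carrier (free_algebra R Y)"
    by (auto simp: free_algebra_carrier free_monomial_def)
qed

lemma rng_algebra_free_algebra: "rng_algebra R (free_algebra R Y)"
proof -
  note [simp] = free_algebra_simps
  note [intro] = free_algebra_closed free_algebra_Pi
  have cl: "f w \<in> carrier R" if "f \<in> carrier (free_algebra R Y)" for f w
    using that by (simp add: free_algebra_carrier)
  have ab: "abelian_group (free_algebra R Y)"
  proof (rule abelian_groupI)
    fix f assume f: "f \<in> carrier (free_algebra R Y)"
    have "(\<lambda>w. (\<ominus> \<one>) \<otimes> f w) \<in> carrier (free_algebra R Y)"
      using f by (intro free_smult) auto
    moreover have "(\<lambda>w. (\<ominus> \<one>) \<otimes> f w) \<oplus>\<^bsub>free_algebra R Y\<^esub> f = \<zero>\<^bsub>free_algebra R Y\<^esub>"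
      using f by (auto simp: cl l_neg l_minus)
    ultimately show "\<exists>g\<in>carrier (free_algebra R Y). g \<oplus>\<^bsub>free_algebra R Y\<^esub> f = \<zero>\<^bsub>free_algebra R Y\<^esub>"
      by blast
  qed (auto simp: cl a_ac)
  show ?thesis
    by (intro rng_algebra.intro rng.intro ab rng_axioms.intro rng_algebra_axioms.intro field_axioms)
       (auto simp: cl fun_eq_iff convolution_assoc convolution_add_left convolution_add_right
          convolution_smult_left convolution_smult_right free_algebra_Pi l_distr r_distr m_assoc)
qed

text \<open>Functions supported in a finite set \<open>S\<close> are treated by induction on
  \<open>S\<close>: a word is split off by setting the value there to zero.\<close>

lemma free_algebra_induct [consumes 1, case_names zero add monomial]:
  assumes f: "f \<in> carrier (free_algebra R Y)"
    and zero: "Q (\<lambda>w. \<zero>)"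
    and add: "\<And>f g. \<lbrakk>f \<in> carrier (free_algebra R Y); g \<in> carrier (free_algebra R Y); Q f; Q g\<rbrakk>
        \<Longrightarrow> Q (\<lambda>w. f w \<oplus> g w)"
    and monomial: "\<And>k w. \<lbrakk>k \<in> carrier R; w \<noteq> []; set w \<subseteq> Y\<rbrakk> \<Longrightarrow> Q (\<lambda>u. k \<otimes> free_monomial w u)"
  shows "Q f"
proof -
  have "\<And>f. f \<in> carrier (free_algebra R Y) \<Longrightarrow> {w. f w \<noteq> \<zero>} \<subseteq> S \<Longrightarrow> Q f" if "finite S" for S
    using that
  proof (induction S rule: finite_induct)
    case empty
    then have "f = (\<lambda>w. \<zero>)" by auto
    then show ?case using zero by simp
  next
    case (insert w S)
    show ?case
    proof (cases "f w = \<zero>")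
      case True
      then show ?thesis using insert by (intro insert.IH) auto
    next
      case False
      let ?g = "f(w := \<zero>)" and ?m = "\<lambda>u. f w \<otimes> free_monomial w u"
      have w: "w \<noteq> []" "set w \<subseteq> Y" "\<And>u. f u \<in> carrier R"
        using insert.prems False by (auto simp: free_algebra_carrier)
      have g: "?g \<in> carrier (free_algebra R Y)"
        using insert.prems by (auto simp: free_algebra_carrier elim: rev_finite_subset)
      moreover have "Q ?g"
      proof (rule insert.IH[OF g])
        show "{u. ?g u \<noteq> \<zero>} \<subseteq> S" using insert.prems by auto
      qed
      moreover have "Q ?m"
        using w by (intro monomial)
      moreover have "?m \<in> carrier (free_algebra R Y)"
        using w by (intro free_smult free_monomial_closed)
      ultimately have "Q (\<lambda>u. ?g u \<oplus> ?m u)"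
        by (intro add)
      moreover have "(\<lambda>u. ?g u \<oplus> ?m u) = f"
        using w by (auto simp: free_monomial_def fun_eq_iff)
      ultimately show ?thesis by simp
    qed
  qed
  from this[of "{w. f w \<noteq> \<zero>}" f] show ?thesis
    using f by (simp add: free_algebra_carrier)
qed

end

section \<open>The universal property of the free algebra\<close>

context rng_algebra
begin

text \<open>The value at the empty word is junk: the free algebra has no such word.\<close>

fun word_value :: "('x \<Rightarrow> 'a) \<Rightarrow> 'x list \<Rightarrow> 'a" where
  "word_value \<iota> [] = \<zero>"
| "word_value \<iota> [x] = \<iota> x"
| "word_value \<iota> (x # y # w) = \<iota> x \<otimes> word_value \<iota> (y # w)"

lemma word_value_closed:
  "\<iota> \<in> Y \<rightarrow> carrier A \<Longrightarrow> set w \<subseteq> Y \<Longrightarrow> word_value \<iota> w \<in> carrier A"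
  by (induction \<iota> w rule: word_value.induct) (auto simp: mult_closed Pi_iff)

lemma word_value_append:
  "\<iota> \<in> Y \<rightarrow> carrier A \<Longrightarrow> set u \<subseteq> Y \<Longrightarrow> set v \<subseteq> Y \<Longrightarrow> u \<noteq> [] \<Longrightarrow> v \<noteq> [] \<Longrightarrow>
    word_value \<iota> (u @ v) = word_value \<iota> u \<otimes> word_value \<iota> v"
proof (induction \<iota> u rule: word_value.induct)
  case (2 \<iota> x)
  then show ?case by (cases v) auto
next
  case (3 \<iota> x y w)
  then have "word_value \<iota> (y # w) \<in> carrier A" "word_value \<iota> v \<in> carrier A" "\<iota> x \<in> carrier A"
    using word_value_closed[of \<iota> Y "y # w"] word_value_closed[of \<iota> Y v] by auto
  then show ?case using 3 by (simp add: mult_assoc)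
qed auto

text \<open>Evaluation of a noncommutative polynomial without constant term at the elements
  \<open>\<iota> x\<close>.\<close>

definition free_lift :: "('x \<Rightarrow> 'a) \<Rightarrow> ('x list \<Rightarrow> 'k) \<Rightarrow> 'a" where
  "free_lift \<iota> f = (\<Oplus>w\<in>{w. f w \<noteq> \<zero>\<^bsub>K\<^esub>}. f w \<odot> word_value \<iota> w)"

text \<open>Two evaluations can be added termwise only over a common index set, whereas
  \<open>free_lift\<close> sums over the support of its own argument. The words added here have
  coefficient zero.\<close>

lemma free_lift_superset:
  assumes \<iota>: "\<iota> \<in> Y \<rightarrow> carrier A" and f: "f \<in> carrier (free_algebra K Y)"
    and S: "finite S" "{w. f w \<noteq> \<zero>\<^bsub>K\<^esub>} \<subseteq> S" "\<And>w. w \<in> S \<Longrightarrow> set w \<subseteq> Y"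
  shows "free_lift \<iota> f = (\<Oplus>w\<in>S. f w \<odot> word_value \<iota> w)"
proof -
  have "f w \<in> carrier K" for w
    using f by (simp add: K.free_algebra_carrier)
  moreover have "word_value \<iota> w \<in> carrier A" if "w \<in> S" for w
    using word_value_closed[OF \<iota>] S that by blast
  ultimately show ?thesis
    unfolding free_lift_def using S
    by (intro add.finprod_mono_neutral_cong_left)
       (auto simp: smult_zero_left smult_closed Pi_iff)
qed

lemma free_lift_monomial:
  assumes \<iota>: "\<iota> \<in> Y \<rightarrow> carrier A" and w: "w \<noteq> []" "set w \<subseteq> Y" and k: "k \<in> carrier K"
  shows "free_lift \<iota> (\<lambda>u. k \<otimes>\<^bsub>K\<^esub> K.free_monomial w u) = k \<odot> word_value \<iota> w"
proof -
  have "free_lift \<iota> (\<lambda>u. k \<otimes>\<^bsub>K\<^esub> K.free_monomial w u)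
    = (\<Oplus>u\<in>{w}. (k \<otimes>\<^bsub>K\<^esub> K.free_monomial w u) \<odot> word_value \<iota> u)"
    using w k
    by (intro free_lift_superset[OF \<iota>] K.free_smult K.free_monomial_closed)
       (auto simp: K.free_monomial_def)
  then show ?thesis
    using word_value_closed[OF \<iota> w(2)] k by (simp add: K.free_monomial_def smult_closed)
qed

text \<open>Both sides of multiplicativity are bilinear, so two inductions over finitely supported
  functions reduce it to a product of two monomials, where it is
  \<open>word_value_append\<close>.\<close>

lemma rng_algebra_hom_free_lift:
  assumes \<iota>: "\<iota> \<in> Y \<rightarrow> carrier A"
  shows "rng_algebra_hom K (free_algebra K Y) A (free_lift \<iota>)"
proof -
  let ?F = "free_algebra K Y"
  interpret F: rng_algebra K ?F by (rule K.rng_algebra_free_algebra)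
  note simps = K.free_algebra_simps
  have clK: "f w \<in> carrier K" if "f \<in> carrier ?F" for f w
    using that by (simp add: K.free_algebra_carrier)
  have S: "finite {w. f w \<noteq> \<zero>\<^bsub>K\<^esub>}" "f w \<noteq> \<zero>\<^bsub>K\<^esub> \<Longrightarrow> set w \<subseteq> Y" if "f \<in> carrier ?F" for f w
    using that by (simp_all add: K.free_algebra_carrier)
  have closed: "free_lift \<iota> f \<in> carrier A" if "f \<in> carrier ?F" for f
    unfolding free_lift_def
  proof (intro finsum_closed Pi_I smult_closed clK that)
    fix w assume "w \<in> {w. f w \<noteq> \<zero>\<^bsub>K\<^esub>}"
    then show "word_value \<iota> w \<in> carrier A"
      using S(2)[OF that, of w] by (intro word_value_closed[OF \<iota>]) auto
  qed
  have lift_add: "free_lift \<iota> (\<lambda>w. f w \<oplus>\<^bsub>K\<^esub> g w) = free_lift \<iota> f \<oplus> free_lift \<iota> g"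
    if fg: "f \<in> carrier ?F" "g \<in> carrier ?F" for f g
  proof -
    define S where "S = {w. f w \<noteq> \<zero>\<^bsub>K\<^esub>} \<union> {w. g w \<noteq> \<zero>\<^bsub>K\<^esub>}"
    have T: "finite S" "\<And>w. w \<in> S \<Longrightarrow> set w \<subseteq> Y"
      using S fg by (auto simp: S_def)
    have v: "word_value \<iota> w \<in> carrier A" if "w \<in> S" for w
      using word_value_closed[OF \<iota>] T(2) that by blast
    have "free_lift \<iota> (\<lambda>w. f w \<oplus>\<^bsub>K\<^esub> g w) = (\<Oplus>w\<in>S. (f w \<oplus>\<^bsub>K\<^esub> g w) \<odot> word_value \<iota> w)"
    proof (rule free_lift_superset[OF \<iota> K.free_add[OF fg] T(1) _ T(2)])
      show "{w. f w \<oplus>\<^bsub>K\<^esub> g w \<noteq> \<zero>\<^bsub>K\<^esub>} \<subseteq> S" by (auto simp: S_def fg clK)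
    qed
    also have "\<dots> = (\<Oplus>w\<in>S. f w \<odot> word_value \<iota> w \<oplus> g w \<odot> word_value \<iota> w)"
      by (intro finsum_cong') (auto simp: v clK fg smult_closed smult_l_distr)
    also have "\<dots> = (\<Oplus>w\<in>S. f w \<odot> word_value \<iota> w) \<oplus> (\<Oplus>w\<in>S. g w \<odot> word_value \<iota> w)"
      by (intro finsum_addf) (auto simp: v clK fg smult_closed)
    also have "(\<Oplus>w\<in>S. f w \<odot> word_value \<iota> w) = free_lift \<iota> f"
      by (rule free_lift_superset[OF \<iota> fg(1) T(1) _ T(2), symmetric]) (auto simp: S_def)
    also have "(\<Oplus>w\<in>S. g w \<odot> word_value \<iota> w) = free_lift \<iota> g"
      by (rule free_lift_superset[OF \<iota> fg(2) T(1) _ T(2), symmetric]) (auto simp: S_def)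
    finally show ?thesis .
  qed
  have lift_smult: "free_lift \<iota> (\<lambda>w. k \<otimes>\<^bsub>K\<^esub> f w) = k \<odot> free_lift \<iota> f"
    if k: "k \<in> carrier K" and f: "f \<in> carrier ?F" for k f
  proof -
    let ?S = "{w. f w \<noteq> \<zero>\<^bsub>K\<^esub>}"
    have v: "word_value \<iota> w \<in> carrier A" if "w \<in> ?S" for w
      using word_value_closed[OF \<iota>] S(2)[OF f] that by blast
    have "free_lift \<iota> (\<lambda>w. k \<otimes>\<^bsub>K\<^esub> f w) = (\<Oplus>w\<in>?S. (k \<otimes>\<^bsub>K\<^esub> f w) \<odot> word_value \<iota> w)"
      by (rule free_lift_superset[OF \<iota> K.free_smult[OF k f] S(1)[OF f]]) (use k f S in auto)
    also have "\<dots> = (\<Oplus>w\<in>?S. k \<odot> (f w \<odot> word_value \<iota> w))"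
      by (intro finsum_cong') (auto simp: v clK f k smult_closed smult_assoc)
    also have "\<dots> = k \<odot> free_lift \<iota> f"
      unfolding free_lift_def
      by (intro finsum_smult[symmetric]) (auto simp: v clK f k smult_closed S(1))
    finally show ?thesis .
  qed
  have lift_zero: "free_lift \<iota> (\<lambda>w. \<zero>\<^bsub>K\<^esub>) = \<zero>"
    by (simp add: free_lift_def)
  have mult: "free_lift \<iota> (f \<otimes>\<^bsub>?F\<^esub> g) = free_lift \<iota> f \<otimes> free_lift \<iota> g"
    if f: "f \<in> carrier ?F" and g: "g \<in> carrier ?F" for f g
    using f
  proof (induction f rule: K.free_algebra_induct)
    case zero
    then show ?case
      using F.mult_zero_left[OF g] by (simp add: simps lift_zero closed g mult_zero_left)
  next
    case (add a b)
    from add.hyps have "(\<lambda>w. a w \<oplus>\<^bsub>K\<^esub> b w) \<otimes>\<^bsub>?F\<^esub> g = (\<lambda>w. (a \<otimes>\<^bsub>?F\<^esub> g) w \<oplus>\<^bsub>K\<^esub> (b \<otimes>\<^bsub>?F\<^esub> g) w)"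
      using F.distrib_right[of a b g] g by (simp add: simps)
    then show ?case
      using add.hyps add.IH g by (simp add: lift_add closed distrib_right F.mult_closed)
  next
    case (monomial k u)
    let ?u = "K.free_monomial u"
    have u: "?u \<in> carrier ?F" "word_value \<iota> u \<in> carrier A"
      using monomial by (auto intro!: K.free_monomial_closed word_value_closed[OF \<iota>])
    have main: "free_lift \<iota> (?u \<otimes>\<^bsub>?F\<^esub> g) = word_value \<iota> u \<otimes> free_lift \<iota> g"
      using g
    proof (induction g rule: K.free_algebra_induct)
      case zero
      then show ?case
        using F.mult_zero_right[OF u(1)] by (simp add: simps lift_zero closed u mult_zero_right)
    next
      case (add a b)
      from add.hyps have "?u \<otimes>\<^bsub>?F\<^esub> (\<lambda>w. a w \<oplus>\<^bsub>K\<^esub> b w) = (\<lambda>w. (?u \<otimes>\<^bsub>?F\<^esub> a) w \<oplus>\<^bsub>K\<^esub> (?u \<otimes>\<^bsub>?F\<^esub> b) w)"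
        using F.distrib_left[of a b ?u] u by (simp add: simps)
      then show ?case
        using add.hyps add.IH u by (simp add: lift_add closed distrib_left F.mult_closed)
    next
      case (monomial l v)
      have v: "K.free_monomial v \<in> carrier ?F" "word_value \<iota> v \<in> carrier A"
        using monomial by (auto intro!: K.free_monomial_closed word_value_closed[OF \<iota>])
      have "?u \<otimes>\<^bsub>?F\<^esub> (\<lambda>w. l \<otimes>\<^bsub>K\<^esub> K.free_monomial v w) = (\<lambda>w. l \<otimes>\<^bsub>K\<^esub> K.free_monomial (u @ v) w)"
        using F.smult_mult_right[OF monomial(1) u(1) v(1)] by (simp add: simps K.convolution_monomial)
      then show ?case
        using monomial \<open>u \<noteq> []\<close> \<open>set u \<subseteq> Y\<close> u v \<iota>
        by (simp add: free_lift_monomial smult_mult_right word_value_append)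
    qed
    have "(\<lambda>w. k \<otimes>\<^bsub>K\<^esub> ?u w) \<otimes>\<^bsub>?F\<^esub> g = (\<lambda>w. k \<otimes>\<^bsub>K\<^esub> (?u \<otimes>\<^bsub>?F\<^esub> g) w)"
      using F.smult_mult_left[OF monomial(1) u(1) g] by (simp add: simps)
    then have "free_lift \<iota> ((\<lambda>w. k \<otimes>\<^bsub>K\<^esub> ?u w) \<otimes>\<^bsub>?F\<^esub> g) = k \<odot> (word_value \<iota> u \<otimes> free_lift \<iota> g)"
      using lift_smult[OF monomial(1) F.mult_closed[OF u(1) g]] main by simp
    then show ?case
      using free_lift_monomial[OF \<iota> monomial(2,3,1)] smult_mult_left[OF monomial(1) u(2) closed[OF g]]
      by simp
  qed
  show ?thesis
  proof (unfold_locales, goal_cases)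
    case (2 f g)
    then show ?case using lift_add[of f g] by (simp add: simps)
  next
    case (4 k f)
    then show ?case using lift_smult[of k f] by (simp add: simps)
  qed (simp_all add: closed mult)
qed

lemma free_lift_gen:
  assumes "\<iota> \<in> Y \<rightarrow> carrier A" "x \<in> Y"
  shows "free_lift \<iota> (free_gen K x) = \<iota> x"
proof -
  have "free_gen K x = (\<lambda>u. \<one>\<^bsub>K\<^esub> \<otimes>\<^bsub>K\<^esub> K.free_monomial [x] u)"
    by (auto simp: K.free_gen_monomial K.free_monomial_def)
  moreover have "\<iota> x \<in> carrier A" using assms by auto
  ultimately show ?thesis
    using free_lift_monomial[OF assms(1), of "[x]" "\<one>\<^bsub>K\<^esub>"] assms by (simp add: smult_one)
qed

end

context field
begin

lemma free_gen_closed: "x \<in> Y \<Longrightarrow> free_gen R x \<in> carrier (free_algebra R Y)"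
  unfolding free_gen_monomial by (rule free_monomial_closed) auto

lemma free_monomial_Cons:
  "x # y # w = u \<Longrightarrow> free_monomial u = free_gen R x \<otimes>\<^bsub>free_algebra R Y\<^esub> free_monomial (y # w)"
  by (auto simp: free_gen_monomial free_algebra_simps convolution_monomial)

text \<open>A word is built from its last letter by prepending letters, hence closure under left
  multiplication by generators suffices. The later generation principles inherit this one-sided
  form.\<close>

lemma free_algebra_generated:
  assumes sub: "rng_algebra.subspace R (free_algebra R Y) S"
    and gen: "\<And>x. x \<in> Y \<Longrightarrow> free_gen R x \<in> S"
    and left: "\<And>x f. x \<in> Y \<Longrightarrow> f \<in> S \<Longrightarrow> free_gen R x \<otimes>\<^bsub>free_algebra R Y\<^esub> f \<in> S"
  shows "carrier (free_algebra R Y) \<subseteq> S"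
proof
  interpret F: rng_algebra R "free_algebra R Y" by (rule rng_algebra_free_algebra)
  have mono: "w \<noteq> [] \<Longrightarrow> set w \<subseteq> Y \<Longrightarrow> free_monomial w \<in> S" for w
  proof (induction w rule: induct_list012)
    case (2 x)
    then show ?case using gen by (simp add: free_gen_monomial[symmetric])
  next
    case (3 x y w)
    then show ?case
      using left[of x "free_monomial (y # w)"] by (simp add: free_monomial_Cons[OF refl, of x y w Y])
  qed simp
  fix f assume "f \<in> carrier (free_algebra R Y)"
  then show "f \<in> S"
  proof (induction rule: free_algebra_induct)
    case zero
    then show ?case using sub by (simp add: F.subspace_def free_algebra_simps)
  next
    case (add f g)
    from add.IH show ?case using sub by (simp add: F.subspace_def free_algebra_simps)
  next
    case (monomial k w)
    from monomial show ?case using sub mono[of w] by (simp add: F.subspace_def free_algebra_simps)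
  qed
qed

end

section \<open>Leavitt families and the universal property\<close>

text \<open>The value on a coset is taken at a chosen representative; another representative differs
  by an element of \<open>I\<close>, which \<open>h\<close> kills.\<close>

lemma (in rng_algebra_hom) kernel_factor:
  assumes I: "A.alg_ideal I" "I \<subseteq> kernel"
  obtains g where "rng_algebra_hom K (quotient_algebra A I) B g"
    and "\<And>x. x \<in> carrier A \<Longrightarrow> g (I +>\<^bsub>A\<^esub> x) = h x"
proof -
  interpret q: rng_algebra_hom K A "quotient_algebra A I" "\<lambda>x. I +>\<^bsub>A\<^esub> x"
    by (rule A.quotient_hom(1)[OF I(1)])
  note sub = A.alg_ideal_additive_subgroup[OF I(1)]
  define g where "g Z = h (SOME x. x \<in> carrier A \<and> I +>\<^bsub>A\<^esub> x = Z)" for Z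
  have g: "g (I +>\<^bsub>A\<^esub> x) = h x" if x: "x \<in> carrier A" for x
  proof -
    define y where "y = (SOME y. y \<in> carrier A \<and> I +>\<^bsub>A\<^esub> y = I +>\<^bsub>A\<^esub> x)"
    have y: "y \<in> carrier A \<and> I +>\<^bsub>A\<^esub> y = I +>\<^bsub>A\<^esub> x"
      unfolding y_def by (rule someI[of _ x]) (simp add: x)
    then have "y \<ominus>\<^bsub>A\<^esub> x \<in> kernel"
      using A.coset_eq_iff[OF sub, of y x] x I(2) by blast
    then have "h y = h x"
      using y x hom_closed by (simp add: kernel_def hom_diff B.diff_eq_zero_iff)
    then show ?thesis by (simp add: g_def y_def)
  qed
  have ex: "\<exists>x\<in>carrier A. Z = I +>\<^bsub>A\<^esub> x" if "Z \<in> carrier (quotient_algebra A I)" for Z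
    using that A.quotient_hom(2)[OF I(1)] by blast
  have "rng_algebra_hom K (quotient_algebra A I) B g"
  proof (unfold_locales, goal_cases)
    case (1 Z)
    then show ?case using ex[of Z] g hom_closed by auto
  next
    case (2 Z Z')
    then obtain x y where "x \<in> carrier A" "y \<in> carrier A" "Z = I +>\<^bsub>A\<^esub> x" "Z' = I +>\<^bsub>A\<^esub> y"
      using ex by metis
    then show ?case by (simp add: q.hom_add[symmetric] g hom_add)
  next
    case (3 Z Z')
    then obtain x y where "x \<in> carrier A" "y \<in> carrier A" "Z = I +>\<^bsub>A\<^esub> x" "Z' = I +>\<^bsub>A\<^esub> y"
      using ex by metis
    then show ?case by (simp add: q.hom_mult[symmetric] g hom_mult A.mult_closed)
  next
    case (4 k Z)
    then obtain x where "x \<in> carrier A" "Z = I +>\<^bsub>A\<^esub> x"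
      using ex by metis
    then show ?case using 4 by (simp add: q.hom_smult[symmetric] g hom_smult A.smult_closed)
  qed
  then show thesis using that g by blast
qed

lemma leavitt_relation_closed:
  assumes "rng A" "wf_digraph E" "\<iota> \<in> leavitt_gens E \<rightarrow> carrier A" "leavitt_relation A \<iota> E a b"
  shows "a \<in> carrier A" "b \<in> carrier A"
proof -
  interpret rng A by fact
  interpret E: wf_digraph E by fact
  have c: "v \<in> verts E \<Longrightarrow> \<iota> (Vertex v) \<in> carrier A" "e \<in> arcs E \<Longrightarrow> \<iota> (Edge e) \<in> carrier A"
    "e \<in> arcs E \<Longrightarrow> \<iota> (Ghost e) \<in> carrier A" for v e
    using assms(3) by (auto simp: leavitt_gens_def)
  show "a \<in> carrier A" "b \<in> carrier A"
    using assms(4)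
    by (cases rule: leavitt_relation.cases;
        auto simp: c mult_closed regular_vertex_def out_arcs_def Pi_iff intro!: finsum_closed)+
qed

context rng_algebra_hom
begin

lemma hom_leavitt_sum:
  assumes "wf_digraph E" "\<iota> \<in> leavitt_gens E \<rightarrow> carrier A"
  shows "h (\<Oplus>\<^bsub>A\<^esub>e\<in>out_arcs E v. \<iota> (Edge e) \<otimes>\<^bsub>A\<^esub> \<iota> (Ghost e))
    = (\<Oplus>\<^bsub>B\<^esub>e\<in>out_arcs E v. h (\<iota> (Edge e)) \<otimes>\<^bsub>B\<^esub> h (\<iota> (Ghost e)))"
proof -
  have c: "e \<in> arcs E \<Longrightarrow> \<iota> (Edge e) \<in> carrier A" "e \<in> arcs E \<Longrightarrow> \<iota> (Ghost e) \<in> carrier A" for e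
    using assms(2) by (auto simp: leavitt_gens_def)
  have "h (\<Oplus>\<^bsub>A\<^esub>e\<in>out_arcs E v. \<iota> (Edge e) \<otimes>\<^bsub>A\<^esub> \<iota> (Ghost e))
    = (\<Oplus>\<^bsub>B\<^esub>e\<in>out_arcs E v. h (\<iota> (Edge e) \<otimes>\<^bsub>A\<^esub> \<iota> (Ghost e)))"
    by (rule hom_finsum) (auto simp: c A.mult_closed)
  also have "\<dots> = (\<Oplus>\<^bsub>B\<^esub>e\<in>out_arcs E v. h (\<iota> (Edge e)) \<otimes>\<^bsub>B\<^esub> h (\<iota> (Ghost e)))"
    by (rule B.finsum_cong') (auto simp: c hom_mult hom_closed B.mult_closed)
  finally show ?thesis .
qed

text \<open>Agreement on generators is enough, because the relations mention nothing else. The sum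
  at a regular vertex is the only relation that takes more than compatibility with products and
  zero.\<close>

lemma leavitt_relation_image:
  assumes "wf_digraph E" "\<iota> \<in> leavitt_gens E \<rightarrow> carrier A" "leavitt_relation A \<iota> E a b"
    and eq: "\<And>x. x \<in> leavitt_gens E \<Longrightarrow> \<kappa> x = h (\<iota> x)"
  shows "leavitt_relation B \<kappa> E (h a) (h b)"
proof -
  interpret E: wf_digraph E by fact
  have c: "v \<in> verts E \<Longrightarrow> \<iota> (Vertex v) \<in> carrier A" "e \<in> arcs E \<Longrightarrow> \<iota> (Edge e) \<in> carrier A"
    "e \<in> arcs E \<Longrightarrow> \<iota> (Ghost e) \<in> carrier A" for v e
    using assms(2) by (auto simp: leavitt_gens_def)
  have k: "v \<in> verts E \<Longrightarrow> h (\<iota> (Vertex v)) = \<kappa> (Vertex v)"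
    "e \<in> arcs E \<Longrightarrow> h (\<iota> (Edge e)) = \<kappa> (Edge e)" "e \<in> arcs E \<Longrightarrow> h (\<iota> (Ghost e)) = \<kappa> (Ghost e)" for v e
    using eq by (auto simp: leavitt_gens_def)
  have kc: "e \<in> arcs E \<Longrightarrow> \<kappa> (Edge e) \<in> carrier B" "e \<in> arcs E \<Longrightarrow> \<kappa> (Ghost e) \<in> carrier B" for e
    using hom_closed c k by metis+
  from assms(3) show ?thesis
  proof (cases rule: leavitt_relation.cases)
    case (regular v)
    have "(\<Oplus>\<^bsub>B\<^esub>e\<in>out_arcs E v. h (\<iota> (Edge e)) \<otimes>\<^bsub>B\<^esub> h (\<iota> (Ghost e)))
      = (\<Oplus>\<^bsub>B\<^esub>e\<in>out_arcs E v. \<kappa> (Edge e) \<otimes>\<^bsub>B\<^esub> \<kappa> (Ghost e))"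
      by (rule B.finsum_cong') (auto simp: k kc B.mult_closed)
    then have "h b = (\<Oplus>\<^bsub>B\<^esub>e\<in>out_arcs E v. \<kappa> (Edge e) \<otimes>\<^bsub>B\<^esub> \<kappa> (Ghost e))"
      using regular hom_leavitt_sum[OF assms(1,2), of v] by simp
    moreover have "h a = \<kappa> (Vertex v)"
      using regular k by (simp add: regular_vertex_def)
    ultimately show ?thesis
      using leavitt_relation.regular[OF regular(3), of B \<kappa>] by simp
  qed (auto simp: c k hom_mult hom_zero intro: leavitt_relation.intros)
qed

text \<open>Each relation of the image family is the image of the relation with the same vertices or
  edges upstairs. Thus the image of a family under a homomorphism is a family without further
  checks.\<close>

lemma leavitt_relation_preimage:
  assumes "wf_digraph E" "\<iota> \<in> leavitt_gens E \<rightarrow> carrier A"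
    "leavitt_relation B (\<lambda>x. h (\<iota> x)) E a b"
  obtains a' b' where "leavitt_relation A \<iota> E a' b'" "a = h a'" "b = h b'"
proof -
  interpret E: wf_digraph E by fact
  have c: "v \<in> verts E \<Longrightarrow> \<iota> (Vertex v) \<in> carrier A" "e \<in> arcs E \<Longrightarrow> \<iota> (Edge e) \<in> carrier A"
    "e \<in> arcs E \<Longrightarrow> \<iota> (Ghost e) \<in> carrier A" for v e
    using assms(2) by (auto simp: leavitt_gens_def)
  from assms(3) have "\<exists>a' b'. leavitt_relation A \<iota> E a' b' \<and> a = h a' \<and> b = h b'"
  proof (cases rule: leavitt_relation.cases)
    case (vertex_idem v)
    then show ?thesis
      using leavitt_relation.vertex_idem[OF vertex_idem(3), of A \<iota>] c hom_mult by metis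
  next
    case (vertex_orth v w)
    then show ?thesis
      using leavitt_relation.vertex_orth[OF vertex_orth(3-5), of A \<iota>] c hom_mult hom_zero by metis
  next
    case (source_edge e)
    then show ?thesis
      using leavitt_relation.source_edge[OF source_edge(3), of A \<iota>] c hom_mult E.tail_in_verts by metis
  next
    case (edge_range e)
    then show ?thesis
      using leavitt_relation.edge_range[OF edge_range(3), of A \<iota>] c hom_mult E.head_in_verts by metis
  next
    case (range_ghost e)
    then show ?thesis
      using leavitt_relation.range_ghost[OF range_ghost(3), of A \<iota>] c hom_mult E.head_in_verts by metis
  next
    case (ghost_source e)
    then show ?thesis
      using leavitt_relation.ghost_source[OF ghost_source(3), of A \<iota>] c hom_mult E.tail_in_verts by metis
  next
    case (ghost_edge e)
    then show ?thesis
      using leavitt_relation.ghost_edge[OF ghost_edge(3), of A \<iota>] c hom_mult by metis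
  next
    case (ghost_edge_orth e f)
    then show ?thesis
      using leavitt_relation.ghost_edge_orth[OF ghost_edge_orth(3-5), of A \<iota>] c hom_mult hom_zero by metis
  next
    case (regular v)
    then show ?thesis
      using leavitt_relation.regular[OF regular(3), of A \<iota>] hom_leavitt_sum[OF assms(1,2), of v] by metis
  qed
  then show thesis using that by blast
qed

end

text \<open>Generators may be sent to zero and need not be distinct. This freedom is essential: the
  images of a family in \<open>T\<close> and in \<open>T/Soc(T)\<close> are again families over the
  old graph, although vertices may die there.\<close>

locale leavitt_family = rng_algebra K A + E: wf_digraph E
  for K :: "('k, 'm) ring_scheme" and A :: "('k, 'a) module" (structure)
    and E :: "('v, 'e) pre_digraph" and \<iota> :: "('v, 'e) leavitt_gen \<Rightarrow> 'a" +
  assumes gen_closed: "\<iota> \<in> leavitt_gens E \<rightarrow> carrier A"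
    and relations: "leavitt_relation A \<iota> E a b \<Longrightarrow> a = b"

text \<open>Generation is phrased as an induction principle with one-sided closure, as in
  \<open>free_algebra_generated\<close>. In this form it passes to homomorphic images by taking
  preimages of subspaces.\<close>

locale leavitt_generating_family = leavitt_family +
  assumes generated: "\<lbrakk>subspace S; \<And>x. x \<in> leavitt_gens E \<Longrightarrow> \<iota> x \<in> S;
      \<And>x y. \<lbrakk>x \<in> leavitt_gens E; y \<in> S\<rbrakk> \<Longrightarrow> \<iota> x \<otimes> y \<in> S\<rbrakk> \<Longrightarrow> carrier A \<subseteq> S"

definition leavitt_element ::
    "('k, 'm) ring_scheme \<Rightarrow> ('v, 'e) pre_digraph \<Rightarrow> ('v, 'e) leavitt_gen
      \<Rightarrow> (('v, 'e) leavitt_gen list \<Rightarrow> 'k) set" where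
  "leavitt_element K E x = leavitt_ideal K E +>\<^bsub>free_algebra K (leavitt_gens E)\<^esub> free_gen K x"

context field
begin

text \<open>The whole free algebra is one of the ideals being intersected, so the family is nonempty
  and the intersection inherits the closure properties.\<close>

lemma
  assumes "wf_digraph E"
  shows alg_ideal_leavitt_ideal:
      "rng_algebra.alg_ideal R (free_algebra R (leavitt_gens E)) (leavitt_ideal R E)"
    and leavitt_ideal_relation:
      "leavitt_relation (free_algebra R (leavitt_gens E)) (free_gen R) E a b
        \<Longrightarrow> a \<ominus>\<^bsub>free_algebra R (leavitt_gens E)\<^esub> b \<in> leavitt_ideal R E"
    and leavitt_ideal_least:
      "\<lbrakk>rng_algebra.alg_ideal R (free_algebra R (leavitt_gens E)) I;
        \<And>a b. leavitt_relation (free_algebra R (leavitt_gens E)) (free_gen R) E a b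
          \<Longrightarrow> a \<ominus>\<^bsub>free_algebra R (leavitt_gens E)\<^esub> b \<in> I\<rbrakk> \<Longrightarrow> leavitt_ideal R E \<subseteq> I"
proof -
  let ?F = "free_algebra R (leavitt_gens E)"
  interpret F: rng_algebra R ?F by (rule rng_algebra_free_algebra)
  define J where "J = {I. rng_ideal I ?F \<and> submodule I R ?F \<and>
               (\<forall>a b. leavitt_relation ?F (free_gen R) E a b \<longrightarrow> a \<ominus>\<^bsub>?F\<^esub> b \<in> I)}"
  have J: "F.alg_ideal I" if "I \<in> J" for I
    using that by (simp add: F.alg_ideal_def J_def)
  have eq: "leavitt_ideal R E = \<Inter>J"
    by (simp add: leavitt_ideal_def J_def Let_def)
  have "F.alg_ideal (carrier ?F)"
    by (rule F.alg_idealI) (auto simp: F.subspace_def F.smult_closed F.mult_closed)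
  moreover have "a \<ominus>\<^bsub>?F\<^esub> b \<in> carrier ?F" if "leavitt_relation ?F (free_gen R) E a b" for a b
    using leavitt_relation_closed[OF F.rng_axioms assms _ that] free_gen_closed[of _ "leavitt_gens E"]
    by (intro F.minus_closed) auto
  ultimately have carr: "carrier ?F \<in> J"
    by (simp add: J_def F.alg_ideal_def)
  note sub = F.alg_ideal_subspace[OF J, unfolded F.subspace_def]
  show "F.alg_ideal (leavitt_ideal R E)"
    unfolding eq
  proof (rule F.alg_idealI)
    show "F.subspace (\<Inter>J)"
      using carr sub unfolding F.subspace_def by blast
  next
    fix x a assume "x \<in> \<Inter>J" "a \<in> carrier ?F"
    then show "a \<otimes>\<^bsub>?F\<^esub> x \<in> \<Inter>J" "x \<otimes>\<^bsub>?F\<^esub> a \<in> \<Inter>J"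
      using F.alg_ideal_left[OF J] F.alg_ideal_right[OF J] by blast+
  qed
  show "leavitt_relation ?F (free_gen R) E a b \<Longrightarrow> a \<ominus>\<^bsub>?F\<^esub> b \<in> leavitt_ideal R E"
    unfolding eq by (auto simp: J_def)
  show "\<lbrakk>F.alg_ideal I; \<And>a b. leavitt_relation ?F (free_gen R) E a b \<Longrightarrow> a \<ominus>\<^bsub>?F\<^esub> b \<in> I\<rbrakk>
      \<Longrightarrow> leavitt_ideal R E \<subseteq> I"
    unfolding eq by (auto simp: J_def F.alg_ideal_def)
qed

text \<open>The relations hold because their differences lie in the ideal; generation is pulled back
  along the quotient map to the free algebra.\<close>

lemma leavitt_path_algebra_family:
  assumes E: "wf_digraph E"
  shows "leavitt_generating_family R (leavitt_path_algebra R E) E (leavitt_element R E)"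
proof -
  let ?F = "free_algebra R (leavitt_gens E)" and ?L = "leavitt_path_algebra R E"
  let ?q = "\<lambda>x. leavitt_ideal R E +>\<^bsub>?F\<^esub> x"
  interpret E: wf_digraph E by fact
  interpret F: rng_algebra R ?F by (rule rng_algebra_free_algebra)
  note I = alg_ideal_leavitt_ideal[OF E]
  interpret q: rng_algebra_hom R ?F ?L ?q
    unfolding leavitt_path_algebra_def by (rule F.quotient_hom(1)[OF I])
  have gen: "free_gen R \<in> leavitt_gens E \<rightarrow> carrier ?F"
    using free_gen_closed by auto
  have el: "leavitt_element R E = (\<lambda>x. ?q (free_gen R x))"
    by (simp add: leavitt_element_def fun_eq_iff)
  have surj: "?q ` carrier ?F = carrier ?L"
    unfolding leavitt_path_algebra_def by (rule F.quotient_hom(2)[OF I])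
  show ?thesis
  proof (unfold_locales, goal_cases)
    case 1
    then show ?case using gen q.hom_closed by (auto simp: el)
  next
    case (2 a b)
    then obtain a' b' where ab: "leavitt_relation ?F (free_gen R) E a' b'" "a = ?q a'" "b = ?q b'"
      using q.leavitt_relation_preimage[OF E gen, of a b] unfolding el by blast
    have "a' \<in> carrier ?F" "b' \<in> carrier ?F"
      using leavitt_relation_closed[OF F.rng_axioms E gen ab(1)] by auto
    then show ?case
      using leavitt_ideal_relation[OF E ab(1)] F.coset_eq_iff[OF F.alg_ideal_additive_subgroup[OF I]] ab
      by simp
  next
    case (3 S)
    have "carrier ?F \<subseteq> {x \<in> carrier ?F. ?q x \<in> S}"
    proof (rule free_algebra_generated)
      show "F.subspace {x \<in> carrier ?F. ?q x \<in> S}"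
        using 3(1) by (rule q.subspace_vimage)
    next
      fix x assume "x \<in> leavitt_gens E"
      then show "free_gen R x \<in> {x \<in> carrier ?F. ?q x \<in> S}"
        using 3(2)[of x] gen by (auto simp: el)
    next
      fix x f assume "x \<in> leavitt_gens E" "f \<in> {x \<in> carrier ?F. ?q x \<in> S}"
      then show "free_gen R x \<otimes>\<^bsub>?F\<^esub> f \<in> {x \<in> carrier ?F. ?q x \<in> S}"
        using 3(3)[of x "?q f"] funcset_mem[OF gen, of x] q.hom_mult[of "free_gen R x" f]
        by (simp add: el F.mult_closed)
    qed
    then show ?case unfolding surj[symmetric] by auto
  qed
qed

end

text \<open>The evaluation of the free algebra at \<iota> has as kernel an algebra ideal containing
  the differences of all relations. Minimality of \<open>leavitt_ideal\<close> puts that ideal into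
  the kernel, and the evaluation factors.\<close>

lemma (in leavitt_family) leavitt_lift:
  obtains h where "rng_algebra_hom K (leavitt_path_algebra K E) A h"
    and "\<And>x. x \<in> leavitt_gens E \<Longrightarrow> h (leavitt_element K E x) = \<iota> x"
proof -
  let ?F = "free_algebra K (leavitt_gens E)"
  note E = E.wf_digraph_axioms
  interpret f: rng_algebra_hom K ?F A "free_lift \<iota>"
    by (rule rng_algebra_hom_free_lift[OF gen_closed])
  have gen: "free_gen K \<in> leavitt_gens E \<rightarrow> carrier ?F"
    using K.free_gen_closed by auto
  have "leavitt_ideal K E \<subseteq> f.kernel"
  proof (rule K.leavitt_ideal_least[OF E f.alg_ideal_kernel])
    fix a b assume ab: "leavitt_relation ?F (free_gen K) E a b"
    have "leavitt_relation A \<iota> E (free_lift \<iota> a) (free_lift \<iota> b)"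
      by (rule f.leavitt_relation_image[OF E gen ab]) (simp add: free_lift_gen[OF gen_closed])
    then have "free_lift \<iota> a = free_lift \<iota> b" by (rule relations)
    moreover have "a \<in> carrier ?F" "b \<in> carrier ?F"
      using leavitt_relation_closed[OF f.A.rng_axioms E gen ab] by auto
    ultimately show "a \<ominus>\<^bsub>?F\<^esub> b \<in> f.kernel"
      using f.hom_closed[of b] by (simp add: f.kernel_def f.hom_diff diff_eq_zero_iff)
  qed
  then obtain g where "rng_algebra_hom K (leavitt_path_algebra K E) A g"
    "\<And>x. x \<in> carrier ?F \<Longrightarrow> g (leavitt_ideal K E +>\<^bsub>?F\<^esub> x) = free_lift \<iota> x"
    using f.kernel_factor[OF K.alg_ideal_leavitt_ideal[OF E]]
    unfolding leavitt_path_algebra_def by blast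
  then show thesis
    using that[of g] funcset_mem[OF gen] free_lift_gen[OF gen_closed]
    by (simp add: leavitt_element_def)
qed

text \<open>The elements where two homomorphisms agree form a subspace to which the generation
  principle applies. This is the uniqueness half of the universal property.\<close>

lemma (in leavitt_generating_family) hom_eqI:
  assumes "rng_algebra_hom K A B g" "rng_algebra_hom K A B h"
    and eq: "\<And>x. x \<in> leavitt_gens E \<Longrightarrow> g (\<iota> x) = h (\<iota> x)" and x: "x \<in> carrier A"
  shows "g x = h x"
proof -
  interpret g: rng_algebra_hom K A B g by fact
  interpret h: rng_algebra_hom K A B h by fact
  have "carrier A \<subseteq> {x \<in> carrier A. g x = h x}"
    using funcset_mem[OF gen_closed] eq
    by (intro generated)
       (auto simp: subspace_def g.hom_zero h.hom_zero g.hom_add h.hom_add g.hom_mult h.hom_mult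
          g.hom_smult h.hom_smult mult_closed smult_closed)
  with x show ?thesis by blast
qed

lemma (in leavitt_generating_family) generating_image:
  assumes h: "rng_algebra_hom K A B h" and surj: "h ` carrier A = carrier B"
  shows "leavitt_generating_family K B E (\<lambda>x. h (\<iota> x))"
proof -
  interpret h: rng_algebra_hom K A B h by fact
  show ?thesis
  proof (unfold_locales, goal_cases)
    case 1
    then show ?case using gen_closed h.hom_closed by auto
  next
    case (2 a b)
    then obtain a' b' where "leavitt_relation A \<iota> E a' b'" "a = h a'" "b = h b'"
      using h.leavitt_relation_preimage[OF E.wf_digraph_axioms gen_closed] by blast
    then show ?case using relations by blast
  next
    case (3 S)
    have "carrier A \<subseteq> {x \<in> carrier A. h x \<in> S}"
    proof (rule generated[OF h.subspace_vimage[OF 3(1)]])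
      fix x assume "x \<in> leavitt_gens E"
      then show "\<iota> x \<in> {x \<in> carrier A. h x \<in> S}"
        using 3(2)[of x] gen_closed by auto
    next
      fix x f assume "x \<in> leavitt_gens E" "f \<in> {x \<in> carrier A. h x \<in> S}"
      then show "\<iota> x \<otimes> f \<in> {x \<in> carrier A. h x \<in> S}"
        using 3(3)[of x "h f"] funcset_mem[OF gen_closed, of x] h.hom_mult[of "\<iota> x" f]
        by (simp add: mult_closed)
    qed
    then show ?case unfolding surj[symmetric] by auto
  qed
qed

lemma (in leavitt_generating_family) surj_if_gens:
  assumes h: "rng_algebra_hom K B A h" and gens: "\<And>x. x \<in> leavitt_gens E \<Longrightarrow> \<iota> x \<in> h ` carrier B"
  shows "h ` carrier B = carrier A"
proof -
  interpret h: rng_algebra_hom K B A h by fact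
  have "h.A.subspace (carrier B)"
    by (simp add: h.A.subspace_def h.A.smult_closed)
  then have "subspace (h ` carrier B)" by (rule h.subspace_image)
  then have "carrier A \<subseteq> h ` carrier B"
  proof (rule generated)
    fix x y assume "x \<in> leavitt_gens E" "y \<in> h ` carrier B"
    then obtain a b where "a \<in> carrier B" "b \<in> carrier B" "\<iota> x = h a" "y = h b"
      using gens[of x] by auto
    then have "\<iota> x \<otimes> y = h (a \<otimes>\<^bsub>B\<^esub> b)" "a \<otimes>\<^bsub>B\<^esub> b \<in> carrier B"
      by (simp_all add: h.hom_mult h.A.mult_closed)
    then show "\<iota> x \<otimes> y \<in> h ` carrier B" by blast
  qed (rule gens)
  then show ?thesis using h.hom_closed by blast
qed

section \<open>Paths in a Leavitt family\<close>

context leavitt_family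
begin

abbreviation vtx :: "'v \<Rightarrow> 'a" where "vtx v \<equiv> \<iota> (Vertex v)"
abbreviation edg :: "'e \<Rightarrow> 'a" where "edg e \<equiv> \<iota> (Edge e)"
abbreviation gho :: "'e \<Rightarrow> 'a" where "gho e \<equiv> \<iota> (Ghost e)"

lemma vtx_closed [simp]: "v \<in> verts E \<Longrightarrow> vtx v \<in> carrier A"
  and edg_closed [simp]: "e \<in> arcs E \<Longrightarrow> edg e \<in> carrier A"
  and gho_closed [simp]: "e \<in> arcs E \<Longrightarrow> gho e \<in> carrier A"
  using gen_closed by (auto simp: leavitt_gens_def)

lemma vtx_idem: "v \<in> verts E \<Longrightarrow> vtx v \<otimes> vtx v = vtx v"
  and vtx_orth: "\<lbrakk>v \<in> verts E; w \<in> verts E; v \<noteq> w\<rbrakk> \<Longrightarrow> vtx v \<otimes> vtx w = \<zero>"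
  and tail_edg: "e \<in> arcs E \<Longrightarrow> vtx (tail E e) \<otimes> edg e = edg e"
  and edg_head: "e \<in> arcs E \<Longrightarrow> edg e \<otimes> vtx (head E e) = edg e"
  and head_gho: "e \<in> arcs E \<Longrightarrow> vtx (head E e) \<otimes> gho e = gho e"
  and gho_tail: "e \<in> arcs E \<Longrightarrow> gho e \<otimes> vtx (tail E e) = gho e"
  and gho_edg: "e \<in> arcs E \<Longrightarrow> gho e \<otimes> edg e = vtx (head E e)"
  and gho_edg_orth: "\<lbrakk>e \<in> arcs E; f \<in> arcs E; e \<noteq> f\<rbrakk> \<Longrightarrow> gho e \<otimes> edg f = \<zero>"
  by (blast intro: relations leavitt_relation.intros)+

lemma vtx_regular: "regular_vertex E v \<Longrightarrow> vtx v = (\<Oplus>e\<in>out_arcs E v. edg e \<otimes> gho e)"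
  by (rule relations) (rule leavitt_relation.regular)

text \<open>A path is given by its list of edges together with its range.\<close>

primrec path :: "'e list \<Rightarrow> 'v \<Rightarrow> 'a" where
  "path [] v = vtx v"
| "path (e # p) v = edg e \<otimes> path p v"

text \<open>For \<open>p = e\<^sub>1...e\<^sub>n\<close> this is
  \<open>e\<^sub>n\<^sup>*...e\<^sub>1\<^sup>*\<close>. The vertex argument is still the range of
  \<open>p\<close>, which is now the left end of the product.\<close>

primrec ghost_path :: "'e list \<Rightarrow> 'v \<Rightarrow> 'a" where
  "ghost_path [] v = vtx v"
| "ghost_path (e # p) v = ghost_path p v \<otimes> gho e"

lemma awalk_Cons [simp]:
  "E.awalk u (e # p) v \<longleftrightarrow> e \<in> arcs E \<and> u = tail E e \<and> E.awalk (head E e) p v"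
  by (auto simp: E.awalk_Cons_iff)

lemma awalk_Nil [simp]: "E.awalk u [] v \<longleftrightarrow> u = v \<and> u \<in> verts E"
  by (simp add: E.awalk_Nil_iff)

lemma awalk_verts: "E.awalk u p v \<Longrightarrow> u \<in> verts E" "E.awalk u p v \<Longrightarrow> v \<in> verts E"
  by (simp_all add: E.awalk_hd_in_verts E.awalk_last_in_verts)

lemma path_closed: "E.awalk u p v \<Longrightarrow> path p v \<in> carrier A"
  by (induction p arbitrary: u) (auto simp: mult_closed awalk_verts)

lemma ghost_path_closed: "E.awalk u p v \<Longrightarrow> ghost_path p v \<in> carrier A"
  by (induction p arbitrary: u) (auto simp: mult_closed awalk_verts)

lemma vtx_path: "E.awalk u p v \<Longrightarrow> vtx u \<otimes> path p v = path p v"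
proof (cases p)
  case (Cons e q)
  assume "E.awalk u p v"
  then show ?thesis
    using Cons path_closed[of _ q v] by (auto simp: mult_assoc[symmetric] tail_edg)
qed (auto simp: vtx_idem)

lemma path_vtx: "E.awalk u p v \<Longrightarrow> path p v \<otimes> vtx v = path p v"
proof (induction p arbitrary: u)
  case (Cons e p)
  then show ?case
    using path_closed[of _ p v] awalk_verts[of _ p v] by (auto simp: mult_assoc)
qed (auto simp: vtx_idem)

lemma ghost_path_vtx: "E.awalk u p v \<Longrightarrow> ghost_path p v \<otimes> vtx u = ghost_path p v"
proof (cases p)
  case (Cons e q)
  assume "E.awalk u p v"
  then show ?thesis
    using Cons ghost_path_closed[of _ q v] by (auto simp: mult_assoc gho_tail)
qed (auto simp: vtx_idem)

lemma vtx_ghost_path: "E.awalk u p v \<Longrightarrow> vtx v \<otimes> ghost_path p v = ghost_path p v"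
proof (induction p arbitrary: u)
  case (Cons e p)
  then show ?case
    using ghost_path_closed[of _ p v] awalk_verts[of _ p v] by (auto simp: mult_assoc[symmetric])
qed (auto simp: vtx_idem)

lemma vtx_path_orth: "E.awalk u p v \<Longrightarrow> x \<in> verts E \<Longrightarrow> x \<noteq> u \<Longrightarrow> vtx x \<otimes> path p v = \<zero>"
proof -
  assume a: "E.awalk u p v" "x \<in> verts E" "x \<noteq> u"
  have "vtx x \<otimes> (vtx u \<otimes> path p v) = \<zero>"
    using a awalk_verts[OF a(1)] path_closed[OF a(1)]
    by (simp add: mult_assoc[symmetric] vtx_orth mult_zero_left)
  then show ?thesis using vtx_path[OF a(1)] by simp
qed

lemma path_vtx_orth: "E.awalk u p v \<Longrightarrow> x \<in> verts E \<Longrightarrow> x \<noteq> v \<Longrightarrow> path p v \<otimes> vtx x = \<zero>"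
proof -
  assume a: "E.awalk u p v" "x \<in> verts E" "x \<noteq> v"
  have "(path p v \<otimes> vtx v) \<otimes> vtx x = \<zero>"
    using a awalk_verts[OF a(1)] path_closed[OF a(1)]
    by (simp add: mult_assoc vtx_orth mult_zero_right)
  then show ?thesis using path_vtx[OF a(1)] by simp
qed

lemma ghost_path_vtx_orth:
  "E.awalk u p v \<Longrightarrow> x \<in> verts E \<Longrightarrow> x \<noteq> u \<Longrightarrow> ghost_path p v \<otimes> vtx x = \<zero>"
proof -
  assume a: "E.awalk u p v" "x \<in> verts E" "x \<noteq> u"
  have "(ghost_path p v \<otimes> vtx u) \<otimes> vtx x = \<zero>"
    using a awalk_verts[OF a(1)] ghost_path_closed[OF a(1)]
    by (simp add: mult_assoc vtx_orth mult_zero_right)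
  then show ?thesis using ghost_path_vtx[OF a(1)] by simp
qed

lemma path_append:
  "E.awalk u p v \<Longrightarrow> E.awalk v q w \<Longrightarrow> path (p @ q) w = path p v \<otimes> path q w"
proof (induction p arbitrary: u)
  case Nil
  then show ?case using vtx_path by auto
next
  case (Cons e p)
  then have "E.awalk (head E e) p v" by simp
  from path_closed[OF this] show ?case
    using Cons path_closed[OF Cons.prems(2)] by (auto simp: mult_assoc)
qed

lemma ghost_path_append:
  "E.awalk u p v \<Longrightarrow> E.awalk v q w \<Longrightarrow> ghost_path (p @ q) w = ghost_path q w \<otimes> ghost_path p v"
proof (induction p arbitrary: u)
  case Nil
  then show ?case using ghost_path_vtx by auto
next
  case (Cons e p)
  then have "E.awalk (head E e) p v" by simp
  from ghost_path_closed[OF this] show ?case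
    using Cons ghost_path_closed[OF Cons.prems(2)] by (auto simp: mult_assoc)
qed

lemma ghost_path_path_append:
  "E.awalk u p v \<Longrightarrow> E.awalk v q w \<Longrightarrow> ghost_path p v \<otimes> path (p @ q) w = path q w"
proof (induction p arbitrary: u)
  case Nil
  then show ?case using vtx_path by auto
next
  case (Cons e p)
  then have p: "E.awalk (head E e) p v" "e \<in> arcs E" by auto
  then have pq: "E.awalk (head E e) (p @ q) w"
    using Cons.prems(2) by (auto simp: E.awalk_append_iff)
  have "ghost_path p v \<otimes> gho e \<otimes> (edg e \<otimes> path (p @ q) w)
    = ghost_path p v \<otimes> ((gho e \<otimes> edg e) \<otimes> path (p @ q) w)"
    using p path_closed[OF pq] ghost_path_closed[OF p(1)] by (simp add: mult_assoc mult_closed)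
  also have "\<dots> = path q w"
    using p vtx_path[OF pq] Cons.IH[OF p(1) Cons.prems(2)] by (simp add: gho_edg)
  finally show ?case by simp
qed

lemma ghost_path_path: "E.awalk u p v \<Longrightarrow> ghost_path p v \<otimes> path p v = vtx v"
  using ghost_path_path_append[of u p v "[]" v] awalk_verts(2)[of u p v] by simp

text \<open>At the first place where the words differ, \<open>e\<^sup>* f = 0\<close>. The length
  condition excludes that \<open>q\<close> is a proper prefix of \<open>p\<close>, where the product
  would be a ghost path. For empty \<open>p\<close> the excluded case is that \<open>q\<close>
  starts at \<open>v\<close>, and orthogonality of vertices takes over.\<close>

lemma ghost_path_path_orth:
  assumes "E.awalk u p v" "E.awalk x q w" "length p \<le> length q"
    "\<nexists>r. q = p @ r \<and> E.awalk v r w"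
  shows "ghost_path p v \<otimes> path q w = \<zero>"
  using assms
proof (induction p arbitrary: u x q)
  case Nil
  then have "x \<noteq> v" by auto
  then show ?case using Nil vtx_path_orth[of x q w v] by auto
next
  case (Cons e p)
  then obtain f r where q: "q = f # r" by (cases q) auto
  have p: "E.awalk (head E e) p v" "e \<in> arcs E" using Cons by auto
  have r: "E.awalk (head E f) r w" "f \<in> arcs E" using Cons q by auto
  have eq: "ghost_path p v \<otimes> gho e \<otimes> (edg f \<otimes> path r w)
    = ghost_path p v \<otimes> ((gho e \<otimes> edg f) \<otimes> path r w)"
    using p path_closed[OF r(1)] ghost_path_closed[OF p(1)] r by (simp add: mult_assoc mult_closed)
  show ?case
  proof (cases "e = f")
    case True
    then have "ghost_path p v \<otimes> path r w = \<zero>"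
      using Cons.prems q r by (intro Cons.IH[OF p(1)]) auto
    then show ?thesis using eq q True r vtx_path[OF r(1)] by (simp add: gho_edg)
  next
    case False
    then show ?thesis
      using eq q r p path_closed[OF r(1)] ghost_path_closed[OF p(1)]
      by (simp add: gho_edg_orth mult_zero_left mult_zero_right)
  qed
qed

text \<open>The products \<open>p q\<^sup>*\<close> are stable, up to zero, under left
  multiplication by \<open>e\<^sup>*\<close>: it meets the first edge of a nonempty
  \<open>p\<close>, and for empty \<open>p\<close> it is absorbed on the other side, since
  \<open>e\<^sup>* q\<^sup>*\<close> is the ghost of \<open>q @ [e]\<close>.\<close>

lemma gho_path_ghost_path:
  assumes e: "e \<in> arcs E" and p: "E.awalk u p v" and q: "E.awalk x q v"
  shows "gho e \<otimes> (path p v \<otimes> ghost_path q v) = \<zero> \<or>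
    (\<exists>u' p' v' x' q'. E.awalk u' p' v' \<and> E.awalk x' q' v' \<and>
       gho e \<otimes> (path p v \<otimes> ghost_path q v) = path p' v' \<otimes> ghost_path q' v')"
proof (cases p)
  case Nil
  then have v: "u = v" "v \<in> verts E" "path p v \<otimes> ghost_path q v = ghost_path q v"
    using p vtx_ghost_path[OF q] by auto
  show ?thesis
  proof (cases "tail E e = v")
    case True
    let ?h = "head E e"
    have h: "E.awalk v [e] ?h" using True e by auto
    have "ghost_path (q @ [e]) ?h = ghost_path [e] ?h \<otimes> ghost_path q v"
      by (rule ghost_path_append[OF q h])
    then have "gho e \<otimes> ghost_path q v = vtx ?h \<otimes> ghost_path (q @ [e]) ?h"
      using e head_gho vtx_ghost_path[of x "q @ [e]" ?h] q h by (simp add: E.awalk_append_iff)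
    moreover have "E.awalk x (q @ [e]) ?h" "E.awalk ?h [] ?h"
      using q h e by (auto simp: E.awalk_append_iff)
    ultimately show ?thesis
      using v(3) by (metis path.simps(1))
  next
    case False
    have "(gho e \<otimes> vtx (tail E e)) \<otimes> (vtx v \<otimes> ghost_path q v) = \<zero>"
    proof -
      have "(gho e \<otimes> vtx (tail E e)) \<otimes> (vtx v \<otimes> ghost_path q v)
        = gho e \<otimes> ((vtx (tail E e) \<otimes> vtx v) \<otimes> ghost_path q v)"
        using e v ghost_path_closed[OF q] by (simp add: mult_assoc mult_closed)
      then show ?thesis
        using False e v ghost_path_closed[OF q] by (simp add: vtx_orth mult_zero_left mult_zero_right)
    qed
    then show ?thesis using e v gho_tail vtx_ghost_path[OF q] by simp
  qed
next
  case (Cons f r)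
  then have f: "f \<in> arcs E" and r: "E.awalk (head E f) r v" using p by auto
  have eq: "gho e \<otimes> (path p v \<otimes> ghost_path q v) = (gho e \<otimes> edg f) \<otimes> (path r v \<otimes> ghost_path q v)"
    using Cons e f path_closed[OF r] ghost_path_closed[OF q] by (simp add: mult_assoc mult_closed)
  show ?thesis
  proof (cases "e = f")
    case True
    then have "gho e \<otimes> (path p v \<otimes> ghost_path q v) = path r v \<otimes> ghost_path q v"
      using eq f path_closed[OF r] ghost_path_closed[OF q] vtx_path[OF r]
      by (simp add: gho_edg mult_assoc[symmetric])
    then show ?thesis using r q by blast
  next
    case False
    then have "gho e \<otimes> (path p v \<otimes> ghost_path q v) = \<zero>"
      using eq e f path_closed[OF r] ghost_path_closed[OF q]
      by (simp add: gho_edg_orth mult_zero_left mult_closed)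
    then show ?thesis by simp
  qed
qed

end

section \<open>The spanning set of products of a path and a ghost path, and local units\<close>

context rng_algebra
begin

lemma subspace_mult_left_vimage:
  "subspace S \<Longrightarrow> a \<in> carrier A \<Longrightarrow> subspace {y \<in> carrier A. a \<otimes> y \<in> S}"
  unfolding subspace_def
  by (auto simp: mult_zero_right distrib_left smult_mult_right smult_closed)

lemma subspace_Inter:
  "\<S> \<noteq> {} \<Longrightarrow> (\<And>S. S \<in> \<S> \<Longrightarrow> subspace S) \<Longrightarrow> subspace (\<Inter>\<S>)"
  unfolding subspace_def by blast

lemma subspace_carrier: "subspace (carrier A)"
  by (simp add: subspace_def smult_closed)

end

context leavitt_generating_family
begin

text \<open>Left multiplication by a generator maps a product \<open>p q\<^sup>*\<close> to another
  such product or to zero, so the linear span of these products satisfies the generation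
  principle.\<close>

lemma spanned:
  assumes S: "subspace S"
    and paths: "\<And>u p v x q. E.awalk u p v \<Longrightarrow> E.awalk x q v \<Longrightarrow> path p v \<otimes> ghost_path q v \<in> S"
  shows "carrier A \<subseteq> S"
proof -
  define M where "M = {path p v \<otimes> ghost_path q v |u p v x q. E.awalk u p v \<and> E.awalk x q v}"
  \<comment> \<open>\<open>\<Inter>\<S>\<close> is the linear span of \<open>M\<close>.\<close>
  define \<S> where "\<S> = {S. subspace S \<and> M \<subseteq> S}"
  have sub: "subspace (\<Inter>\<S>)"
  proof (rule subspace_Inter)
    have "M \<subseteq> carrier A"
      by (auto simp: M_def intro!: mult_closed path_closed ghost_path_closed)
    then show "\<S> \<noteq> {}" using subspace_carrier by (auto simp: \<S>_def)
  qed (simp add: \<S>_def)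
  have M: "M \<subseteq> \<Inter>\<S>" by (auto simp: \<S>_def)
  have zero: "\<zero> \<in> \<Inter>\<S>" using sub by (simp add: subspace_def)
  have Mc: "M \<subseteq> carrier A" using sub M by (auto simp: subspace_def)
  have left: "\<iota> x \<otimes> m \<in> \<Inter>\<S>" if x: "x \<in> leavitt_gens E" and m: "m \<in> M" for x m
  proof -
    obtain u p v y q where pq: "E.awalk u p v" "E.awalk y q v" "m = path p v \<otimes> ghost_path q v"
      using m by (auto simp: M_def)
    have cl: "path p v \<in> carrier A" "ghost_path q v \<in> carrier A"
      using path_closed[OF pq(1)] ghost_path_closed[OF pq(2)] by auto
    from x consider (v) z where "x = Vertex z" "z \<in> verts E" | (e) e where "x = Edge e" "e \<in> arcs E"
      | (g) e where "x = Ghost e" "e \<in> arcs E"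
      by (auto simp: leavitt_gens_def)
    then have "\<iota> x \<otimes> m \<in> insert \<zero> M"
    proof cases
      case v
      then have "\<iota> x \<otimes> m = (vtx z \<otimes> path p v) \<otimes> ghost_path q v"
        using pq cl by (simp add: mult_assoc)
      then show ?thesis
        using vtx_path[OF pq(1)] vtx_path_orth[OF pq(1) v(2)] cl m pq(3)
        by (cases "z = u") (auto simp: mult_zero_left)
    next
      case e
      have eq: "\<iota> x \<otimes> m = (edg e \<otimes> path p v) \<otimes> ghost_path q v"
        using pq cl e by (simp add: mult_assoc)
      show ?thesis
      proof (cases "head E e = u")
        case True
        then have "E.awalk (tail E e) (e # p) v" using pq e by auto
        moreover have "\<iota> x \<otimes> m = path (e # p) v \<otimes> ghost_path q v" using eq by simp
        ultimately show ?thesis using pq(2) unfolding M_def by blast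
      next
        case False
        have "edg e \<otimes> path p v = edg e \<otimes> (vtx (head E e) \<otimes> path p v)"
          using e cl edg_head by (simp add: mult_assoc[symmetric])
        also have "\<dots> = \<zero>"
          using False e vtx_path_orth[OF pq(1)] by (simp add: mult_zero_right)
        finally show ?thesis using eq cl by (simp add: mult_zero_left)
      qed
    next
      case g
      then show ?thesis
        using gho_path_ghost_path[OF g(2) pq(1,2)] pq(3) unfolding M_def by blast
    qed
    then show ?thesis using M zero by auto
  qed
  have "carrier A \<subseteq> \<Inter>\<S>"
  proof (rule generated[OF sub])
    fix x assume x: "x \<in> leavitt_gens E"
    then consider (v) z where "x = Vertex z" "z \<in> verts E" | (e) e where "x = Edge e" "e \<in> arcs E"
      | (g) e where "x = Ghost e" "e \<in> arcs E"
      by (auto simp: leavitt_gens_def)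
    then have "\<iota> x \<in> M"
    proof cases
      case v
      then have "\<iota> x = path [] z \<otimes> ghost_path [] z" "E.awalk z [] z" by (auto simp: vtx_idem)
      then show ?thesis unfolding M_def by blast
    next
      case e
      then have "\<iota> x = path [e] (head E e) \<otimes> ghost_path [] (head E e)"
        "E.awalk (tail E e) [e] (head E e)" "E.awalk (head E e) [] (head E e)"
        by (auto simp: edg_head mult_assoc)
      then show ?thesis unfolding M_def by blast
    next
      case g
      then have "\<iota> x = path [] (head E e) \<otimes> ghost_path [e] (head E e)"
        "E.awalk (tail E e) [e] (head E e)" "E.awalk (head E e) [] (head E e)"
        by (auto simp: head_gho)
      then show ?thesis unfolding M_def by blast
    qed
    then show "\<iota> x \<in> \<Inter>\<S>" using M by blast
  next
    fix x y assume x: "x \<in> leavitt_gens E" and y: "y \<in> \<Inter>\<S>"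
    have "{y \<in> carrier A. \<iota> x \<otimes> y \<in> \<Inter>\<S>} \<in> \<S>"
      using subspace_mult_left_vimage[OF sub funcset_mem[OF gen_closed x]] left[OF x] Mc
      by (auto simp: \<S>_def)
    then show "\<iota> x \<otimes> y \<in> \<Inter>\<S>" using y by blast
  qed
  also have "\<Inter>\<S> \<subseteq> S" using S paths by (auto simp: \<S>_def M_def)
  finally show ?thesis .
qed

text \<open>Local units replace the missing identity: the sources of the finitely many ghost paths
  occurring in \<open>x\<close> add up to a right unit of \<open>x\<close>, and \<open>x\<close> is
  the sum of its columns \<open>x \<otimes> vtx v\<close>.\<close>

lemma vertex_decomposition:
  assumes "x \<in> carrier A"
  obtains V where "finite V" "V \<subseteq> verts E" "(\<Oplus>v\<in>V. vtx v) \<in> carrier A"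
    "x \<otimes> (\<Oplus>v\<in>V. vtx v) = x" "x = (\<Oplus>v\<in>V. x \<otimes> vtx v)"
proof -
  define U where "U W = (\<Oplus>v\<in>W. vtx v)" for W
  have Ucl: "U W \<in> carrier A" if "W \<subseteq> verts E" for W
    unfolding U_def by (rule finsum_closed) (use that in auto)
  \<comment> \<open>The unit property is demanded for all larger finite sets \<open>W\<close>. Two
    elements then share a unit, namely the one for the union of their vertex sets, which makes
    \<open>S\<close> closed under addition.\<close>
  define S where "S = {x \<in> carrier A. \<exists>V. finite V \<and> V \<subseteq> verts E \<and>
    (\<forall>W. finite W \<longrightarrow> V \<subseteq> W \<longrightarrow> W \<subseteq> verts E \<longrightarrow> x \<otimes> U W = x)}"
  have "carrier A \<subseteq> S"
  proof (rule spanned)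
    show "subspace S"
      unfolding subspace_def
    proof (intro conjI ballI)
      show "S \<subseteq> carrier A" by (auto simp: S_def)
      show "\<zero> \<in> S" by (auto simp: S_def Ucl mult_zero_left)
    next
      fix x y assume "x \<in> S" "y \<in> S"
      then obtain V V' where V: "x \<in> carrier A" "y \<in> carrier A" "finite V" "finite V'"
        "V \<subseteq> verts E" "V' \<subseteq> verts E"
        and V1: "\<And>W. finite W \<Longrightarrow> V \<subseteq> W \<Longrightarrow> W \<subseteq> verts E \<Longrightarrow> x \<otimes> U W = x"
        and V2: "\<And>W. finite W \<Longrightarrow> V' \<subseteq> W \<Longrightarrow> W \<subseteq> verts E \<Longrightarrow> y \<otimes> U W = y"
        unfolding S_def by blast
      have "(x \<oplus> y) \<otimes> U W = x \<oplus> y" if "finite W" "V \<union> V' \<subseteq> W" "W \<subseteq> verts E" for W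
        using V1[of W] V2[of W] that V(1,2) Ucl[of W] by (simp add: distrib_right)
      moreover have "finite (V \<union> V')" "V \<union> V' \<subseteq> verts E" "x \<oplus> y \<in> carrier A"
        using V by auto
      ultimately show "x \<oplus> y \<in> S"
        unfolding S_def by blast
    next
      fix k x assume "k \<in> carrier K" "x \<in> S"
      then obtain V where V: "x \<in> carrier A" "finite V" "V \<subseteq> verts E"
        and V1: "\<And>W. finite W \<Longrightarrow> V \<subseteq> W \<Longrightarrow> W \<subseteq> verts E \<Longrightarrow> x \<otimes> U W = x"
        unfolding S_def by blast
      have "(k \<odot> x) \<otimes> U W = k \<odot> x" if "finite W" "V \<subseteq> W" "W \<subseteq> verts E" for W
        using V1[of W] that V(1) Ucl[of W] \<open>k \<in> carrier K\<close> by (simp add: smult_mult_left)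
      moreover have "k \<odot> x \<in> carrier A"
        using V \<open>k \<in> carrier K\<close> by (simp add: smult_closed)
      ultimately show "k \<odot> x \<in> S"
        using V(2,3) unfolding S_def by blast
    qed
    fix u p v x q assume p: "E.awalk u p v" and q: "E.awalk x q v"
    have "ghost_path q v \<otimes> U W = ghost_path q v" if W: "finite W" "{x} \<subseteq> W" "W \<subseteq> verts E" for W
    proof -
      have "ghost_path q v \<otimes> U W = (\<Oplus>y\<in>W. ghost_path q v \<otimes> vtx y)"
        unfolding U_def
        by (rule finsum_mult_right) (use W ghost_path_closed[OF q] in auto)
      also have "\<dots> = ghost_path q v \<otimes> vtx x"
        by (rule finsum_single)
           (use W ghost_path_closed[OF q] ghost_path_vtx_orth[OF q] in \<open>auto intro!: mult_closed\<close>)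
      finally show ?thesis using ghost_path_vtx[OF q] by simp
    qed
    then have "(path p v \<otimes> ghost_path q v) \<otimes> U W = path p v \<otimes> ghost_path q v"
      if "finite W" "{x} \<subseteq> W" "W \<subseteq> verts E" for W
      using that path_closed[OF p] ghost_path_closed[OF q] Ucl[of W] by (simp add: mult_assoc)
    moreover have "finite {x}" "{x} \<subseteq> verts E" "path p v \<otimes> ghost_path q v \<in> carrier A"
      using path_closed[OF p] ghost_path_closed[OF q] awalk_verts[OF q] by (auto simp: mult_closed)
    ultimately show "path p v \<otimes> ghost_path q v \<in> S"
      unfolding S_def by blast
  qed
  then obtain V where V: "finite V" "V \<subseteq> verts E" "x \<otimes> U V = x"
    using assms unfolding S_def by blast
  have "x \<otimes> U V = (\<Oplus>v\<in>V. x \<otimes> vtx v)"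
    unfolding U_def by (rule finsum_mult_right) (use assms V in auto)
  then show thesis using that[of V] V Ucl[OF V(2)] by (simp add: U_def)
qed

lemma right_local_unit: "x \<in> carrier A \<Longrightarrow> \<exists>u\<in>carrier A. x \<otimes> u = x"
  using vertex_decomposition by metis

end

section \<open>Ideals without vertices\<close>

context leavitt_family
begin

text \<open>Linear combinations of real paths with range \<open>v\<close>. No linear independence of
  paths is claimed, so an element may have many such representations.\<close>

definition real_at :: "'v \<Rightarrow> 'a set" where
  "real_at v = {(\<Oplus>p\<in>S. k p \<odot> path p v) |S k.
     finite S \<and> (\<forall>p\<in>S. \<exists>u. E.awalk u p v) \<and> k \<in> UNIV \<rightarrow> carrier K}"

text \<open>Described column by column, because the later arguments multiply by a single vertex on
  the right.\<close>

definition real_span :: "'a set" where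
  "real_span = {z \<in> carrier A. \<forall>v\<in>verts E. z \<otimes> vtx v \<in> real_at v}"

lemma real_term_closed: "\<exists>u. E.awalk u p v \<Longrightarrow> k \<in> UNIV \<rightarrow> carrier K \<Longrightarrow> k p \<odot> path p v \<in> carrier A"
  by (auto intro!: smult_closed path_closed)

lemma real_sum_Pi:
  assumes "\<forall>p\<in>S. \<exists>u. E.awalk u p v" "k \<in> UNIV \<rightarrow> carrier K"
  shows "(\<lambda>p. k p \<odot> path p v) \<in> S \<rightarrow> carrier A"
  using assms by (intro Pi_I real_term_closed) auto

lemma real_sum_superset:
  assumes "finite S'" "S \<subseteq> S'" "\<forall>p\<in>S'. \<exists>u. E.awalk u p v" "k \<in> UNIV \<rightarrow> carrier K"
  shows "(\<Oplus>p\<in>S. k p \<odot> path p v) = (\<Oplus>p\<in>S'. (if p \<in> S then k p else \<zero>\<^bsub>K\<^esub>) \<odot> path p v)"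
proof (rule add.finprod_mono_neutral_cong_left[OF assms(1,2)])
  fix p assume "p \<in> S' - S"
  then have "path p v \<in> carrier A" using assms path_closed by blast
  then show "(if p \<in> S then k p else \<zero>\<^bsub>K\<^esub>) \<odot> path p v = \<zero>"
    using \<open>p \<in> S' - S\<close> by (simp add: smult_zero_left)
next
  show "(\<lambda>p. (if p \<in> S then k p else \<zero>\<^bsub>K\<^esub>) \<odot> path p v) \<in> S' \<rightarrow> carrier A"
    using assms by (intro real_sum_Pi) auto
qed simp

lemma subspace_real_at:
  assumes "v \<in> verts E"
  shows "subspace (real_at v)"
  unfolding subspace_def
proof (intro conjI ballI)
  show "real_at v \<subseteq> carrier A"
    by (auto simp: real_at_def intro!: finsum_closed real_term_closed)
  show "\<zero> \<in> real_at v"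
    unfolding real_at_def by (auto intro!: exI[of _ "{}"] exI[of _ "\<lambda>_. \<zero>\<^bsub>K\<^esub>"])
next
  fix x y assume "x \<in> real_at v" "y \<in> real_at v"
  then obtain S k S' k' where S: "finite S" "\<forall>p\<in>S. \<exists>u. E.awalk u p v" "k \<in> UNIV \<rightarrow> carrier K"
      "x = (\<Oplus>p\<in>S. k p \<odot> path p v)"
    and S': "finite S'" "\<forall>p\<in>S'. \<exists>u. E.awalk u p v" "k' \<in> UNIV \<rightarrow> carrier K"
      "y = (\<Oplus>p\<in>S'. k' p \<odot> path p v)"
    unfolding real_at_def by blast
  \<comment> \<open>Both coefficient functions are extended by zero to the union of their index
    sets.\<close>
  define l where "l p = (if p \<in> S then k p else \<zero>\<^bsub>K\<^esub>)" for p
  define l' where "l' p = (if p \<in> S' then k' p else \<zero>\<^bsub>K\<^esub>)" for p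
  have l: "l \<in> UNIV \<rightarrow> carrier K" "l' \<in> UNIV \<rightarrow> carrier K"
    using S(3) S'(3) by (auto simp: l_def l'_def)
  let ?U = "S \<union> S'"
  have U: "finite ?U" "\<forall>p\<in>?U. \<exists>u. E.awalk u p v" using S S' by auto
  have "x = (\<Oplus>p\<in>?U. l p \<odot> path p v)" "y = (\<Oplus>p\<in>?U. l' p \<odot> path p v)"
    using real_sum_superset[OF U(1) _ U(2) S(3), of S] real_sum_superset[OF U(1) _ U(2) S'(3), of S']
      S(4) S'(4) by (simp_all add: l_def l'_def)
  then have "x \<oplus> y = (\<Oplus>p\<in>?U. l p \<odot> path p v \<oplus> l' p \<odot> path p v)"
    using U l by (simp add: finsum_addf real_term_closed Pi_I)
  also have "\<dots> = (\<Oplus>p\<in>?U. (l p \<oplus>\<^bsub>K\<^esub> l' p) \<odot> path p v)"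
  proof (rule finsum_cong'[OF refl])
    fix p assume "p \<in> ?U"
    then obtain u where "E.awalk u p v" using U(2) by blast
    then show "l p \<odot> path p v \<oplus> l' p \<odot> path p v = (l p \<oplus>\<^bsub>K\<^esub> l' p) \<odot> path p v"
      using l path_closed[of u p v] by (simp add: smult_l_distr Pi_iff)
  next
    show "(\<lambda>p. (l p \<oplus>\<^bsub>K\<^esub> l' p) \<odot> path p v) \<in> ?U \<rightarrow> carrier A"
      using U(2) l by (intro real_sum_Pi) auto
  qed
  finally show "x \<oplus> y \<in> real_at v"
    using U l unfolding real_at_def
    by (intro CollectI exI[of _ ?U] exI[of _ "\<lambda>p. l p \<oplus>\<^bsub>K\<^esub> l' p"]) auto
next
  fix c x assume c: "c \<in> carrier K" and "x \<in> real_at v"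
  then obtain S k where S: "finite S" "\<forall>p\<in>S. \<exists>u. E.awalk u p v" "k \<in> UNIV \<rightarrow> carrier K"
      "x = (\<Oplus>p\<in>S. k p \<odot> path p v)"
    unfolding real_at_def by blast
  have "c \<odot> x = (\<Oplus>p\<in>S. c \<odot> (k p \<odot> path p v))"
    unfolding S(4) by (rule finsum_smult) (use S c real_term_closed in auto)
  also have "\<dots> = (\<Oplus>p\<in>S. (c \<otimes>\<^bsub>K\<^esub> k p) \<odot> path p v)"
  proof (rule finsum_cong'[OF refl])
    fix p assume "p \<in> S"
    then obtain u where "E.awalk u p v" using S(2) by blast
    then show "c \<odot> (k p \<odot> path p v) = (c \<otimes>\<^bsub>K\<^esub> k p) \<odot> path p v"
      using S(3) c path_closed[of u p v] by (simp add: smult_assoc Pi_iff)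
  next
    show "(\<lambda>p. (c \<otimes>\<^bsub>K\<^esub> k p) \<odot> path p v) \<in> S \<rightarrow> carrier A"
      using S(2,3) c by (intro real_sum_Pi) auto
  qed
  finally show "c \<odot> x \<in> real_at v"
    using S c unfolding real_at_def
    by (intro CollectI exI[of _ S] exI[of _ "\<lambda>p. c \<otimes>\<^bsub>K\<^esub> k p"]) auto
qed

lemma path_real_at: "E.awalk u p v \<Longrightarrow> path p v \<in> real_at v"
  unfolding real_at_def
  by (intro CollectI exI[of _ "{p}"] exI[of _ "\<lambda>_. \<one>\<^bsub>K\<^esub>"])
     (auto simp: smult_one path_closed)

lemma subspace_real_span: "subspace real_span"
  using subspace_real_at
  unfolding subspace_def real_span_def
  by (auto simp: mult_zero_left distrib_right smult_mult_left smult_closed)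

lemma path_real_span:
  assumes "E.awalk u p v"
  shows "path p v \<in> real_span"
  unfolding real_span_def
proof (intro CollectI conjI ballI path_closed[OF assms])
  fix w assume "w \<in> verts E"
  then show "path p v \<otimes> vtx w \<in> real_at w"
    using path_vtx_orth[OF assms, of w] path_vtx[OF assms] path_real_at[OF assms]
      subspace_real_at[of w]
    by (cases "w = v") (auto simp: subspace_def)
qed

lemma real_at_edg:
  assumes "f \<in> arcs E" "z \<in> real_at (tail E f)"
  shows "z \<otimes> edg f \<in> real_at (head E f)"
proof -
  let ?v = "tail E f" and ?w = "head E f"
  have sub: "subspace (real_at ?w)" using assms by (intro subspace_real_at) auto
  obtain S k where S: "finite S" "\<forall>p\<in>S. \<exists>u. E.awalk u p ?v" "k \<in> UNIV \<rightarrow> carrier K"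
      "z = (\<Oplus>p\<in>S. k p \<odot> path p ?v)"
    using assms(2) unfolding real_at_def by blast
  have f: "E.awalk ?v [f] ?w" using assms by auto
  have "z \<otimes> edg f = (\<Oplus>p\<in>S. (k p \<odot> path p ?v) \<otimes> edg f)"
    unfolding S(4) by (rule finsum_mult_left) (use S assms real_term_closed in auto)
  moreover have "(k p \<odot> path p ?v) \<otimes> edg f \<in> real_at ?w" if pS: "p \<in> S" for p
  proof -
    obtain u where u: "E.awalk u p ?v" using bspec[OF S(2) pS] ..
    have "path (p @ [f]) ?w = path p ?v \<otimes> edg f"
      using path_append[OF u f] assms by (simp add: edg_head)
    moreover have "path (p @ [f]) ?w \<in> real_at ?w"
      using path_real_at[of u "p @ [f]" ?w] u f by (auto simp: E.awalk_append_iff)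
    ultimately show ?thesis
      using path_closed[OF u] assms S(3) sub by (simp add: smult_mult_left subspace_def Pi_iff)
  qed
  ultimately show ?thesis
    using subspace_finsum[OF sub, of S "\<lambda>p. (k p \<odot> path p ?v) \<otimes> edg f"] by simp
qed

lemma edg_vtx_orth:
  assumes "f \<in> arcs E" "v \<in> verts E" "v \<noteq> head E f"
  shows "edg f \<otimes> vtx v = \<zero>"
  using path_vtx_orth[of "tail E f" "[f]" "head E f" v] assms by (simp add: edg_head)

lemma vtx_edg_orth:
  assumes "f \<in> arcs E" "v \<in> verts E" "v \<noteq> tail E f"
  shows "vtx v \<otimes> edg f = \<zero>"
  using vtx_path_orth[of "tail E f" "[f]" "head E f" v] assms by (simp add: edg_head)

lemma gho_vtx_orth:
  assumes "f \<in> arcs E" "v \<in> verts E" "v \<noteq> tail E f"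
  shows "gho f \<otimes> vtx v = \<zero>"
  using ghost_path_vtx_orth[of "tail E f" "[f]" "head E f" v] assms by (simp add: head_gho)

lemma real_span_edg:
  assumes "f \<in> arcs E" "z \<in> real_span"
  shows "z \<otimes> edg f \<in> real_span"
  unfolding real_span_def
proof (intro CollectI conjI ballI)
  have z: "z \<in> carrier A" "z \<otimes> vtx (tail E f) \<in> real_at (tail E f)"
    using assms by (auto simp: real_span_def)
  then show "z \<otimes> edg f \<in> carrier A" using assms by (simp add: mult_closed)
  fix w assume w: "w \<in> verts E"
  have "(z \<otimes> vtx (tail E f)) \<otimes> edg f = z \<otimes> edg f"
    using z assms by (simp add: mult_assoc tail_edg)
  then have "z \<otimes> edg f \<in> real_at (head E f)"
    using real_at_edg[OF assms(1) z(2)] by simp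
  then show "z \<otimes> edg f \<otimes> vtx w \<in> real_at w"
    using z assms w edg_vtx_orth[of f w] subspace_real_at[of w]
    by (cases "w = head E f") (auto simp: mult_assoc edg_head mult_zero_right subspace_def)
qed

text \<open>This is \<open>x\<close> multiplied by the complement of the idempotent
  \<open>\<Sum> f f\<^sup>*\<close> over \<open>Z\<close>, written without the identity that the
  algebra may lack.\<close>

definition residual :: "'e set \<Rightarrow> 'a \<Rightarrow> 'a" where
  "residual Z x = x \<ominus> (\<Oplus>f\<in>Z. (x \<otimes> edg f) \<otimes> gho f)"

lemma residual_sum_closed:
  "Z \<subseteq> arcs E \<Longrightarrow> x \<in> carrier A \<Longrightarrow> (\<Oplus>f\<in>Z. (x \<otimes> edg f) \<otimes> gho f) \<in> carrier A"
  by (intro finsum_closed) (auto simp: mult_closed)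

lemma residual_closed: "Z \<subseteq> arcs E \<Longrightarrow> x \<in> carrier A \<Longrightarrow> residual Z x \<in> carrier A"
  by (simp add: residual_def residual_sum_closed)

lemma residual_zero: "Z \<subseteq> arcs E \<Longrightarrow> residual Z \<zero> = \<zero>"
proof -
  assume Z: "Z \<subseteq> arcs E"
  have "(\<Oplus>f\<in>Z. (\<zero> \<otimes> edg f) \<otimes> gho f) = (\<Oplus>f\<in>Z. \<zero>)"
    by (rule finsum_cong') (use Z in \<open>auto simp: mult_zero_left\<close>)
  then show ?thesis by (simp add: residual_def minus_eq)
qed

lemma residual_add:
  assumes "Z \<subseteq> arcs E" "x \<in> carrier A" "y \<in> carrier A"
  shows "residual Z (x \<oplus> y) = residual Z x \<oplus> residual Z y"
proof -
  have "(\<Oplus>f\<in>Z. ((x \<oplus> y) \<otimes> edg f) \<otimes> gho f)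
    = (\<Oplus>f\<in>Z. (x \<otimes> edg f) \<otimes> gho f \<oplus> (y \<otimes> edg f) \<otimes> gho f)"
    by (rule finsum_cong') (use assms in \<open>auto simp: distrib_right mult_closed subset_iff\<close>)
  also have "\<dots> = (\<Oplus>f\<in>Z. (x \<otimes> edg f) \<otimes> gho f) \<oplus> (\<Oplus>f\<in>Z. (y \<otimes> edg f) \<otimes> gho f)"
    by (rule finsum_addf) (use assms in \<open>auto simp: mult_closed subset_iff\<close>)
  finally show ?thesis
    using assms residual_sum_closed[OF assms(1)]
    by (simp add: residual_def minus_eq minus_add a_ac)
qed

lemma residual_smult:
  assumes "finite Z" "Z \<subseteq> arcs E" "x \<in> carrier A" "k \<in> carrier K"
  shows "residual Z (k \<odot> x) = k \<odot> residual Z x"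
proof -
  have "(\<Oplus>f\<in>Z. ((k \<odot> x) \<otimes> edg f) \<otimes> gho f) = (\<Oplus>f\<in>Z. k \<odot> ((x \<otimes> edg f) \<otimes> gho f))"
    by (rule finsum_cong') (use assms in \<open>auto simp: smult_mult_left smult_closed mult_closed subset_iff\<close>)
  also have "\<dots> = k \<odot> (\<Oplus>f\<in>Z. (x \<otimes> edg f) \<otimes> gho f)"
    by (rule finsum_smult[symmetric]) (use assms in \<open>auto simp: mult_closed subset_iff\<close>)
  finally show ?thesis
    using assms residual_sum_closed[OF assms(2)] by (simp add: residual_def smult_diff)
qed

text \<open>As \<open>g\<^sup>* f = 0\<close> for distinct edges,
  \<open>(\<Sum> x g g\<^sup>* ) f\<close> is \<open>x f\<close> for an edge of \<open>Z\<close> and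
  zero for any other edge.\<close>

lemma residual_edg:
  assumes "finite Z" "Z \<subseteq> arcs E" "x \<in> carrier A" "f \<in> arcs E"
  shows "residual Z x \<otimes> edg f = (if f \<in> Z then \<zero> else x \<otimes> edg f)"
proof -
  have xf: "x \<otimes> edg f \<in> carrier A" using assms by (simp add: mult_closed)
  have "(\<Oplus>g\<in>Z. (x \<otimes> edg g) \<otimes> gho g) \<otimes> edg f = (\<Oplus>g\<in>Z. ((x \<otimes> edg g) \<otimes> gho g) \<otimes> edg f)"
    by (rule finsum_mult_left) (use assms in \<open>auto simp: mult_closed subset_iff\<close>)
  also have "\<dots> = (\<Oplus>g\<in>Z. if f = g then x \<otimes> edg f else \<zero>)"
  proof (rule finsum_cong'[OF refl])
    fix g assume "g \<in> Z"
    then have g: "g \<in> arcs E" using assms by auto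
    then have "((x \<otimes> edg g) \<otimes> gho g) \<otimes> edg f = (x \<otimes> edg g) \<otimes> (gho g \<otimes> edg f)"
      using assms by (simp add: mult_assoc mult_closed)
    then show "((x \<otimes> edg g) \<otimes> gho g) \<otimes> edg f = (if f = g then x \<otimes> edg f else \<zero>)"
      using g assms by (simp add: gho_edg gho_edg_orth mult_assoc mult_closed mult_zero_right edg_head)
  qed (use xf in auto)
  also have "\<dots> = (if f \<in> Z then x \<otimes> edg f else \<zero>)"
  proof (cases "f \<in> Z")
    case True
    then show ?thesis using finsum_singleton[of f Z "\<lambda>_. x \<otimes> edg f"] assms xf by simp
  next
    case False
    then have "(\<Oplus>g\<in>Z. if f = g then x \<otimes> edg f else \<zero>) = (\<Oplus>g\<in>Z. \<zero>)"
      by (intro finsum_cong') auto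
    then show ?thesis using False by simp
  qed
  finally show ?thesis
    using assms xf residual_sum_closed[OF assms(2,3)]
    by (simp add: residual_def mult_diff_left diff_eq_zero_iff) (simp add: minus_eq)
qed

text \<open>Each \<open>g g\<^sup>*\<close> commutes with every vertex: both products are
  \<open>g g\<^sup>*\<close> at the source of \<open>g\<close> and zero elsewhere. Residuals can
  therefore be computed column by column.\<close>

lemma residual_vtx:
  assumes "finite Z" "Z \<subseteq> arcs E" "x \<in> carrier A" "v \<in> verts E"
  shows "residual Z x \<otimes> vtx v = residual Z (x \<otimes> vtx v)"
proof -
  have "(\<Oplus>g\<in>Z. (x \<otimes> edg g) \<otimes> gho g) \<otimes> vtx v = (\<Oplus>g\<in>Z. ((x \<otimes> edg g) \<otimes> gho g) \<otimes> vtx v)"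
    by (rule finsum_mult_left) (use assms in \<open>auto simp: mult_closed subset_iff\<close>)
  also have "\<dots> = (\<Oplus>g\<in>Z. ((x \<otimes> vtx v) \<otimes> edg g) \<otimes> gho g)"
  proof (rule finsum_cong'[OF refl])
    fix g assume "g \<in> Z"
    then have g: "g \<in> arcs E" using assms by auto
    then show "((x \<otimes> edg g) \<otimes> gho g) \<otimes> vtx v = ((x \<otimes> vtx v) \<otimes> edg g) \<otimes> gho g"
      using assms gho_vtx_orth[OF g, of v] vtx_edg_orth[OF g, of v]
      by (cases "v = tail E g")
         (auto simp: mult_assoc mult_closed gho_tail tail_edg mult_zero_right mult_zero_left)
  qed (use assms in \<open>auto simp: mult_closed subset_iff\<close>)
  finally show ?thesis
    using assms residual_sum_closed[OF assms(2,3)] by (simp add: residual_def mult_diff_left)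
qed

lemma residual_sink:
  assumes "Z \<subseteq> arcs E" "x \<in> carrier A" "v \<in> verts E" "out_arcs E v = {}"
  shows "residual Z (x \<otimes> vtx v) = x \<otimes> vtx v"
proof -
  have "(\<Oplus>g\<in>Z. ((x \<otimes> vtx v) \<otimes> edg g) \<otimes> gho g) = (\<Oplus>g\<in>Z. \<zero>)"
  proof (rule finsum_cong'[OF refl])
    fix g assume "g \<in> Z"
    then have g: "g \<in> arcs E" "v \<noteq> tail E g" using assms by (auto simp: out_arcs_def)
    then show "((x \<otimes> vtx v) \<otimes> edg g) \<otimes> gho g = \<zero>"
      using assms vtx_edg_orth[of g v] by (simp add: mult_assoc[of x] mult_zero_right mult_zero_left)
  qed auto
  then show ?thesis using assms by (simp add: residual_def minus_eq mult_closed)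
qed

text \<open>The filtration by ghost degree. Each step only records what the induction below uses:
  multiplying by an edge lowers the degree, and the terms of positive ghost degree are removed by
  \<open>residual Z\<close> for all large enough \<open>Z\<close>.\<close>

primrec ghost_degree :: "nat \<Rightarrow> 'a set" where
  "ghost_degree 0 = real_span"
| "ghost_degree (Suc n) = {x \<in> carrier A. (\<forall>f\<in>arcs E. x \<otimes> edg f \<in> ghost_degree n) \<and>
     (\<exists>z\<in>real_span. \<exists>Y. finite Y \<and> Y \<subseteq> arcs E \<and>
       (\<forall>Z. finite Z \<longrightarrow> Y \<subseteq> Z \<longrightarrow> Z \<subseteq> arcs E \<longrightarrow> residual Z x = residual Z z))}"

lemma real_span_closed: "z \<in> real_span \<Longrightarrow> z \<in> carrier A"
  by (simp add: real_span_def)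

lemma subspace_ghost_degree: "subspace (ghost_degree n)"
proof (induction n)
  case 0
  then show ?case by (simp add: subspace_real_span)
next
  case (Suc n)
  have Rs: "subspace real_span" by (rule subspace_real_span)
  show ?case
    unfolding subspace_def
  proof (intro conjI ballI)
    show "ghost_degree (Suc n) \<subseteq> carrier A" by auto
    show "\<zero> \<in> ghost_degree (Suc n)"
      using Suc Rs by (auto simp: subspace_def mult_zero_left)
  next
    fix x y assume x: "x \<in> ghost_degree (Suc n)" and y: "y \<in> ghost_degree (Suc n)"
    from x obtain z Y where z: "z \<in> real_span" "finite Y" "Y \<subseteq> arcs E"
      "\<And>Z. finite Z \<Longrightarrow> Y \<subseteq> Z \<Longrightarrow> Z \<subseteq> arcs E \<Longrightarrow> residual Z x = residual Z z" by auto
    from y obtain z' Y' where z': "z' \<in> real_span" "finite Y'" "Y' \<subseteq> arcs E"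
      "\<And>Z. finite Z \<Longrightarrow> Y' \<subseteq> Z \<Longrightarrow> Z \<subseteq> arcs E \<Longrightarrow> residual Z y = residual Z z'" by auto
    have xy: "x \<in> carrier A" "y \<in> carrier A" using x y by auto
    have "residual Z (x \<oplus> y) = residual Z (z \<oplus> z')" if "finite Z" "Y \<union> Y' \<subseteq> Z" "Z \<subseteq> arcs E" for Z
      using that z(4)[of Z] z'(4)[of Z] xy real_span_closed z(1) z'(1) by (simp add: residual_add)
    moreover have "z \<oplus> z' \<in> real_span" "finite (Y \<union> Y')" "Y \<union> Y' \<subseteq> arcs E"
      using Rs z z' by (auto simp: subspace_def)
    moreover have "(x \<oplus> y) \<otimes> edg f \<in> ghost_degree n" if "f \<in> arcs E" for f
      using x y xy that Suc by (auto simp: distrib_right subspace_def)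
    moreover from calculation have "\<exists>z\<in>real_span. \<exists>Y. finite Y \<and> Y \<subseteq> arcs E \<and>
       (\<forall>Z. finite Z \<longrightarrow> Y \<subseteq> Z \<longrightarrow> Z \<subseteq> arcs E \<longrightarrow> residual Z (x \<oplus> y) = residual Z z)"
      by (intro bexI[of _ "z \<oplus> z'"] exI[of _ "Y \<union> Y'"]) simp_all
    ultimately show "x \<oplus> y \<in> ghost_degree (Suc n)"
      using xy by simp
  next
    fix k x assume k: "k \<in> carrier K" and x: "x \<in> ghost_degree (Suc n)"
    from x obtain z Y where z: "z \<in> real_span" "finite Y" "Y \<subseteq> arcs E"
      "\<And>Z. finite Z \<Longrightarrow> Y \<subseteq> Z \<Longrightarrow> Z \<subseteq> arcs E \<Longrightarrow> residual Z x = residual Z z" by auto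
    have xc: "x \<in> carrier A" using x by auto
    have "residual Z (k \<odot> x) = residual Z (k \<odot> z)" if "finite Z" "Y \<subseteq> Z" "Z \<subseteq> arcs E" for Z
      using that z(4)[of Z] xc real_span_closed z(1) k by (simp add: residual_smult)
    moreover have "k \<odot> z \<in> real_span" using Rs z k by (auto simp: subspace_def)
    moreover have "(k \<odot> x) \<otimes> edg f \<in> ghost_degree n" if "f \<in> arcs E" for f
      using x xc k that Suc by (auto simp: smult_mult_left subspace_def)
    moreover from calculation have "\<exists>z\<in>real_span. \<exists>Y. finite Y \<and> Y \<subseteq> arcs E \<and>
       (\<forall>Z. finite Z \<longrightarrow> Y \<subseteq> Z \<longrightarrow> Z \<subseteq> arcs E \<longrightarrow> residual Z (k \<odot> x) = residual Z z)"
      using z(2,3) by (intro bexI[of _ "k \<odot> z"] exI[of _ Y]) simp_all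
    ultimately show "k \<odot> x \<in> ghost_degree (Suc n)"
      using xc k by (simp add: smult_closed)
  qed
qed

text \<open>A real element can serve as its own real approximation \<open>z\<close>, for every
  \<open>Z\<close>, and its products with edges stay real.\<close>

lemma ghost_degree_Suc: "ghost_degree n \<subseteq> ghost_degree (Suc n)"
proof (induction n)
  case 0
  show ?case
    using real_span_edg real_span_closed by auto
next
  case (Suc n)
  then show ?case by (auto simp del: ghost_degree.simps(1))
qed

lemma ghost_degree_mono: "m \<le> n \<Longrightarrow> ghost_degree m \<subseteq> ghost_degree n"
  using lift_Suc_mono_le[of ghost_degree] ghost_degree_Suc by blast

text \<open>Write the product as \<open>x = y e\<^sup>*\<close>. Then \<open>x f\<close> is
  \<open>y\<close> for \<open>f = e\<close> and zero otherwise, and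
  \<open>x e e\<^sup>* = x\<close>, so the residual vanishes as soon as \<open>e\<close> is in
  \<open>Z\<close>; the real approximation is zero.\<close>

lemma path_ghost_degree:
  "E.awalk u p v \<Longrightarrow> E.awalk x q v \<Longrightarrow> path p v \<otimes> ghost_path q v \<in> ghost_degree (length q)"
proof (induction q arbitrary: x)
  case Nil
  then show ?case using path_vtx path_real_span by auto
next
  case (Cons e q)
  then have e: "e \<in> arcs E" and q: "E.awalk (head E e) q v" by auto
  let ?y = "path p v \<otimes> ghost_path q v" and ?n = "length q"
  have pc: "path p v \<in> carrier A" and qc: "ghost_path q v \<in> carrier A"
    using path_closed[OF Cons.prems(1)] ghost_path_closed[OF q] by auto
  have y: "?y \<in> ghost_degree ?n" "?y \<in> carrier A"
    using Cons.IH[OF Cons.prems(1) q] pc qc by (auto simp: mult_closed)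
  have x: "path p v \<otimes> ghost_path (e # q) v = ?y \<otimes> gho e"
    using pc qc e by (simp add: mult_assoc)
  have xf: "(?y \<otimes> gho e) \<otimes> edg f = (if e = f then ?y else \<zero>)" if "f \<in> arcs E" for f
  proof -
    have "(?y \<otimes> gho e) \<otimes> edg f = ?y \<otimes> (gho e \<otimes> edg f)"
      using y e that by (simp add: mult_assoc)
    moreover have "?y \<otimes> vtx (head E e) = ?y"
      using pc qc e ghost_path_vtx[OF q] by (simp add: mult_assoc)
    ultimately show ?thesis
      using y that e by (cases "e = f") (auto simp: gho_edg gho_edg_orth mult_zero_right)
  qed
  have "residual Z (?y \<otimes> gho e) = \<zero>" if Z: "finite Z" "{e} \<subseteq> Z" "Z \<subseteq> arcs E" for Z
  proof -
    have "(\<Oplus>f\<in>Z. ((?y \<otimes> gho e) \<otimes> edg f) \<otimes> gho f) = (\<Oplus>f\<in>Z. if e = f then ?y \<otimes> gho f else \<zero>)"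
      by (rule finsum_cong')
         (use Z y e in \<open>auto simp: subset_iff xf mult_zero_left simp del: mult_assoc intro!: mult_closed\<close>)
    also have "\<dots> = ?y \<otimes> gho e"
      by (rule finsum_singleton) (use Z y e in \<open>auto simp: subset_iff intro!: mult_closed\<close>)
    finally show ?thesis
      using y e by (simp add: residual_def diff_eq_zero_iff mult_closed)
  qed
  then have "\<exists>z\<in>real_span. \<exists>Y. finite Y \<and> Y \<subseteq> arcs E \<and>
       (\<forall>Z. finite Z \<longrightarrow> Y \<subseteq> Z \<longrightarrow> Z \<subseteq> arcs E \<longrightarrow> residual Z (?y \<otimes> gho e) = residual Z z)"
    using e subspace_real_span
    by (intro bexI[of _ \<zero>] exI[of _ "{e}"]) (auto simp: residual_zero subspace_def)
  moreover have "\<zero> \<in> ghost_degree ?n"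
    using subspace_ghost_degree by (simp add: subspace_def)
  ultimately have "?y \<otimes> gho e \<in> ghost_degree (Suc ?n)"
    using y e by (auto simp: xf mult_closed)
  then show ?case using x by simp
qed

end

lemma (in leavitt_generating_family) ghost_degree_exhausts:
  assumes "x \<in> carrier A"
  obtains n where "x \<in> ghost_degree n"
proof -
  have "carrier A \<subseteq> (\<Union>n. ghost_degree n)"
  proof (rule spanned)
    show "subspace (\<Union>n. ghost_degree n)"
      unfolding subspace_def
    proof (intro conjI ballI)
      show "(\<Union>n. ghost_degree n) \<subseteq> carrier A"
        using subspace_ghost_degree unfolding subspace_def by blast
      show "\<zero> \<in> (\<Union>n. ghost_degree n)"
        using subspace_ghost_degree unfolding subspace_def by blast
    next
      fix x y assume "x \<in> (\<Union>n. ghost_degree n)" "y \<in> (\<Union>n. ghost_degree n)"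
      then obtain m n where "x \<in> ghost_degree m" "y \<in> ghost_degree n" by blast
      then have "x \<in> ghost_degree (max m n)" "y \<in> ghost_degree (max m n)"
        using ghost_degree_mono[of m "max m n"] ghost_degree_mono[of n "max m n"] by auto
      then show "x \<oplus> y \<in> (\<Union>n. ghost_degree n)"
        using subspace_ghost_degree[of "max m n"] unfolding subspace_def by blast
    next
      fix k x assume "k \<in> carrier K" "x \<in> (\<Union>n. ghost_degree n)"
      then show "k \<odot> x \<in> (\<Union>n. ghost_degree n)"
        using subspace_ghost_degree unfolding subspace_def by blast
    qed
    fix u p v x q assume "E.awalk u p v" "E.awalk x q v"
    then show "path p v \<otimes> ghost_path q v \<in> (\<Union>n. ghost_degree n)"
      by (intro UN_I[of "length q"] path_ghost_degree) auto
  qed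
  then show thesis using that assms by blast
qed

section \<open>Leading terms and the reduction of ideals without vertices\<close>

context leavitt_family
begin

text \<open>Let \<open>p\<close> be a shortest path with nonzero coefficient. By minimality
  \<open>p\<^sup>* q\<close> vanishes unless \<open>q = p \<tau>\<close>, and then \<tau> is a
  closed path at \<open>v\<close>, since both paths have range \<open>v\<close>. The term of
  \<open>p\<close> itself becomes the constant term.\<close>

lemma real_at_leading:
  assumes v: "v \<in> verts E" and z: "z \<in> real_at v" "z \<noteq> \<zero>"
  obtains u p k C l where "E.awalk u p v" "k \<in> carrier K" "k \<noteq> \<zero>\<^bsub>K\<^esub>" "finite C"
    "\<forall>\<tau>\<in>C. \<tau> \<noteq> [] \<and> E.awalk v \<tau> v" "l \<in> UNIV \<rightarrow> carrier K"
    "ghost_path p v \<otimes> z = k \<odot> vtx v \<oplus> (\<Oplus>\<tau>\<in>C. l \<tau> \<odot> path \<tau> v)"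
proof -
  obtain S0 k where S0: "finite S0" "\<forall>p\<in>S0. \<exists>u. E.awalk u p v" "k \<in> UNIV \<rightarrow> carrier K"
      "z = (\<Oplus>p\<in>S0. k p \<odot> path p v)"
    using z(1) unfolding real_at_def by blast
  \<comment> \<open>Zero coefficients are discarded first, since the coefficient of the shortest
    path must be a nonzero constant term.\<close>
  define S where "S = {p \<in> S0. k p \<noteq> \<zero>\<^bsub>K\<^esub>}"
  have S: "finite S" "\<And>p. p \<in> S \<Longrightarrow> \<exists>u. E.awalk u p v" "\<And>p. p \<in> S \<Longrightarrow> k p \<noteq> \<zero>\<^bsub>K\<^esub>"
    using S0 by (auto simp: S_def)
  have zS: "z = (\<Oplus>p\<in>S. k p \<odot> path p v)"
  proof -
    have "(\<Oplus>p\<in>S. k p \<odot> path p v) = z"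
      unfolding S0(4)
    proof (rule add.finprod_mono_neutral_cong_left)
      fix p assume "p \<in> S0 - S"
      then show "k p \<odot> path p v = \<zero>"
        using S0(2) path_closed[of _ p v] by (auto simp: S_def smult_zero_left)
    qed (use S0 real_term_closed in \<open>auto simp: S_def\<close>)
    then show ?thesis by simp
  qed
  have "S \<noteq> {}" using zS z(2) by auto
  then obtain p where p: "p \<in> S" "\<And>q. q \<in> S \<Longrightarrow> length p \<le> length q"
    using S(1) arg_min_if_finite[of S length] by (metis not_le_imp_less)
  obtain u where u: "E.awalk u p v" using S(2) p(1) by blast
  define C where "C = {\<tau>. \<tau> \<noteq> [] \<and> p @ \<tau> \<in> S \<and> E.awalk v \<tau> v}"
  have finC: "finite C"
    by (rule finite_imageD[of "\<lambda>\<tau>. p @ \<tau>"])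
       (auto simp: C_def inj_on_def intro: finite_subset[OF _ S(1)])
  let ?g = "ghost_path p v"
  have g: "?g \<in> carrier A" by (rule ghost_path_closed[OF u])
  have summand: "?g \<otimes> (k q \<odot> path q v) = k q \<odot> (?g \<otimes> path q v)"
    "k q \<odot> (?g \<otimes> path q v) \<in> carrier A" if q: "q \<in> S" for q
  proof -
    obtain u' where "E.awalk u' q v" using S(2) q by blast
    then have "path q v \<in> carrier A" "k q \<in> carrier K" using path_closed S0(3) by auto
    then show "?g \<otimes> (k q \<odot> path q v) = k q \<odot> (?g \<otimes> path q v)" "k q \<odot> (?g \<otimes> path q v) \<in> carrier A"
      using g by (auto simp: smult_mult_right intro!: smult_closed mult_closed)
  qed
  have "?g \<otimes> z = (\<Oplus>q\<in>S. ?g \<otimes> (k q \<odot> path q v))"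
    unfolding zS by (rule finsum_mult_right) (use S S0(3) real_term_closed g in auto)
  also have "\<dots> = (\<Oplus>q\<in>S. k q \<odot> (?g \<otimes> path q v))"
    by (rule finsum_cong') (use summand in auto)
  also have "\<dots> = (\<Oplus>q\<in>insert p (S - {p}). k q \<odot> (?g \<otimes> path q v))"
    using p(1) by (simp add: insert_absorb)
  also have "\<dots> = k p \<odot> (?g \<otimes> path p v) \<oplus> (\<Oplus>q\<in>S - {p}. k q \<odot> (?g \<otimes> path q v))"
    by (rule finsum_insert) (use S(1) summand p in auto)
  also have "?g \<otimes> path p v = vtx v" by (rule ghost_path_path[OF u])
  also have "(\<Oplus>q\<in>S - {p}. k q \<odot> (?g \<otimes> path q v))
    = (\<Oplus>q\<in>(\<lambda>\<tau>. p @ \<tau>) ` C. k q \<odot> (?g \<otimes> path q v))"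
  proof (rule add.finprod_mono_neutral_cong_right)
    fix q assume q: "q \<in> (S - {p}) - (\<lambda>\<tau>. p @ \<tau>) ` C"
    obtain u' where u': "E.awalk u' q v" using S(2) q by blast
    have "\<nexists>r. q = p @ r \<and> E.awalk v r v"
      using q by (auto simp: C_def)
    then have "?g \<otimes> path q v = \<zero>"
      using ghost_path_path_orth[OF u u'] p(2) q by auto
    then show "k q \<odot> (?g \<otimes> path q v) = \<zero>"
      using S0(3) by (simp add: smult_zero_right Pi_iff)
  qed (use S(1) summand in \<open>auto simp: C_def\<close>)
  also have "\<dots> = (\<Oplus>\<tau>\<in>C. k (p @ \<tau>) \<odot> (?g \<otimes> path (p @ \<tau>) v))"
    by (rule finsum_reindex) (use summand in \<open>auto simp: C_def inj_on_def\<close>)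
  also have "\<dots> = (\<Oplus>\<tau>\<in>C. k (p @ \<tau>) \<odot> path \<tau> v)"
  proof (rule finsum_cong'[OF refl])
    show "(\<lambda>\<tau>. k (p @ \<tau>) \<odot> path \<tau> v) \<in> C \<rightarrow> carrier A"
      by (rule real_sum_Pi) (use S0(3) in \<open>auto simp: C_def\<close>)
    fix \<tau> assume "\<tau> \<in> C"
    then have "E.awalk v \<tau> v" by (simp add: C_def)
    then show "k (p @ \<tau>) \<odot> (?g \<otimes> path (p @ \<tau>) v) = k (p @ \<tau>) \<odot> path \<tau> v"
      by (simp add: ghost_path_path_append[OF u])
  qed
  finally have "?g \<otimes> z = k p \<odot> vtx v \<oplus> (\<Oplus>\<tau>\<in>C. k (p @ \<tau>) \<odot> path \<tau> v)" .
  then show thesis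
  proof (rule that[of u p "k p" C "\<lambda>\<tau>. k (p @ \<tau>)", rotated -1])
    show "\<forall>\<tau>\<in>C. \<tau> \<noteq> [] \<and> E.awalk v \<tau> v" by (simp add: C_def)
  qed (use u S(3)[OF p(1)] finC S0(3) in auto)
qed

text \<open>A relation with invertible constant term, all other terms being closed paths of positive
  length. \<open>C\<close> may be empty; for a subspace \<open>N\<close> this means that
  \<open>v\<close> itself belongs to \<open>N\<close>.\<close>

definition relation_vertices :: "'a set \<Rightarrow> 'v set" where
  "relation_vertices N = {v \<in> verts E. \<exists>k C l. k \<in> carrier K \<and> k \<noteq> \<zero>\<^bsub>K\<^esub> \<and> finite C \<and>
     (\<forall>\<tau>\<in>C. \<tau> \<noteq> [] \<and> E.awalk v \<tau> v) \<and> l \<in> UNIV \<rightarrow> carrier K \<and>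
     k \<odot> vtx v \<oplus> (\<Oplus>\<tau>\<in>C. l \<tau> \<odot> path \<tau> v) \<in> N}"

end

text \<open>For \<open>x\<close> in \<open>N\<close> write
  \<open>x = y + \<Sum> x f f\<^sup>*\<close> over \<open>Z\<close>, with
  \<open>y = residual Z x\<close>. The elements \<open>x f\<close> lie in \<open>N\<close> and have
  smaller ghost degree, so only \<open>y\<close> remains, and for large \<open>Z\<close> it is the
  residual of a real \<open>z\<close>. Its column at \<open>v\<close> depends on the edges leaving
  \<open>v\<close>: at a sink it is \<open>z v\<close>, which is real; at a regular vertex it
  vanishes; at an infinite emitter a nonzero \<open>z v\<close> would force a vertex into
  \<open>N\<close>.\<close>

theorem (in leavitt_generating_family) vertexfree_ideal_subset:
  assumes N: "alg_ideal N" "\<And>v. v \<in> verts E \<Longrightarrow> vtx v \<notin> N"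
    and I: "alg_ideal I" "\<And>v. v \<in> relation_vertices N \<Longrightarrow> vtx v \<in> I"
  shows "N \<subseteq> I"
proof -
  note Is = alg_ideal_subspace[OF I(1)] and Ns = alg_ideal_subspace[OF N(1)]
  have I0: "\<zero> \<in> I" using Is by (simp add: subspace_def)
  have Nc: "x \<in> carrier A" if "x \<in> N" for x using Ns that by (auto simp: subspace_def)
  \<comment> \<open>The leading term of a nonzero real column in \<open>N\<close> shows that
    \<open>v\<close> is a relation vertex; then \<open>v\<close> lies in \<open>I\<close>, and so
    does \<open>z = z v\<close>.\<close>
  have real: "z \<in> I" if z: "v \<in> verts E" "z \<in> real_at v" "z \<otimes> vtx v = z" "z \<in> N" for z v
  proof (cases "z = \<zero>")
    case False
    obtain u p k C l where *: "E.awalk u p v" "k \<in> carrier K" "k \<noteq> \<zero>\<^bsub>K\<^esub>" "finite C"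
      "\<forall>\<tau>\<in>C. \<tau> \<noteq> [] \<and> E.awalk v \<tau> v" "l \<in> UNIV \<rightarrow> carrier K"
      "ghost_path p v \<otimes> z = k \<odot> vtx v \<oplus> (\<Oplus>\<tau>\<in>C. l \<tau> \<odot> path \<tau> v)"
      by (rule real_at_leading[OF z(1,2) False])
    have "ghost_path p v \<otimes> z \<in> N"
      using alg_ideal_left[OF N(1) z(4) ghost_path_closed[OF *(1)]] .
    then have "v \<in> relation_vertices N"
      unfolding relation_vertices_def using * z(1) by auto
    then show ?thesis
      using I(2) alg_ideal_left[OF I(1) _ Nc[OF z(4)]] z(3) by metis
  qed (use I0 in simp)
  have "x \<in> I" if "x \<in> ghost_degree n" "x \<in> N" for n x
    using that
  proof (induction n arbitrary: x)
    case 0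
    obtain V where V: "finite V" "V \<subseteq> verts E" "x = (\<Oplus>v\<in>V. x \<otimes> vtx v)"
      by (rule vertex_decomposition[OF Nc[OF 0(2)]])
    have "x \<otimes> vtx v \<in> I" if "v \<in> V" for v
    proof (rule real)
      show "v \<in> verts E" using that V by auto
      then show "x \<otimes> vtx v \<in> real_at v" "x \<otimes> vtx v \<otimes> vtx v = x \<otimes> vtx v" "x \<otimes> vtx v \<in> N"
        using 0 Nc[OF 0(2)] alg_ideal_right[OF N(1) 0(2)]
        by (auto simp: real_span_def mult_assoc vtx_idem)
    qed
    then show ?case using V(3) subspace_finsum[OF Is] by metis
  next
    case (Suc n)
    have xc: "x \<in> carrier A" using Nc Suc by blast
    obtain z Y where z: "z \<in> real_span" "finite Y" "Y \<subseteq> arcs E"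
      "\<And>Z. finite Z \<Longrightarrow> Y \<subseteq> Z \<Longrightarrow> Z \<subseteq> arcs E \<Longrightarrow> residual Z x = residual Z z"
      using Suc.prems(1) by auto
    have zc: "z \<in> carrier A" using z(1) by (rule real_span_closed)
    obtain V where V: "finite V" "V \<subseteq> verts E" "(\<Oplus>v\<in>V. vtx v) \<in> carrier A" "z \<otimes> (\<Oplus>v\<in>V. vtx v) = z"
      by (rule vertex_decomposition[OF zc])
    \<comment> \<open>Besides \<open>Y\<close>, the set contains all edges leaving vertices of
      finite out-degree in \<open>V\<close>, so that the residual annihilates each of them.
      \<open>V\<close> is finite, hence so is \<open>Z\<close>.\<close>
    define Z where "Z = Y \<union> (\<Union>v\<in>{v \<in> V. finite (out_arcs E v)}. out_arcs E v)"
    have Z: "finite Z" "Z \<subseteq> arcs E" "Y \<subseteq> Z"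
      using z V(1) by (auto simp: Z_def)
    define y where "y = residual Z x"
    have y: "y = residual Z z" using z(4)[OF Z(1,3,2)] by (simp add: y_def)
    have yc: "y \<in> carrier A" by (simp add: y_def residual_closed Z xc)
    have sumI: "(\<Oplus>f\<in>Z. (x \<otimes> edg f) \<otimes> gho f) \<in> I"
    proof (rule subspace_finsum[OF Is])
      fix f assume "f \<in> Z"
      then have f: "f \<in> arcs E" using Z by auto
      then have "x \<otimes> edg f \<in> I"
        using Suc.IH[of "x \<otimes> edg f"] Suc.prems(1) alg_ideal_right[OF N(1) Suc.prems(2), of "edg f"]
        by simp
      then show "(x \<otimes> edg f) \<otimes> gho f \<in> I" using f alg_ideal_right[OF I(1)] by simp
    qed
    have yN: "y \<in> N"
    proof -
      have "(\<Oplus>f\<in>Z. (x \<otimes> edg f) \<otimes> gho f) \<in> N"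
      proof (rule subspace_finsum[OF Ns])
        fix f assume "f \<in> Z"
        then have f: "f \<in> arcs E" using Z by auto
        then show "(x \<otimes> edg f) \<otimes> gho f \<in> N"
          using alg_ideal_right[OF N(1) Suc.prems(2), of "edg f"] alg_ideal_right[OF N(1), of _ "gho f"]
          by simp
      qed
      then show ?thesis unfolding y_def residual_def by (rule subspace_diff[OF Ns Suc.prems(2)])
    qed
    have yv: "y \<otimes> vtx v \<in> I" if v: "v \<in> verts E" for v
    proof (cases "z \<otimes> vtx v = \<zero>")
      case True
      then have "y \<otimes> vtx v = \<zero>"
        using residual_vtx[OF Z(1,2) zc v] residual_zero[OF Z(2)] y by simp
      then show ?thesis using I0 by simp
    next
      case False
      have vV: "v \<in> V"
      proof (rule ccontr)
        assume "v \<notin> V"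
        have "(\<Oplus>v\<in>V. vtx v) \<otimes> vtx v = (\<Oplus>w\<in>V. vtx w \<otimes> vtx v)"
          by (rule finsum_mult_left) (use V v in auto)
        also have "\<dots> = (\<Oplus>w\<in>V. \<zero>)"
          by (rule finsum_cong') (use V v \<open>v \<notin> V\<close> vtx_orth in auto)
        finally have "(z \<otimes> (\<Oplus>v\<in>V. vtx v)) \<otimes> vtx v = \<zero>"
          using zc V(3) v by (simp add: mult_assoc mult_zero_right)
        then show False using V(4) False by simp
      qed
      have zv: "z \<otimes> vtx v \<in> real_at v" using z(1) v by (simp add: real_span_def)
      have yvN: "y \<otimes> vtx v \<in> N" using alg_ideal_right[OF N(1) yN] v by simp
      show ?thesis
      proof (cases "finite (out_arcs E v)")
        case fin: True
        show ?thesis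
        proof (cases "out_arcs E v = {}")
          case True
          then have "y \<otimes> vtx v = z \<otimes> vtx v"
            using residual_vtx[OF Z(1,2) zc v] residual_sink[OF Z(2) zc v] y by simp
          then show ?thesis
            using real[OF v zv] yvN zc v by (simp add: mult_assoc vtx_idem)
        next
          case False
          then have "regular_vertex E v" using fin v by (simp add: regular_vertex_def)
          then have "y \<otimes> vtx v = y \<otimes> (\<Oplus>e\<in>out_arcs E v. edg e \<otimes> gho e)"
            by (simp add: vtx_regular)
          also have "\<dots> = (\<Oplus>e\<in>out_arcs E v. y \<otimes> (edg e \<otimes> gho e))"
            by (rule finsum_mult_right) (use fin yc in \<open>auto simp: mult_closed\<close>)
          also have "\<dots> = (\<Oplus>e\<in>out_arcs E v. \<zero>)"
          proof (rule finsum_cong'[OF refl])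
            fix e assume e: "e \<in> out_arcs E v"
            then have "e \<in> Z" "e \<in> arcs E" using vV fin by (auto simp: Z_def)
            then have "y \<otimes> edg e = \<zero>" using residual_edg[OF Z(1,2) zc] y by simp
            then show "y \<otimes> (edg e \<otimes> gho e) = \<zero>"
              using yc \<open>e \<in> arcs E\<close> by (simp add: mult_assoc[symmetric] mult_zero_left)
          qed auto
          finally show ?thesis using I0 by simp
        qed
      next
        case inf: False
        obtain u p k C l where *: "E.awalk u p v" "k \<in> carrier K" "k \<noteq> \<zero>\<^bsub>K\<^esub>" "finite C"
          "\<forall>\<tau>\<in>C. \<tau> \<noteq> [] \<and> E.awalk v \<tau> v" "l \<in> UNIV \<rightarrow> carrier K"
          "ghost_path p v \<otimes> (z \<otimes> vtx v) = k \<odot> vtx v \<oplus> (\<Oplus>\<tau>\<in>C. l \<tau> \<odot> path \<tau> v)"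
          by (rule real_at_leading[OF v zv False])
        \<comment> \<open>An edge outside the finite set \<open>Z\<close> and different from the
          first edge of every \<tau>: then \<open>y f = z f\<close> and
          \<open>f\<^sup>* \<tau> = 0\<close>. Consequently
          \<open>f\<^sup>* p\<^sup>* y f = k r(f)\<close> lies in \<open>N\<close>, which contains
          no vertex.\<close>
        obtain f where f: "f \<in> out_arcs E v" "f \<notin> Z \<union> hd ` C"
          using inf Z(1) *(4) by (metis finite_Un finite_imageI finite_subset subsetI)
        then have f': "f \<in> arcs E" "tail E f = v" by auto
        let ?g = "ghost_path p v"
        have gc: "?g \<in> carrier A" by (rule ghost_path_closed[OF *(1)])
        have summand: "l \<tau> \<odot> path \<tau> v \<in> carrier A" "gho f \<otimes> (l \<tau> \<odot> path \<tau> v) = \<zero>" if \<tau>C: "\<tau> \<in> C" for \<tau>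
        proof -
          obtain e \<sigma> where \<tau>: "\<tau> = e # \<sigma>" "e \<in> arcs E" "E.awalk (head E e) \<sigma> v" "e \<noteq> f"
          proof (cases \<tau>)
            case Nil
            then show thesis using bspec[OF *(5) \<tau>C] by simp
          next
            case (Cons e \<sigma>)
            then have "e \<in> hd ` C" using \<tau>C by force
            then show thesis
              using Cons bspec[OF *(5) \<tau>C] f that[of e \<sigma>] by auto
          qed
          have lk: "l \<tau> \<in> carrier K" using *(6) by auto
          have "path \<tau> v \<in> carrier A" using bspec[OF *(5) \<tau>C] path_closed[of v \<tau> v] by simp
          then show "l \<tau> \<odot> path \<tau> v \<in> carrier A" using lk by (simp add: smult_closed)
          have "gho f \<otimes> path \<tau> v = (gho f \<otimes> edg e) \<otimes> path \<sigma> v"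
            using \<tau> f' path_closed[OF \<tau>(3)] by (simp add: mult_assoc)
          then have "gho f \<otimes> path \<tau> v = \<zero>"
            using \<tau> f' path_closed[OF \<tau>(3)] by (simp add: gho_edg_orth mult_zero_left)
          then show "gho f \<otimes> (l \<tau> \<odot> path \<tau> v) = \<zero>"
            using lk f' \<open>path \<tau> v \<in> carrier A\<close> by (simp add: smult_mult_right smult_zero_right)
        qed
        have sc: "(\<Oplus>\<tau>\<in>C. l \<tau> \<odot> path \<tau> v) \<in> carrier A"
          by (rule finsum_closed) (use summand in auto)
        have "gho f \<otimes> (\<Oplus>\<tau>\<in>C. l \<tau> \<odot> path \<tau> v) = (\<Oplus>\<tau>\<in>C. gho f \<otimes> (l \<tau> \<odot> path \<tau> v))"
          by (rule finsum_mult_right) (use summand f' *(4) in auto)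
        also have "\<dots> = (\<Oplus>\<tau>\<in>C. \<zero>)" by (rule finsum_cong') (use summand in auto)
        finally have "gho f \<otimes> (k \<odot> vtx v \<oplus> (\<Oplus>\<tau>\<in>C. l \<tau> \<odot> path \<tau> v)) = k \<odot> gho f"
          using f' sc *(2) v gho_tail[of f]
          by (simp add: distrib_left smult_closed smult_mult_right)
        then have "(gho f \<otimes> (?g \<otimes> (z \<otimes> vtx v))) \<otimes> edg f = k \<odot> vtx (head E f)"
          using *(2,7) f' by (simp add: smult_mult_left gho_edg)
        moreover have "(gho f \<otimes> (?g \<otimes> (z \<otimes> vtx v))) \<otimes> edg f = (gho f \<otimes> ?g) \<otimes> (y \<otimes> edg f)"
        proof -
          have "y \<otimes> edg f = z \<otimes> edg f"
            using residual_edg[OF Z(1,2) zc f'(1)] f(2) y by simp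
          also have "\<dots> = (z \<otimes> vtx v) \<otimes> edg f"
            using zc v f' tail_edg[of f] by (simp add: mult_assoc)
          finally show ?thesis
            using gc zc v f' by (simp add: mult_assoc mult_closed)
        qed
        moreover have "(gho f \<otimes> ?g) \<otimes> (y \<otimes> edg f) \<in> N"
          using alg_ideal_left[OF N(1)] alg_ideal_right[OF N(1) yN] gc f' by (simp add: mult_closed)
        ultimately have kN: "k \<odot> vtx (head E f) \<in> N" by simp
        have hv: "head E f \<in> verts E" using f' by simp
        have "inv\<^bsub>K\<^esub> k \<odot> (k \<odot> vtx (head E f)) \<in> N"
          using Ns kN *(2,3) by (simp add: subspace_def K.field_Units)
        moreover have "inv\<^bsub>K\<^esub> k \<odot> (k \<odot> vtx (head E f)) = vtx (head E f)"
          using *(2,3) hv by (simp add: smult_assoc[symmetric] smult_one K.field_Units)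
        ultimately show ?thesis using N(2)[OF hv] by simp
      qed
    qed
    obtain W where W: "W \<subseteq> verts E" "y = (\<Oplus>v\<in>W. y \<otimes> vtx v)"
      by (rule vertex_decomposition[OF yc])
    then have "y \<in> I" using subspace_finsum[OF Is, of W "\<lambda>v. y \<otimes> vtx v"] yv by auto
    then have "y \<oplus> (\<Oplus>f\<in>Z. (x \<otimes> edg f) \<otimes> gho f) \<in> I"
      using sumI Is by (simp add: subspace_def)
    then show ?case
      using xc residual_sum_closed[OF Z(2) xc] by (simp add: y_def residual_def diff_add_cancel)
  qed
  then show ?thesis using ghost_degree_exhausts Nc by blast
qed

section \<open>Corners at vertices satisfying a polynomial relation\<close>

text \<open>The exponents \<open>n i\<close> may repeat, so the relation does not come as a
  polynomial in normal form. The polynomial \<open>p\<close> is assembled in \<open>F[X]\<close> and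
  is nonzero because its value at zero is \<open>k\<close>, all exponents being positive. Hence
  \<open>x\<close> is algebraic over \<open>F\<close>.\<close>

lemma (in domain) simple_extension_subfieldI:
  assumes F: "subfield F R" and x: "x \<in> carrier R"
    and k: "k \<in> F" "k \<noteq> \<zero>" and C: "finite C" "l \<in> C \<rightarrow> F" "\<And>i. i \<in> C \<Longrightarrow> 0 < n i"
    and rel: "k \<oplus> (\<Oplus>i\<in>C. l i \<otimes> x [^] (n i :: nat)) = \<zero>"
  shows "subfield (simple_extension F x) R"
proof -
  note sub = subfieldE(1)[OF F]
  note FR = subringE(1)[OF sub]
  interpret UP: domain "F[X]" by (rule univ_poly_is_domain[OF sub])
  note pc = ring_hom_memE(1)[OF canonical_embedding_is_hom[OF sub], simplified]
  have Xc: "X \<in> carrier (F[X])" by (rule var_closed(1)[OF sub])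
  have ev_const: "eval (poly_of_const c) y = c" if "c \<in> F" "y \<in> carrier R" for c y
    using that FR by (auto simp: poly_of_const_def)
  define p where "p = poly_of_const k \<oplus>\<^bsub>F[X]\<^esub>
    (\<Oplus>\<^bsub>F[X]\<^esub>i\<in>C. poly_of_const (l i) \<otimes>\<^bsub>F[X]\<^esub> X [^]\<^bsub>F[X]\<^esub> n i)"
  have lc: "l i \<in> F" if "i \<in> C" for i using C(2) that by auto
  have sc: "poly_of_const (l i) \<otimes>\<^bsub>F[X]\<^esub> X [^]\<^bsub>F[X]\<^esub> n i \<in> carrier (F[X])" if "i \<in> C" for i
    using lc[OF that] pc Xc by auto
  have p: "p \<in> carrier (F[X])"
    unfolding p_def by (intro UP.a_closed pc k UP.finsum_closed) (use sc in auto)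
  have ev: "eval p y = k \<oplus> (\<Oplus>i\<in>C. l i \<otimes> y [^] n i)" if y: "y \<in> carrier R" for y
  proof -
    interpret h: ring_hom_ring "F[X]" R "\<lambda>p. eval p y" by (rule eval_ring_hom[OF sub y])
    have "eval p y = eval (poly_of_const k) y \<oplus>
        eval (\<Oplus>\<^bsub>F[X]\<^esub>i\<in>C. poly_of_const (l i) \<otimes>\<^bsub>F[X]\<^esub> X [^]\<^bsub>F[X]\<^esub> n i) y"
      unfolding p_def by (intro h.hom_add pc k UP.finsum_closed) (use sc in auto)
    also have "eval (\<Oplus>\<^bsub>F[X]\<^esub>i\<in>C. poly_of_const (l i) \<otimes>\<^bsub>F[X]\<^esub> X [^]\<^bsub>F[X]\<^esub> n i) y
      = (\<Oplus>i\<in>C. eval (poly_of_const (l i) \<otimes>\<^bsub>F[X]\<^esub> X [^]\<^bsub>F[X]\<^esub> n i) y)"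
      using h.hom_finsum[of "\<lambda>i. poly_of_const (l i) \<otimes>\<^bsub>F[X]\<^esub> X [^]\<^bsub>F[X]\<^esub> n i" C] sc
      by (simp add: o_def Pi_iff)
    also have "\<dots> = (\<Oplus>i\<in>C. l i \<otimes> y [^] n i)"
    proof (rule finsum_cong'[OF refl])
      fix i assume i: "i \<in> C"
      have "eval (poly_of_const (l i) \<otimes>\<^bsub>F[X]\<^esub> X [^]\<^bsub>F[X]\<^esub> n i) y
        = eval (poly_of_const (l i)) y \<otimes> eval (X [^]\<^bsub>F[X]\<^esub> n i) y"
        by (rule h.hom_mult) (use pc lc[OF i] Xc in auto)
      then show "eval (poly_of_const (l i) \<otimes>\<^bsub>F[X]\<^esub> X [^]\<^bsub>F[X]\<^esub> n i) y = l i \<otimes> y [^] n i"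
        using h.hom_nat_pow[OF Xc, of "n i"] ev_const[OF lc[OF i] y] eval_var[OF y] by simp
    qed (use lc FR y in auto)
    finally show ?thesis using ev_const[OF k(1) y] by simp
  qed
  have "eval p \<zero> = k"
  proof -
    have "(\<Oplus>i\<in>C. l i \<otimes> \<zero> [^] n i) = (\<Oplus>i\<in>C. \<zero>)"
    proof (rule finsum_cong'[OF refl])
      fix i assume i: "i \<in> C"
      then obtain m where "n i = Suc m" using C(3) by (metis gr0_conv_Suc)
      then show "l i \<otimes> \<zero> [^] n i = \<zero>" using lc[OF i] FR by auto
    qed auto
    then show ?thesis using ev[of \<zero>] k FR by auto
  qed
  then have "p \<noteq> []" using k by auto
  then have "(algebraic over F) x"
    by (rule algebraicI[OF p]) (simp add: ev[OF x] rel)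
  then show ?thesis using simple_extension_is_subfield[OF F x] by simp
qed

section \<open>Corner rings\<close>

context rng
begin

text \<open>For an idempotent \<open>w\<close> this is \<open>w R w\<close>.\<close>

definition corner :: "'a \<Rightarrow> 'a set" where
  "corner w = {x \<in> carrier R. w \<otimes> x = x \<and> x \<otimes> w = x}"

abbreviation "corner_ring w \<equiv> R\<lparr>carrier := corner w, one := w\<rparr>"

lemma corner_closed: "x \<in> corner w \<Longrightarrow> x \<in> carrier R"
  by (simp add: corner_def)

lemma ring_corner_ring:
  assumes w: "w \<in> carrier R" "w \<otimes> w = w"
  shows "ring (corner_ring w)"
proof (rule ringI)
  show "abelian_group (corner_ring w)"
  proof (rule abelian_groupI)
    fix x assume x: "x \<in> carrier (corner_ring w)"
    then show "\<exists>y\<in>carrier (corner_ring w). y \<oplus>\<^bsub>corner_ring w\<^esub> x = \<zero>\<^bsub>corner_ring w\<^esub>"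
      using w by (intro bexI[of _ "\<ominus> x"]) (auto simp: corner_def mult_minus_left mult_minus_right l_neg)
  qed (use w in \<open>auto simp: corner_def distrib_left distrib_right a_ac mult_zero_left mult_zero_right\<close>)
  show "monoid (corner_ring w)"
  proof (rule monoidI)
    fix x y assume "x \<in> carrier (corner_ring w)" "y \<in> carrier (corner_ring w)"
    then have xy: "x \<in> carrier R" "y \<in> carrier R" "w \<otimes> x = x" "y \<otimes> w = y" by (auto simp: corner_def)
    then show "x \<otimes>\<^bsub>corner_ring w\<^esub> y \<in> carrier (corner_ring w)"
      using w mult_assoc[of w x y] mult_assoc[of x y w] by (simp add: corner_def mult_closed)
  qed (use w in \<open>auto simp: corner_def mult_assoc\<close>)
qed (auto simp: corner_def distrib_left distrib_right)

end

section \<open>Prefixes of powers of a word\<close>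

lemma prefix_append_cases:
  "prefix \<nu> (\<tau> @ \<nu>) \<Longrightarrow> prefix \<nu> (concat (replicate n \<tau>) @ \<nu>)"
proof (induction n)
  case (Suc n)
  then have "prefix (\<tau> @ \<nu>) (\<tau> @ concat (replicate n \<tau>) @ \<nu>)" by simp
  then show ?case using Suc.prems prefix_order.trans by (metis append.assoc concat.simps(2) replicate_Suc)
qed simp

text \<open>By iteration \<nu> is a prefix of \<open>\<tau>\<^sup>n \<nu>\<close>; as \<tau> is
  nonempty, the power alone is already long enough to contain it. So \<nu> is an initial piece of
  the infinite word \<tau>\<tau>\<tau>...\<close>

lemma prefix_replicate:
  assumes "prefix \<nu> (\<tau> @ \<nu>)" "\<tau> \<noteq> []" "length \<nu> \<le> n"
  shows "prefix \<nu> (concat (replicate n \<tau>))"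
proof -
  have "prefix \<nu> (concat (replicate n \<tau>) @ \<nu>)" by (rule prefix_append_cases[OF assms(1)])
  moreover have "length (concat (replicate n \<tau>)) = n * length \<tau>"
    by (induction n) auto
  then have "length \<nu> \<le> length (concat (replicate n \<tau>))"
    using assms(2,3) by (metis One_nat_def Suc_leI length_greater_0_conv le_trans mult.right_neutral mult_le_mono2)
  ultimately show ?thesis
    by (metis prefix_length_prefix prefixI)
qed

text \<open>Pigeonhole: if \<open>\<sigma>\<close> and \<open>\<rho>\<close> are incomparable, then so are the words \<open>\<sigma>\<^sup>j \<rho>\<close>, hence each
  \<open>\<tau>\<^sup>\<infinity>\<close> has at most one of them as a prefix.\<close>

lemma prefix_comparable_if_finite:
  fixes \<sigma> \<rho> :: "'e list"
  assumes C: "finite C" "[] \<notin> C"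
    and words: "\<And>j. \<exists>\<tau>\<in>C. prefix (concat (replicate j \<sigma>) @ \<rho>) (\<tau> @ concat (replicate j \<sigma>) @ \<rho>)"
  shows "prefix \<sigma> \<rho> \<or> prefix \<rho> \<sigma>"
proof -
  define a where "a j = concat (replicate j \<sigma>) @ \<rho>" for j :: nat
  obtain t where t: "\<And>j. t j \<in> C \<and> prefix (a j) (t j @ a j)"
    using words unfolding a_def by metis
  have "\<not> inj t"
    using C(1) t by (metis finite_subset finite_imageD image_subsetI infinite_UNIV_nat)
  then obtain i j where ij: "i < j" "t i = t j"
    by (metis injI nat_neq_iff)
  define n where "n = max (length (a i)) (length (a j))"
  have "prefix (a i) (concat (replicate n (t i)))" "prefix (a j) (concat (replicate n (t i)))"
    using t[of i] t[of j] C(2) ij(2) by (metis n_def prefix_replicate max.cobounded1 max.cobounded2)+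
  then have comp: "prefix (a i) (a j) \<or> prefix (a j) (a i)"
    by (rule prefix_same_cases)
  \<comment> \<open>After cancelling \<open>\<sigma>\<^sup>i\<close>, comparing \<open>a i\<close>
    with \<open>a j\<close> means comparing \<rho> with \<sigma> followed by
    \<open>y\<close>.\<close>
  define y where "y = concat (replicate (j - Suc i) \<sigma>) @ \<rho>"
  have "replicate j \<sigma> = replicate i \<sigma> @ \<sigma> # replicate (j - Suc i) \<sigma>"
    using ij(1) by (metis Suc_diff_Suc replicate_Suc replicate_add add_diff_inverse_nat less_imp_not_less)
  then have "a j = concat (replicate i \<sigma>) @ \<sigma> @ y"
    by (simp add: a_def y_def)
  then have "prefix \<rho> (\<sigma> @ y) \<or> prefix (\<sigma> @ y) \<rho>"
    using comp by (simp add: a_def)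
  then show ?thesis
    using prefix_same_cases[of \<rho> "\<sigma> @ y" \<sigma>] append_prefixD[of \<sigma> y \<rho>] by auto
qed

section \<open>Paths starting at a vertex with a polynomial relation\<close>

context leavitt_family
begin

declare E.awalk_append_iff [simp del]

lemma awalk_append_eq: "E.awalk u p v \<Longrightarrow> E.awalk u (p @ q) w \<longleftrightarrow> E.awalk v q w"
proof (induction p arbitrary: u)
  case (Cons e p)
  then show ?case by auto
qed simp

lemma awalk_concat_replicate: "E.awalk w \<tau> w \<Longrightarrow> E.awalk w (concat (replicate n \<tau>)) w"
  by (induction n) (auto simp: awalk_verts awalk_append_eq)

end

text \<open>The situation in the quotient: all vertices of the graph survive in the algebra, and at
  \<open>w\<close> a relation with nonzero constant term holds with value zero.\<close>

locale relation_vertex = leavitt_generating_family +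
  fixes w
  assumes nonzero_vertices: "v \<in> verts E \<Longrightarrow> vtx v \<noteq> \<zero>"
    and relation_vertex: "w \<in> relation_vertices {\<zero>}"
begin

lemma w_vert: "w \<in> verts E"
  using relation_vertex by (simp add: relation_vertices_def)

lemma relationE:
  obtains k C l where "k \<in> carrier K" "k \<noteq> \<zero>\<^bsub>K\<^esub>" "finite C" "[] \<notin> C"
    "\<forall>\<tau>\<in>C. E.awalk w \<tau> w" "l \<in> UNIV \<rightarrow> carrier K"
    "k \<odot> vtx w \<oplus> (\<Oplus>\<tau>\<in>C. l \<tau> \<odot> path \<tau> w) = \<zero>"
  using relation_vertex unfolding relation_vertices_def by blast

text \<open>Compress the relation by \<nu>:
  \<open>\<nu>\<^sup>* (k w + \<Sum> l\<^sub>\<tau> \<tau>) \<nu> = 0\<close>. If \<nu> is a prefix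
  of no \<open>\<tau> @ \<nu>\<close>, every term with \<tau> vanishes and \<open>k u = 0\<close>
  remains, although vertices are nonzero. The point is that one finite set \<open>C\<close> serves
  for all \<nu>.\<close>

lemma relation_prefix:
  obtains C where "finite C" "C \<noteq> {}" "[] \<notin> C" "\<forall>\<tau>\<in>C. E.awalk w \<tau> w"
    "\<forall>\<nu> u. E.awalk w \<nu> u \<longrightarrow> (\<exists>\<tau>\<in>C. prefix \<nu> (\<tau> @ \<nu>))"
proof -
  obtain k C l where *: "k \<in> carrier K" "k \<noteq> \<zero>\<^bsub>K\<^esub>" "finite C" "[] \<notin> C"
    "\<forall>\<tau>\<in>C. E.awalk w \<tau> w" "l \<in> UNIV \<rightarrow> carrier K"
    "k \<odot> vtx w \<oplus> (\<Oplus>\<tau>\<in>C. l \<tau> \<odot> path \<tau> w) = \<zero>"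
    by (rule relationE)
  have main: "\<exists>\<tau>\<in>C. prefix \<nu> (\<tau> @ \<nu>)" if \<nu>: "E.awalk w \<nu> u" for \<nu> u
  proof (rule ccontr)
    assume no: "\<not> ?thesis"
    let ?g = "ghost_path \<nu> u" and ?p = "path \<nu> u"
    have gp: "?g \<in> carrier A" "?p \<in> carrier A" "u \<in> verts E"
      using ghost_path_closed[OF \<nu>] path_closed[OF \<nu>] awalk_verts[OF \<nu>] by auto
    have lk: "l \<tau> \<in> carrier K" for \<tau> using *(6) by auto
    have tc: "path \<tau> w \<in> carrier A" if "\<tau> \<in> C" for \<tau>
      using bspec[OF *(5) that] by (rule path_closed)
    have kill: "?g \<otimes> (l \<tau> \<odot> path \<tau> w) \<otimes> ?p = \<zero>" if \<tau>: "\<tau> \<in> C" for \<tau>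
    proof -
      have \<tau>\<nu>: "E.awalk w (\<tau> @ \<nu>) u"
        using bspec[OF *(5) \<tau>] \<nu> by (simp add: awalk_append_eq)
      have "?g \<otimes> path (\<tau> @ \<nu>) u = \<zero>"
        by (rule ghost_path_path_orth[OF \<nu> \<tau>\<nu>]) (use no \<tau> in \<open>auto simp: prefix_def\<close>)
      then have "?g \<otimes> (path \<tau> w \<otimes> ?p) = \<zero>"
        using path_append[OF bspec[OF *(5) \<tau>] \<nu>] by simp
      then show ?thesis
        using gp tc[OF \<tau>] lk
        by (simp add: smult_mult_left smult_mult_right mult_assoc mult_closed smult_zero_right)
    qed
    have sc: "l \<tau> \<odot> path \<tau> w \<in> carrier A" if "\<tau> \<in> C" for \<tau>
      using tc[OF that] lk by (simp add: smult_closed)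
    have sumc: "(\<Oplus>\<tau>\<in>C. l \<tau> \<odot> path \<tau> w) \<in> carrier A"
      by (rule finsum_closed) (use sc in auto)
    have "?g \<otimes> (\<Oplus>\<tau>\<in>C. l \<tau> \<odot> path \<tau> w) \<otimes> ?p = (\<Oplus>\<tau>\<in>C. ?g \<otimes> (l \<tau> \<odot> path \<tau> w)) \<otimes> ?p"
      using finsum_mult_right[OF *(3) _ gp(1)] sc by (simp add: Pi_iff)
    also have "\<dots> = (\<Oplus>\<tau>\<in>C. ?g \<otimes> (l \<tau> \<odot> path \<tau> w) \<otimes> ?p)"
      by (rule finsum_mult_left[OF *(3) _ gp(2)]) (use gp sc in \<open>auto intro!: mult_closed\<close>)
    also have "\<dots> = (\<Oplus>\<tau>\<in>C. \<zero>)"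
      by (rule finsum_cong') (use kill in auto)
    finally have sum0: "?g \<otimes> (\<Oplus>\<tau>\<in>C. l \<tau> \<odot> path \<tau> w) \<otimes> ?p = \<zero>" by simp
    have "?g \<otimes> (k \<odot> vtx w \<oplus> (\<Oplus>\<tau>\<in>C. l \<tau> \<odot> path \<tau> w)) \<otimes> ?p = ?g \<otimes> (k \<odot> vtx w) \<otimes> ?p"
      using gp sumc *(1) w_vert sum0
      by (simp add: distrib_left distrib_right smult_closed mult_closed)
    also have "\<dots> = k \<odot> vtx u"
      using gp *(1) w_vert ghost_path_vtx[OF \<nu>] ghost_path_path[OF \<nu>]
      by (simp add: smult_mult_right smult_mult_left)
    finally have "k \<odot> vtx u = \<zero>"
      using *(7) gp by (simp add: mult_zero_left mult_zero_right)
    then show False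
      using smult_eq_zero[OF *(1,2)] gp nonzero_vertices[of u] by simp
  qed
  have "C \<noteq> {}" using main[of "[]" w] w_vert by auto
  moreover have "\<forall>\<nu> u. E.awalk w \<nu> u \<longrightarrow> (\<exists>\<tau>\<in>C. prefix \<nu> (\<tau> @ \<nu>))"
    by (intro allI impI) (rule main)
  ultimately show thesis using that[of C] *(3,4,5) by simp
qed

text \<open>The path \<nu> is a prefix of a power of some \<tau> in \<open>C\<close>, a closed path
  at \<open>w\<close>, so the remainder leads back to \<open>w\<close>. One more \<tau> is appended
  to make the return path nonempty even if the remainder is empty.\<close>

lemma returns:
  assumes "E.awalk w \<nu> u"
  obtains \<rho> where "E.awalk u \<rho> w" "\<rho> \<noteq> []"
proof -
  obtain C where C: "finite C" "C \<noteq> {}" "[] \<notin> C" "\<forall>\<tau>\<in>C. E.awalk w \<tau> w"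
    "\<forall>\<nu> u. E.awalk w \<nu> u \<longrightarrow> (\<exists>\<tau>\<in>C. prefix \<nu> (\<tau> @ \<nu>))"
    by (rule relation_prefix)
  obtain \<tau> where \<tau>: "\<tau> \<in> C" "prefix \<nu> (\<tau> @ \<nu>)"
    using C(5)[rule_format, OF assms] by auto
  then have "\<tau> \<noteq> []" using C(3) by auto
  have "prefix \<nu> (concat (replicate (length \<nu>) \<tau>))"
    by (rule prefix_replicate[OF \<tau>(2) \<open>\<tau> \<noteq> []\<close>]) simp
  then obtain \<rho> where "concat (replicate (length \<nu>) \<tau>) = \<nu> @ \<rho>" by (auto simp: prefix_def)
  then have \<rho>: "E.awalk u \<rho> w"
    using awalk_concat_replicate[of w \<tau> "length \<nu>"] bspec[OF C(4) \<tau>(1)] awalk_append_eq[OF assms]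
    by simp
  then have "E.awalk u (\<rho> @ \<tau>) w" using bspec[OF C(4) \<tau>(1)] awalk_append_eq[OF \<rho>] by simp
  then show thesis using that[of "\<rho> @ \<tau>"] \<open>\<tau> \<noteq> []\<close> by simp
qed

text \<open>Return paths complete both to closed paths at \<open>w\<close>. Every power of the first
  followed by the second is again a path from \<open>w\<close>, so the pigeonhole argument over
  \<open>C\<close> applies; prefixes of comparable words are comparable.\<close>

lemma comparable:
  assumes "E.awalk w \<mu> u" "E.awalk w \<nu> v"
  shows "prefix \<mu> \<nu> \<or> prefix \<nu> \<mu>"
proof -
  obtain \<rho> where \<rho>: "E.awalk u \<rho> w" by (rule returns[OF assms(1)])
  obtain \<rho>' where \<rho>': "E.awalk v \<rho>' w" by (rule returns[OF assms(2)])
  have s: "E.awalk w (\<mu> @ \<rho>) w" "E.awalk w (\<nu> @ \<rho>') w"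
    using assms \<rho> \<rho>' by (simp_all add: awalk_append_eq)
  obtain C where C: "finite C" "C \<noteq> {}" "[] \<notin> C" "\<forall>\<tau>\<in>C. E.awalk w \<tau> w"
    "\<forall>\<nu> u. E.awalk w \<nu> u \<longrightarrow> (\<exists>\<tau>\<in>C. prefix \<nu> (\<tau> @ \<nu>))"
    by (rule relation_prefix)
  have "prefix (\<mu> @ \<rho>) (\<nu> @ \<rho>') \<or> prefix (\<nu> @ \<rho>') (\<mu> @ \<rho>)"
  proof (rule prefix_comparable_if_finite[OF C(1,3)])
    fix j
    have "E.awalk w (concat (replicate j (\<mu> @ \<rho>)) @ \<nu> @ \<rho>') w"
      using awalk_append_eq[OF awalk_concat_replicate[OF s(1), of j]] s(2) by simp
    then show "\<exists>\<tau>\<in>C. prefix (concat (replicate j (\<mu> @ \<rho>)) @ \<nu> @ \<rho>')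
        (\<tau> @ concat (replicate j (\<mu> @ \<rho>)) @ \<nu> @ \<rho>')"
      by (rule C(5)[rule_format])
  qed
  then show ?thesis
    by (metis append_prefixD prefixI prefix_same_cases)
qed

text \<open>Some edge must leave \<open>u\<close> in order to return to \<open>w\<close>, and two of
  them would extend \<nu> to incomparable paths of equal length. So the paths from \<open>w\<close>
  run along a cycle without exit.\<close>

lemma out_arcs_reachable:
  assumes "E.awalk w \<nu> u"
  obtains e where "out_arcs E u = {e}"
proof -
  obtain \<rho> where \<rho>: "E.awalk u \<rho> w" "\<rho> \<noteq> []" by (rule returns[OF assms])
  from \<rho> obtain e \<sigma> where e: "\<rho> = e # \<sigma>" "e \<in> arcs E" "tail E e = u"
    by (cases \<rho>) simp_all
  have "f = e" if f: "f \<in> arcs E" "tail E f = u" for f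
  proof -
    have "E.awalk w (\<nu> @ [e]) (head E e)" "E.awalk w (\<nu> @ [f]) (head E f)"
      using assms e f by (simp_all add: awalk_append_eq)
    then have "prefix (\<nu> @ [e]) (\<nu> @ [f]) \<or> prefix (\<nu> @ [f]) (\<nu> @ [e])" by (rule comparable)
    then have "e = f \<or> f = e" by simp
    then show ?thesis by (elim disjE) simp_all
  qed
  then have "out_arcs E u \<subseteq> {e}" unfolding out_arcs_def by blast
  moreover have "e \<in> out_arcs E u" using e by simp
  ultimately show thesis by (intro that[of e]) auto
qed

text \<open>Each vertex met on the way is regular with a single edge, so its relation reads
  \<open>v = e e\<^sup>*\<close>. Paths along the cycle thus become invertible, with their ghosts as
  inverses.\<close>

lemma path_ghost_path_reachable:
  "E.awalk w \<mu> v \<Longrightarrow> E.awalk v \<nu> u \<Longrightarrow> path \<nu> u \<otimes> ghost_path \<nu> u = vtx v"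
proof (induction \<nu> arbitrary: v \<mu>)
  case Nil
  then show ?case by (auto simp: vtx_idem)
next
  case (Cons e \<nu>)
  then have e: "e \<in> arcs E" "v = tail E e" and \<nu>: "E.awalk (head E e) \<nu> u" by auto
  have "E.awalk w (\<mu> @ [e]) (head E e)" using Cons.prems e by (simp add: awalk_append_eq)
  then have IH: "path \<nu> u \<otimes> ghost_path \<nu> u = vtx (head E e)" by (rule Cons.IH) (rule \<nu>)
  obtain f where "out_arcs E v = {f}" by (rule out_arcs_reachable[OF Cons.prems(1)])
  then have out: "out_arcs E v = {e}" using e by (auto simp: out_arcs_def)
  then have "regular_vertex E v" using e by (simp add: regular_vertex_def)
  then have v: "vtx v = edg e \<otimes> gho e"
    using vtx_regular out e by (simp add: mult_closed)
  have "path (e # \<nu>) u \<otimes> ghost_path (e # \<nu>) u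
    = edg e \<otimes> ((path \<nu> u \<otimes> ghost_path \<nu> u) \<otimes> gho e)"
    using e path_closed[OF \<nu>] ghost_path_closed[OF \<nu>] by (simp add: mult_assoc mult_closed)
  also have "\<dots> = vtx v" unfolding IH using e v head_gho by simp
  finally show ?case .
qed

end

lemma (in rng) finsum_corner_ring:
  assumes w: "w \<in> carrier R" "w \<otimes> w = w" and f: "f \<in> S \<rightarrow> corner w"
  shows "finsum (corner_ring w) f S = finsum R f S"
proof -
  interpret C: ring "corner_ring w" by (rule ring_corner_ring[OF w])
  show ?thesis
    using f
  proof (induction S rule: infinite_finite_induct)
    case (infinite S)
    then show ?case by (simp add: C.finsum_infinite finsum_infinite)
  next
    case (insert i S)
    then have "f \<in> S \<rightarrow> carrier R" "f i \<in> carrier R" by (auto simp: corner_def)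
    with insert show ?case by simp
  qed simp
qed

text \<open>The elementwise form of primeness: \<open>x R y = 0\<close> only if one of the two
  factors vanishes.\<close>

definition (in rng) elementwise_prime :: bool where
  "elementwise_prime \<longleftrightarrow>
     (\<forall>x\<in>carrier R. \<forall>y\<in>carrier R. (\<forall>t\<in>carrier R. x \<otimes> t \<otimes> y = \<zero>) \<longrightarrow> x = \<zero> \<or> y = \<zero>)"

lemma (in rng) elementwise_primeE:
  assumes "elementwise_prime" "x \<in> carrier R" "y \<in> carrier R" "x \<noteq> \<zero>" "y \<noteq> \<zero>"
  obtains t where "t \<in> carrier R" "x \<otimes> t \<otimes> y \<noteq> \<zero>"
  using assms unfolding elementwise_prime_def by blast

context rng_algebra
begin

lemma subspace_centralizer: "y \<in> carrier A \<Longrightarrow> subspace {x \<in> carrier A. x \<otimes> y = y \<otimes> x}"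
  by (auto simp: subspace_def mult_zero_left mult_zero_right distrib_left distrib_right
      smult_closed smult_mult_left smult_mult_right)

lemma subspace_compress_vimage:
  "w \<in> carrier A \<Longrightarrow> subspace S \<Longrightarrow> subspace {x \<in> carrier A. w \<otimes> x \<otimes> w \<in> S}"
  by (auto simp: subspace_def mult_zero_left mult_zero_right distrib_left distrib_right
      smult_closed smult_mult_left smult_mult_right mult_closed)

end

section \<open>The corner at a relation vertex is a field\<close>

context relation_vertex
begin

definition cycle :: "'e list" where
  "cycle = arg_min length (\<lambda>c. c \<noteq> [] \<and> E.awalk w c w)"

lemma cycle: "cycle \<noteq> []" "E.awalk w cycle w"
  and cycle_shortest: "c \<noteq> [] \<Longrightarrow> E.awalk w c w \<Longrightarrow> length cycle \<le> length c"
proof -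
  obtain \<rho> where \<rho>: "E.awalk w \<rho> w" "\<rho> \<noteq> []"
    using returns[of "[]" w] w_vert by auto
  have "cycle \<noteq> [] \<and> E.awalk w cycle w"
    unfolding cycle_def by (rule arg_min_natI[of _ \<rho>]) (simp add: \<rho>)
  then show "cycle \<noteq> []" "E.awalk w cycle w" by auto
  show "c \<noteq> [] \<Longrightarrow> E.awalk w c w \<Longrightarrow> length cycle \<le> length c"
    unfolding cycle_def by (rule arg_min_nat_le) simp
qed

text \<open>A nonempty closed walk is comparable with \<open>cycle\<close> and not shorter, hence
  starts with it; what follows is a shorter closed walk.\<close>

lemma closed_walk_power:
  "E.awalk w \<sigma> w \<Longrightarrow> \<exists>n. \<sigma> = concat (replicate n cycle)"
proof (induction "length \<sigma>" arbitrary: \<sigma> rule: less_induct)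
  case less
  show ?case
  proof (cases "\<sigma> = []")
    case True
    then show ?thesis by (intro exI[of _ 0]) simp
  next
    case False
    have "prefix cycle \<sigma> \<or> prefix \<sigma> cycle" by (rule comparable[OF cycle(2) less.prems])
    then have "prefix cycle \<sigma>"
      using cycle_shortest[OF False less.prems] by (auto simp: prefix_def)
    then obtain \<sigma>' where \<sigma>': "\<sigma> = cycle @ \<sigma>'" by (auto simp: prefix_def)
    then have "E.awalk w \<sigma>' w" using less.prems awalk_append_eq[OF cycle(2)] by simp
    then obtain n where "\<sigma>' = concat (replicate n cycle)"
      using less.hyps[of \<sigma>'] \<sigma>' cycle(1) by auto
    then show ?thesis using \<sigma>' by (intro exI[of _ "Suc n"]) simp
  qed
qed

abbreviation "W \<equiv> vtx w"
abbreviation "C \<equiv> corner_ring W"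
abbreviation "a \<equiv> path cycle w"
abbreviation "b \<equiv> ghost_path cycle w"

lemma w_idempotent: "W \<in> carrier A" "W \<otimes> W = W" "W \<noteq> \<zero>"
  using w_vert nonzero_vertices by (auto simp: vtx_idem)

lemma ring_corner_w: "ring C"
  by (rule ring_corner_ring[OF w_idempotent(1,2)])

lemma cycle_inverse: "a \<in> corner W" "b \<in> corner W" "a \<otimes> b = W" "b \<otimes> a = W"
  using cycle(2) path_closed ghost_path_closed vtx_path path_vtx ghost_path_vtx vtx_ghost_path
    ghost_path_path path_ghost_path_reachable[of "[]" w cycle w] w_vert
  by (auto simp: corner_def)

lemma path_power: "path (concat (replicate n cycle)) w = a [^]\<^bsub>C\<^esub> n"
proof (induction n)
  case 0
  show ?case by simp
next
  case (Suc n)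
  interpret C: ring C by (rule ring_corner_w)
  have "path (concat (replicate (Suc n) cycle)) w = a \<otimes> path (concat (replicate n cycle)) w"
    using path_append[OF cycle(2) awalk_concat_replicate[OF cycle(2)]] by simp
  then show ?case using Suc C.nat_pow_Suc2[of a n] cycle_inverse(1) by simp
qed

lemma ghost_path_power: "ghost_path (concat (replicate n cycle)) w = b [^]\<^bsub>C\<^esub> n"
proof (induction n)
  case 0
  show ?case by simp
next
  case (Suc n)
  have "ghost_path (concat (replicate (Suc n) cycle)) w = ghost_path (concat (replicate n cycle)) w \<otimes> b"
    using ghost_path_append[OF cycle(2) awalk_concat_replicate[OF cycle(2)]] by simp
  then show ?case using Suc by simp
qed

text \<open>A product \<open>p q\<^sup>*\<close> survives compression by \<open>W\<close> only when
  both paths start at \<open>w\<close>. Inserting \<open>\<delta> \<delta>\<^sup>* = v\<close> for a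
  return path \<delta> makes it a closed path times a closed ghost path at \<open>w\<close>, that
  is, a power of \<open>a\<close> times a power of \<open>b\<close>.\<close>

lemma corner_spanned:
  assumes S: "subspace S" and powers: "\<And>(m :: nat) (n :: nat). a [^]\<^bsub>C\<^esub> m \<otimes> b [^]\<^bsub>C\<^esub> n \<in> S"
  shows "corner W \<subseteq> S"
proof -
  have "carrier A \<subseteq> {x \<in> carrier A. W \<otimes> x \<otimes> W \<in> S}"
  proof (rule spanned[OF subspace_compress_vimage[OF w_idempotent(1) S]])
    fix u p v x q assume p: "E.awalk u p v" and q: "E.awalk x q v"
    have cl: "path p v \<in> carrier A" "ghost_path q v \<in> carrier A"
      using path_closed[OF p] ghost_path_closed[OF q] by auto
    have eq: "W \<otimes> (path p v \<otimes> ghost_path q v) \<otimes> W = (W \<otimes> path p v) \<otimes> (ghost_path q v \<otimes> W)"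
      using cl w_idempotent(1) by (simp add: mult_assoc mult_closed)
    have "(W \<otimes> path p v) \<otimes> (ghost_path q v \<otimes> W) \<in> S"
    proof (cases "u = w \<and> x = w")
      case False
      then have "W \<otimes> path p v = \<zero> \<or> ghost_path q v \<otimes> W = \<zero>"
        using vtx_path_orth[OF p w_vert] ghost_path_vtx_orth[OF q w_vert] by auto
      then have "(W \<otimes> path p v) \<otimes> (ghost_path q v \<otimes> W) = \<zero>"
        using cl w_idempotent(1) by (auto simp: mult_zero_left mult_zero_right mult_closed)
      then show ?thesis using S by (simp add: subspace_def)
    next
      case True
      then have p: "E.awalk w p v" and q: "E.awalk w q v" using p q by auto
      obtain \<delta> where \<delta>: "E.awalk v \<delta> w" by (rule returns[OF p])
      have d: "path \<delta> w \<otimes> ghost_path \<delta> w = vtx v"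
        by (rule path_ghost_path_reachable[OF p \<delta>])
      have "path p v \<otimes> ghost_path q v = (path p v \<otimes> (path \<delta> w \<otimes> ghost_path \<delta> w)) \<otimes> ghost_path q v"
        unfolding d using path_vtx[OF p] by simp
      also have "\<dots> = path (p @ \<delta>) w \<otimes> ghost_path (q @ \<delta>) w"
        using cl path_closed[OF \<delta>] ghost_path_closed[OF \<delta>]
        by (simp add: path_append[OF p \<delta>] ghost_path_append[OF q \<delta>] mult_assoc mult_closed)
      finally have pq: "path p v \<otimes> ghost_path q v = path (p @ \<delta>) w \<otimes> ghost_path (q @ \<delta>) w" .
      have "E.awalk w (p @ \<delta>) w" "E.awalk w (q @ \<delta>) w"
        using \<delta> by (simp_all add: awalk_append_eq[OF p] awalk_append_eq[OF q])
      then obtain m n where "p @ \<delta> = concat (replicate m cycle)" "q @ \<delta> = concat (replicate n cycle)"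
        using closed_walk_power by metis
      then have "path p v \<otimes> ghost_path q v \<in> S"
        using powers[of m n] pq by (simp add: path_power ghost_path_power)
      then show ?thesis using vtx_path[OF p] ghost_path_vtx[OF q] by simp
    qed
    then show "path p v \<otimes> ghost_path q v \<in> {x \<in> carrier A. W \<otimes> x \<otimes> W \<in> S}"
      using eq cl by (simp add: mult_closed)
  qed
  then show ?thesis by (auto simp: corner_def)
qed

lemma power_commute:
  assumes y: "y \<in> corner W" and z: "z \<in> corner W" "z \<otimes> y = y \<otimes> z"
  shows "z [^]\<^bsub>C\<^esub> (n :: nat) \<otimes> y = y \<otimes> z [^]\<^bsub>C\<^esub> n"
proof -
  interpret C: ring C by (rule ring_corner_w)
  show ?thesis
  proof (induction n)
    case 0
    then show ?case using y by (simp add: corner_def)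
  next
    case (Suc n)
    have zn: "z [^]\<^bsub>C\<^esub> n \<in> carrier C" using z(1) by (intro C.nat_pow_closed) simp
    have "z [^]\<^bsub>C\<^esub> n \<otimes> z \<otimes> y = z [^]\<^bsub>C\<^esub> n \<otimes> y \<otimes> z"
      using C.m_assoc[of "z [^]\<^bsub>C\<^esub> n" z y] C.m_assoc[of "z [^]\<^bsub>C\<^esub> n" y z] zn y z by simp
    also have "\<dots> = y \<otimes> (z [^]\<^bsub>C\<^esub> n \<otimes> z)"
      using C.m_assoc[of y "z [^]\<^bsub>C\<^esub> n" z] zn y z Suc by simp
    finally show ?case by simp
  qed
qed

text \<open>By the spanning result, an element commuting with \<open>a\<close> and \<open>b\<close>
  commutes with the whole corner. This applies to \<open>a\<close> and to \<open>b\<close>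
  themselves, as they are mutually inverse; hence every element of the corner satisfies the
  premise.\<close>

lemma corner_commute:
  assumes "x \<in> corner W" "y \<in> corner W"
  shows "x \<otimes> y = y \<otimes> x"
proof -
  interpret C: ring C by (rule ring_corner_w)
  have main: "corner W \<subseteq> {x \<in> carrier A. x \<otimes> y = y \<otimes> x}"
    if y: "y \<in> corner W" "a \<otimes> y = y \<otimes> a" "b \<otimes> y = y \<otimes> b" for y
  proof (rule corner_spanned[OF subspace_centralizer[OF corner_closed[OF y(1)]]])
    fix m n :: nat
    have am: "a [^]\<^bsub>C\<^esub> m \<in> carrier C" and bn: "b [^]\<^bsub>C\<^esub> n \<in> carrier C"
      using cycle_inverse C.nat_pow_closed[of a m] C.nat_pow_closed[of b n] by simp_all
    have "a [^]\<^bsub>C\<^esub> m \<otimes> b [^]\<^bsub>C\<^esub> n \<otimes> y = a [^]\<^bsub>C\<^esub> m \<otimes> y \<otimes> b [^]\<^bsub>C\<^esub> n"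
      using C.m_assoc[of "a [^]\<^bsub>C\<^esub> m" "b [^]\<^bsub>C\<^esub> n" y] C.m_assoc[of "a [^]\<^bsub>C\<^esub> m" y "b [^]\<^bsub>C\<^esub> n"]
        am bn y power_commute[OF y(1) cycle_inverse(2) y(3), of n] by simp
    also have "\<dots> = y \<otimes> (a [^]\<^bsub>C\<^esub> m \<otimes> b [^]\<^bsub>C\<^esub> n)"
      using C.m_assoc[of y "a [^]\<^bsub>C\<^esub> m" "b [^]\<^bsub>C\<^esub> n"]
        am bn y power_commute[OF y(1) cycle_inverse(1) y(2), of m] by simp
    finally show "a [^]\<^bsub>C\<^esub> m \<otimes> b [^]\<^bsub>C\<^esub> n \<in> {x \<in> carrier A. x \<otimes> y = y \<otimes> x}"
      using am bn by (simp add: mult_closed corner_def)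
  qed
  have "a \<otimes> y = y \<otimes> a"
    using main[of a] cycle_inverse assms(2) by auto
  moreover have "b \<otimes> y = y \<otimes> b"
    using main[of b] cycle_inverse assms(2) by auto
  ultimately show ?thesis using main[OF assms(2)] assms(1) by auto
qed

text \<open>This copy of \<open>K\<close> inside the corner is the base over which \<open>a\<close>
  will be algebraic.\<close>

lemma scalars_subfield: "subfield ((\<lambda>k. k \<odot> W) ` carrier K) C"
proof -
  interpret C: ring C by (rule ring_corner_w)
  let ?F = "(\<lambda>k. k \<odot> W) ` carrier K"
  have inC: "k \<odot> W \<in> corner W" if "k \<in> carrier K" for k
    using that w_idempotent by (simp add: corner_def smult_closed smult_mult_left smult_mult_right)
  have mult: "(k \<odot> W) \<otimes> (l \<odot> W) = (k \<otimes>\<^bsub>K\<^esub> l) \<odot> W" if "k \<in> carrier K" "l \<in> carrier K" for k l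
    using that w_idempotent by (simp add: smult_closed smult_mult_left smult_mult_right smult_assoc[symmetric] K.m_comm)
  have "subring ?F C"
  proof (rule C.subringI)
    show "?F \<subseteq> carrier C" using inC by auto
    show "\<one>\<^bsub>C\<^esub> \<in> ?F"
      using w_idempotent(1) smult_one by (auto intro!: image_eqI[of _ _ "\<one>\<^bsub>K\<^esub>"])
  next
    fix h assume "h \<in> ?F"
    then obtain k where k: "k \<in> carrier K" "h = k \<odot> W" by auto
    have "((\<ominus>\<^bsub>K\<^esub> k) \<odot> W) \<oplus>\<^bsub>C\<^esub> h = \<zero>\<^bsub>C\<^esub>"
      using k w_idempotent(1) by (simp add: smult_l_distr[symmetric] K.l_neg smult_zero_left)
    then have "\<ominus>\<^bsub>C\<^esub> h = (\<ominus>\<^bsub>K\<^esub> k) \<odot> W"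
      using C.minus_equality[of "(\<ominus>\<^bsub>K\<^esub> k) \<odot> W" h] inC k by simp
    then show "\<ominus>\<^bsub>C\<^esub> h \<in> ?F" using k by auto
  next
    fix h h' assume "h \<in> ?F" "h' \<in> ?F"
    then obtain k l where k: "k \<in> carrier K" "h = k \<odot> W" "l \<in> carrier K" "h' = l \<odot> W" by auto
    then show "h \<otimes>\<^bsub>C\<^esub> h' \<in> ?F" using mult by auto
    have "h \<oplus>\<^bsub>C\<^esub> h' = (k \<oplus>\<^bsub>K\<^esub> l) \<odot> W" using k w_idempotent(1) by (simp add: smult_l_distr)
    then show "h \<oplus>\<^bsub>C\<^esub> h' \<in> ?F" using k by auto
  qed
  then have sub: "subcring ?F C"
    by (rule C.subcringI) (use mult K.m_comm in auto)
  show ?thesis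
  proof (rule C.subfieldI[OF sub], intro equalityI subsetI)
    fix x assume "x \<in> Units (C\<lparr>carrier := ?F\<rparr>)"
    then obtain y where "x \<in> ?F" "y \<in> ?F" "y \<otimes> x = W" by (auto simp: Units_def)
    moreover from this have "x \<noteq> \<zero>"
      using w_idempotent inC by (auto simp: mult_zero_right corner_def)
    ultimately show "x \<in> ?F - {\<zero>\<^bsub>C\<^esub>}" by simp
  next
    fix x assume "x \<in> ?F - {\<zero>\<^bsub>C\<^esub>}"
    then obtain k where k: "k \<in> carrier K" "x = k \<odot> W" "x \<noteq> \<zero>" by auto
    then have "k \<noteq> \<zero>\<^bsub>K\<^esub>" using w_idempotent by (auto simp: smult_zero_left)
    then have U: "k \<in> Units K" using k by (simp add: K.field_Units)
    then have "(inv\<^bsub>K\<^esub> k \<odot> W) \<otimes> x = W" "x \<otimes> (inv\<^bsub>K\<^esub> k \<odot> W) = W" "inv\<^bsub>K\<^esub> k \<odot> W \<in> ?F"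
      using k w_idempotent smult_one by (auto simp: mult)
    then show "x \<in> Units (C\<lparr>carrier := ?F\<rparr>)"
      using k by (auto simp: Units_def)
  qed
qed

text \<open>The corner is commutative, so \<open>x y = 0\<close> gives
  \<open>x t y = x (W t W) y = (W t W) x y = 0\<close> for all \<open>t\<close>, and primeness makes
  it a domain. The relation at \<open>w\<close> is an equation for \<open>a\<close> over the scalars
  with nonzero constant term, so adjoining \<open>a\<close> yields a field. It contains
  \<open>b\<close>, the inverse of \<open>a\<close>, and therefore the whole corner.\<close>

lemma corner_division:
  assumes prime: "elementwise_prime" and x: "x \<in> corner W" "x \<noteq> \<zero>"
  shows "\<exists>y\<in>corner W. y \<otimes> x = W"
proof -
  let ?F = "(\<lambda>k. k \<odot> W) ` carrier K"
  interpret C: domain C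
  proof (intro domain.intro domain_axioms.intro cring.intro ring_corner_w comm_monoid.intro
      comm_monoid_axioms.intro ring.axioms(2)[OF ring_corner_w])
    fix x y assume xy: "x \<in> carrier C" "y \<in> carrier C"
    then show "x \<otimes>\<^bsub>C\<^esub> y = y \<otimes>\<^bsub>C\<^esub> x" using corner_commute by simp
    assume 0: "x \<otimes>\<^bsub>C\<^esub> y = \<zero>\<^bsub>C\<^esub>"
    show "x = \<zero>\<^bsub>C\<^esub> \<or> y = \<zero>\<^bsub>C\<^esub>"
    proof (rule ccontr)
      assume "\<not> ?thesis"
      then obtain t where t: "t \<in> carrier A" "x \<otimes> t \<otimes> y \<noteq> \<zero>"
        using elementwise_primeE[OF prime, of x y] xy by (auto simp: corner_def)
      have c: "x \<in> carrier A" "y \<in> carrier A" "x \<otimes> W = x" "W \<otimes> y = y"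
        using xy by (auto simp: corner_def)
      have wtw: "W \<otimes> t \<otimes> W \<in> corner W"
        using t w_idempotent mult_assoc[of W W "t \<otimes> W"] by (simp add: corner_def mult_closed mult_assoc)
      have "x \<otimes> t \<otimes> y = (x \<otimes> W) \<otimes> t \<otimes> (W \<otimes> y)" using c by simp
      also have "\<dots> = (x \<otimes> (W \<otimes> t \<otimes> W)) \<otimes> y"
        using c(1,2) t w_idempotent(1) by (simp add: mult_assoc mult_closed del: c(3,4))
      also have "\<dots> = ((W \<otimes> t \<otimes> W) \<otimes> x) \<otimes> y" using corner_commute[OF _ wtw, of x] xy by simp
      also have "\<dots> = (W \<otimes> t \<otimes> W) \<otimes> (x \<otimes> y)"
        using c wtw by (simp add: mult_assoc mult_closed corner_def)
      also have "\<dots> = \<zero>" using 0 wtw by (simp add: mult_zero_right corner_def)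
      finally show False using t by simp
    qed
  next
    show "\<one>\<^bsub>C\<^esub> \<noteq> \<zero>\<^bsub>C\<^esub>" using w_idempotent by simp
  qed
  obtain k D l where rel: "k \<in> carrier K" "k \<noteq> \<zero>\<^bsub>K\<^esub>" "finite D" "[] \<notin> D"
    "\<forall>\<tau>\<in>D. E.awalk w \<tau> w" "l \<in> UNIV \<rightarrow> carrier K"
    "k \<odot> vtx w \<oplus> (\<Oplus>\<tau>\<in>D. l \<tau> \<odot> path \<tau> w) = \<zero>"
    by (rule relationE)
  obtain n where n: "\<And>\<tau>. \<tau> \<in> D \<Longrightarrow> \<tau> = concat (replicate (n \<tau>) cycle)"
    using closed_walk_power rel(5) by metis
  have a: "a \<in> carrier C" "a \<noteq> \<zero>" using cycle_inverse w_idempotent by (auto simp: mult_zero_left corner_def)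
  have pw: "a [^]\<^bsub>C\<^esub> (m :: nat) \<in> corner W" "b [^]\<^bsub>C\<^esub> m \<in> corner W" for m
    using C.nat_pow_closed[of a m] C.nat_pow_closed[of b m] cycle_inverse by auto
  have lW: "l \<tau> \<odot> W \<in> carrier A" "l \<tau> \<in> carrier K" for \<tau>
    using rel(6) w_idempotent by (auto intro!: smult_closed)
  have summand: "l \<tau> \<odot> path \<tau> w = (l \<tau> \<odot> W) \<otimes> a [^]\<^bsub>C\<^esub> n \<tau>" if "\<tau> \<in> D" for \<tau>
  proof -
    have "path \<tau> w = a [^]\<^bsub>C\<^esub> n \<tau>" using n[OF that] path_power by metis
    then show ?thesis
      using pw(1)[of "n \<tau>"] lW w_idempotent by (simp add: smult_mult_left corner_def)
  qed
  have FC: "?F \<subseteq> carrier C" by (rule subfieldE(3)[OF scalars_subfield])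
  have sumC: "(l \<tau> \<odot> W) \<otimes> a [^]\<^bsub>C\<^esub> n \<tau> \<in> corner W" for \<tau>
    using C.m_closed[of "l \<tau> \<odot> W" "a [^]\<^bsub>C\<^esub> n \<tau>"] FC lW pw by auto
  have "subfield (C.simple_extension ?F a) C"
  proof (rule C.simple_extension_subfieldI[OF scalars_subfield a(1), of "k \<odot> W" D "\<lambda>\<tau>. l \<tau> \<odot> W" n])
    show "k \<odot> W \<in> ?F" using rel(1) by simp
    show "k \<odot> W \<noteq> \<zero>\<^bsub>C\<^esub>" using smult_eq_zero[OF rel(1,2) w_idempotent(1)] w_idempotent(3) by auto
    show "(\<lambda>\<tau>. l \<tau> \<odot> W) \<in> D \<rightarrow> ?F" using lW by auto
    \<comment> \<open>Only the empty word is the zeroth power of the cycle, and \<open>D\<close>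
      does not contain it; so the constant term of the equation is \<open>k\<close> alone.\<close>
    show "0 < n \<tau>" if "\<tau> \<in> D" for \<tau>
    proof (rule ccontr)
      assume "\<not> 0 < n \<tau>"
      then have "\<tau> = []" using n[OF that] by (metis concat.simps(1) neq0_conv replicate_0)
      then show False using that rel(4) by simp
    qed
    have "(\<Oplus>\<^bsub>C\<^esub>\<tau>\<in>D. (l \<tau> \<odot> W) \<otimes>\<^bsub>C\<^esub> a [^]\<^bsub>C\<^esub> n \<tau>) = (\<Oplus>\<tau>\<in>D. (l \<tau> \<odot> W) \<otimes> a [^]\<^bsub>C\<^esub> n \<tau>)"
      using finsum_corner_ring[OF w_idempotent(1,2), of "\<lambda>\<tau>. (l \<tau> \<odot> W) \<otimes> a [^]\<^bsub>C\<^esub> n \<tau>" D] sumC by simp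
    also have "\<dots> = (\<Oplus>\<tau>\<in>D. l \<tau> \<odot> path \<tau> w)"
      by (rule finsum_cong'[OF refl]) (use summand sumC in \<open>auto simp: corner_def\<close>)
    finally show "k \<odot> W \<oplus>\<^bsub>C\<^esub> (\<Oplus>\<^bsub>C\<^esub>\<tau>\<in>D. (l \<tau> \<odot> W) \<otimes>\<^bsub>C\<^esub> a [^]\<^bsub>C\<^esub> n \<tau>) = \<zero>\<^bsub>C\<^esub>"
      using rel(7) by simp
  qed (rule rel(3))
  then interpret M: subfield "C.simple_extension ?F a" C .
  let ?M = "C.simple_extension ?F a"
  note sf = \<open>subfield ?M C\<close>
  note MC = subfieldE(3)[OF sf] and sr = subfieldE(1)[OF sf]
  have aM: "a \<in> ?M"
    by (rule C.simple_extension_mem[OF subfieldE(1)[OF scalars_subfield] a(1)])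
  have inv: "inv\<^bsub>C\<^esub> y \<in> ?M" "inv\<^bsub>C\<^esub> y \<otimes> y = W" "y \<otimes> inv\<^bsub>C\<^esub> y = W" if "y \<in> ?M" "y \<noteq> \<zero>" for y
    using C.subfield_m_inv[OF sf, of y] that by auto
  have "b = inv\<^bsub>C\<^esub> a"
    using inv[OF aM a(2)] C.m_assoc[of b a "inv\<^bsub>C\<^esub> a"] cycle_inverse MC by (auto simp: corner_def)
  then have bM: "b \<in> ?M" using inv(1)[OF aM a(2)] by simp
  have powM: "z [^]\<^bsub>C\<^esub> (m :: nat) \<in> ?M" if "z \<in> ?M" for z m
    by (induction m) (use that subringE(3,6)[OF sr] in auto)
  have "corner W \<subseteq> ?M"
  proof (rule corner_spanned)
    show "subspace ?M"
      unfolding subspace_def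
    proof (intro conjI ballI)
      show "?M \<subseteq> carrier A" using MC by (auto simp: corner_def)
      show "\<zero> \<in> ?M" using subringE(2)[OF sr] by simp
    next
      fix x y assume "x \<in> ?M" "y \<in> ?M"
      then show "x \<oplus> y \<in> ?M" using subringE(7)[OF sr] by simp
    next
      fix c y assume c: "c \<in> carrier K" and y: "y \<in> ?M"
      then have "c \<odot> W \<in> ?M"
        using C.simple_extension_incl[OF FC a(1)] by auto
      moreover have "(c \<odot> W) \<otimes> y = c \<odot> y"
        using c y MC w_idempotent by (auto simp: smult_mult_left corner_def)
      ultimately show "c \<odot> y \<in> ?M" using subringE(6)[OF sr, of "c \<odot> W" y] y by simp
    qed
    show "a [^]\<^bsub>C\<^esub> m \<otimes> b [^]\<^bsub>C\<^esub> n \<in> ?M" for m :: nat and n :: nat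
      using subringE(6)[OF sr powM[OF aM] powM[OF bM]] by simp
  qed
  then have "x \<in> ?M" using x by blast
  then show ?thesis using inv[OF _ x(2)] MC by (intro bexI[of _ "inv\<^bsub>C\<^esub> x"]) auto
qed

end

section \<open>The socle\<close>

lemma (in rng) sum_of_subgroups_subgroup:
  assumes "\<And>S. S \<in> \<S> \<Longrightarrow> S \<subseteq> carrier R"
  shows "additive_subgroup (sum_of_subgroups R \<S>) R"
    and "S \<in> \<S> \<Longrightarrow> S \<subseteq> sum_of_subgroups R \<S>"
    and "additive_subgroup H R \<Longrightarrow> (\<And>S. S \<in> \<S> \<Longrightarrow> S \<subseteq> H) \<Longrightarrow> sum_of_subgroups R \<S> \<subseteq> H"
proof -
  have U: "\<Union>\<S> \<subseteq> carrier R" using assms by blast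
  show "additive_subgroup (sum_of_subgroups R \<S>) R"
    unfolding sum_of_subgroups_def
    by (rule additive_subgroup.intro) (rule add.generate_is_subgroup, use U in simp)
  show "S \<in> \<S> \<Longrightarrow> S \<subseteq> sum_of_subgroups R \<S>"
    unfolding sum_of_subgroups_def by (auto intro: generate.incl)
  assume H: "additive_subgroup H R" "\<And>S. S \<in> \<S> \<Longrightarrow> S \<subseteq> H"
  then show "sum_of_subgroups R \<S> \<subseteq> H"
    unfolding sum_of_subgroups_def
    by (intro add.generate_subgroup_incl) (auto simp: additive_subgroup_def)
qed

text \<open>An element of a generated subgroup arises in finitely many steps, each using a single
  member of the chain, and for a sum the larger of two members serves. \<open>S\<close> is removed
  throughout because independence is a condition on the family without \<open>S\<close>.\<close>

lemma (in rng) sum_of_subgroups_chain: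
  assumes chain: "\<And>c c'. c \<in> \<C> \<Longrightarrow> c' \<in> \<C> \<Longrightarrow> c \<subseteq> c' \<or> c' \<subseteq> c" and ne: "\<C> \<noteq> {}"
    and x: "x \<in> sum_of_subgroups R (\<Union>\<C> - {S})"
  shows "\<exists>c\<in>\<C>. x \<in> sum_of_subgroups R (c - {S})"
  using x unfolding sum_of_subgroups_def
proof (induction rule: generate.induct)
  case one
  then show ?case using ne generate.one by fastforce
next
  case (incl h)
  then show ?case by (blast intro: generate.incl)
next
  case (inv h)
  then show ?case by (blast intro: generate.inv)
next
  case (eng h1 h2)
  then obtain c1 c2 where c: "c1 \<in> \<C>" "h1 \<in> generate (add_monoid R) (\<Union>(c1 - {S}))"
    "c2 \<in> \<C>" "h2 \<in> generate (add_monoid R) (\<Union>(c2 - {S}))" by blast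
  define c where "c = (if c1 \<subseteq> c2 then c2 else c1)"
  have "c1 \<subseteq> c" "c2 \<subseteq> c" "c \<in> \<C>" using chain[OF c(1,3)] c by (auto simp: c_def)
  then have u: "\<Union>(c1 - {S}) \<subseteq> \<Union>(c - {S})" "\<Union>(c2 - {S}) \<subseteq> \<Union>(c - {S})" by auto
  have "h1 \<otimes>\<^bsub>add_monoid R\<^esub> h2 \<in> generate (add_monoid R) (\<Union>(c - {S}))"
    by (rule generate.eng[OF subsetD[OF add.mono_generate[OF u(1)] c(2)] subsetD[OF add.mono_generate[OF u(2)] c(4)]])
  then show ?case using \<open>c \<in> \<C>\<close> by (rule bexI)
qed

lemma (in rng) left_ideal_sum:
  assumes "\<And>S. S \<in> \<S> \<Longrightarrow> rng_left_ideal S R"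
  shows "rng_left_ideal (sum_of_subgroups R \<S>) R"
proof -
  have sub: "S \<subseteq> carrier R" if "S \<in> \<S>" for S
    using additive_subgroup.a_subset[OF rng_left_ideal_additive_subgroup[OF assms[OF that]]] .
  let ?M = "sum_of_subgroups R \<S>"
  interpret M: additive_subgroup ?M R by (rule sum_of_subgroups_subgroup(1)[OF sub])
  have "?M \<subseteq> {x \<in> carrier R. \<forall>a\<in>carrier R. a \<otimes> x \<in> ?M}"
  proof (rule sum_of_subgroups_subgroup(3)[OF sub])
    show "additive_subgroup {x \<in> carrier R. \<forall>a\<in>carrier R. a \<otimes> x \<in> ?M} R"
      by (rule additive_subgroupI')
         (auto simp: mult_zero_right distrib_left mult_minus_right)
    fix S assume S: "S \<in> \<S>"
    then show "S \<subseteq> {x \<in> carrier R. \<forall>a\<in>carrier R. a \<otimes> x \<in> ?M}"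
      using sub[OF S] rng_left_ideal.left_closed[OF assms[OF S]] sum_of_subgroups_subgroup(2)[OF sub S]
      by blast
  qed
  then show ?thesis
    by (intro rng_left_ideal.intro M.additive_subgroup_axioms rng_left_ideal_axioms.intro) blast
qed

lemma (in rng) sum_of_subgroups_insert:
  assumes "additive_subgroup S R" "\<And>S'. S' \<in> \<S> \<Longrightarrow> S' \<subseteq> carrier R"
    and x: "x \<in> sum_of_subgroups R (insert S \<S>)"
  obtains s y where "s \<in> S" "y \<in> sum_of_subgroups R \<S>" "x = s \<oplus> y"
proof -
  interpret S: additive_subgroup S R by fact
  interpret M: additive_subgroup "sum_of_subgroups R \<S>" R
    by (rule sum_of_subgroups_subgroup(1)[OF assms(2)])
  let ?H = "{s \<oplus> y |s y. s \<in> S \<and> y \<in> sum_of_subgroups R \<S>}"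
  have Sc: "s \<in> carrier R" if "s \<in> S" for s using S.a_subset that by blast
  have Mc: "s \<in> carrier R" if "s \<in> sum_of_subgroups R \<S>" for s using M.a_subset that by blast
  have "sum_of_subgroups R (insert S \<S>) \<subseteq> ?H"
  proof (rule sum_of_subgroups_subgroup(3))
    show "S' \<subseteq> carrier R" if "S' \<in> insert S \<S>" for S' using that assms(2) S.a_subset by blast
    show "additive_subgroup ?H R"
    proof (rule additive_subgroupI')
      show "?H \<subseteq> carrier R" using Sc Mc by auto
      show "\<zero> \<in> ?H" by (auto intro!: exI[of _ \<zero>])
    next
      fix x y assume "x \<in> ?H" "y \<in> ?H"
      then obtain s t s' t' where "s \<in> S" "s' \<in> S" "t \<in> sum_of_subgroups R \<S>"
        "t' \<in> sum_of_subgroups R \<S>" "x = s \<oplus> t" "y = s' \<oplus> t'" by auto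
      then have "x \<oplus> y = (s \<oplus> s') \<oplus> (t \<oplus> t')" "s \<oplus> s' \<in> S" "t \<oplus> t' \<in> sum_of_subgroups R \<S>"
        using Sc Mc by (auto simp: a_ac)
      then show "x \<oplus> y \<in> ?H" by blast
    next
      fix x assume "x \<in> ?H"
      then obtain s t where "s \<in> S" "t \<in> sum_of_subgroups R \<S>" "x = s \<oplus> t" by auto
      then have "\<ominus> x = (\<ominus> s) \<oplus> (\<ominus> t)" "\<ominus> s \<in> S" "\<ominus> t \<in> sum_of_subgroups R \<S>"
        using Sc Mc by (auto simp: minus_add)
      then show "\<ominus> x \<in> ?H" by blast
    qed
    fix S' assume "S' \<in> insert S \<S>"
    then show "S' \<subseteq> ?H"
    proof
      assume "S' = S"
      moreover have "s = s \<oplus> \<zero>" if "s \<in> S" for s using Sc that by simp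
      ultimately show ?thesis using M.zero_closed by blast
    next
      assume S': "S' \<in> \<S>"
      have "y = \<zero> \<oplus> y" if "y \<in> S'" for y using assms(2)[OF S'] that by auto
      then show ?thesis using sum_of_subgroups_subgroup(2)[OF assms(2) S'] S.zero_closed by blast
    qed
  qed
  then show thesis using x that by blast
qed

lemma simple_left_ideal_left_ideal: "simple_left_ideal S R \<Longrightarrow> rng_left_ideal S R"
  by (simp add: simple_left_ideal_def)

lemma (in rng) left_ideal_subset: "rng_left_ideal S R \<Longrightarrow> S \<subseteq> carrier R"
  by (rule additive_subgroup.a_subset[OF rng_left_ideal_additive_subgroup])

lemma (in rng) left_ideal_Int:
  assumes "rng_left_ideal I R" "rng_left_ideal J R"
  shows "rng_left_ideal (I \<inter> J) R"
proof -
  interpret I: rng_left_ideal I R by fact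
  interpret J: rng_left_ideal J R by fact
  show ?thesis
    by (rule rng_left_idealI) (use I.a_subset I.left_closed J.left_closed in auto)
qed

text \<open>Take a maximal independent family of simple left ideals. A simple left ideal not
  contained in its sum meets the sum in zero, since the intersection is a smaller left ideal, and
  could be added to the family.\<close>

lemma (in rng) socle_direct_sum:
  "\<exists>\<S>. (\<forall>S\<in>\<S>. simple_left_ideal S R) \<and> internal_direct_sum R \<S> (socle R)"
proof -
  define indep where "indep = {\<S>. (\<forall>S\<in>\<S>. simple_left_ideal S R) \<and>
    (\<forall>S\<in>\<S>. S \<inter> sum_of_subgroups R (\<S> - {S}) = {\<zero>})}"
  have sub: "S \<subseteq> carrier R" if "simple_left_ideal S R" for S
    by (rule left_ideal_subset[OF simple_left_ideal_left_ideal[OF that]])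
  have "\<exists>M\<in>indep. \<forall>Y\<in>indep. M \<subseteq> Y \<longrightarrow> Y = M"
  proof (rule subset_Zorn_nonempty)
    show "indep \<noteq> {}" by (auto simp: indep_def intro!: exI[of _ "{}"])
  next
    fix \<C> assume ne: "\<C> \<noteq> {}" and "subset.chain indep \<C>"
    then have ind: "\<C> \<subseteq> indep" and chain: "\<And>c c'. c \<in> \<C> \<Longrightarrow> c' \<in> \<C> \<Longrightarrow> c \<subseteq> c' \<or> c' \<subseteq> c"
      by (auto simp: subset_chain_def)
    have simple: "simple_left_ideal S R" if "S \<in> \<Union>\<C>" for S using that ind by (auto simp: indep_def)
    moreover have "S \<inter> sum_of_subgroups R (\<Union>\<C> - {S}) = {\<zero>}" if S: "S \<in> \<Union>\<C>" for S
    proof -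
      have "x = \<zero>" if x: "x \<in> S" "x \<in> sum_of_subgroups R (\<Union>\<C> - {S})" for x
      proof -
        obtain c where c: "c \<in> \<C>" "x \<in> sum_of_subgroups R (c - {S})"
          using sum_of_subgroups_chain[OF chain ne x(2)] by blast
        obtain c' where c': "c' \<in> \<C>" "S \<in> c'" using S by blast
        define d where "d = (if c \<subseteq> c' then c' else c)"
        have d: "d \<in> \<C>" "S \<in> d" "c \<subseteq> d" using chain[OF c(1) c'(1)] c c' by (auto simp: d_def)
        have "sum_of_subgroups R (c - {S}) \<subseteq> sum_of_subgroups R (d - {S})"
          unfolding sum_of_subgroups_def by (rule add.mono_generate) (use d in auto)
        then have "x \<in> S \<inter> sum_of_subgroups R (d - {S})" using x c by blast
        moreover have "S \<inter> sum_of_subgroups R (d - {S}) = {\<zero>}" using subsetD[OF ind d(1)] d(2) unfolding indep_def by blast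
        ultimately show ?thesis by blast
      qed
      moreover have "\<zero> \<in> S"
        using additive_subgroup.zero_closed rng_left_ideal_additive_subgroup
          simple_left_ideal_left_ideal[OF simple[OF S]] by blast
      moreover have "\<zero> \<in> sum_of_subgroups R (\<Union>\<C> - {S})"
        by (rule additive_subgroup.zero_closed[OF sum_of_subgroups_subgroup(1)]) (use sub simple in blast)
      ultimately show ?thesis by blast
    qed
    ultimately show "\<Union>\<C> \<in> indep" by (simp add: indep_def)
  qed
  then obtain M where M: "M \<in> indep" "\<And>Y. Y \<in> indep \<Longrightarrow> M \<subseteq> Y \<Longrightarrow> Y = M" by blast
  have Ms: "simple_left_ideal S R" if "S \<in> M" for S using M that by (simp add: indep_def)
  have Msub: "S \<subseteq> carrier R" if "S \<in> M" for S using sub Ms that by blast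
  have LM: "rng_left_ideal (sum_of_subgroups R M) R"
    by (rule left_ideal_sum) (rule simple_left_ideal_left_ideal[OF Ms])
  interpret LM: rng_left_ideal "sum_of_subgroups R M" R by (rule LM)
  have "S \<subseteq> sum_of_subgroups R M" if S: "simple_left_ideal S R" for S
  proof (rule ccontr)
    assume no: "\<not> S \<subseteq> sum_of_subgroups R M"
    have LS: "rng_left_ideal S R" by (rule simple_left_ideal_left_ideal[OF S])
    interpret S: rng_left_ideal S R by (rule LS)
    have "S \<inter> sum_of_subgroups R M = {\<zero>} \<or> S \<inter> sum_of_subgroups R M = S"
      using S left_ideal_Int[OF LS LM] by (auto simp: simple_left_ideal_def)
    then have S0: "S \<inter> sum_of_subgroups R M = {\<zero>}" using no by blast
    have SM: "S \<notin> M" using sum_of_subgroups_subgroup(2)[OF Msub] no by blast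
    have "S' \<inter> sum_of_subgroups R (insert S M - {S'}) = {\<zero>}" if S': "S' \<in> insert S M" for S'
    proof (cases "S' = S")
      case True
      then show ?thesis using S0 SM by simp
    next
      case False
      then have S'M: "S' \<in> M" using S' by simp
      have eq: "insert S M - {S'} = insert S (M - {S'})" using False by blast
      have sub': "T \<subseteq> carrier R" if "T \<in> M - {S'}" for T using Msub that by blast
      have le: "sum_of_subgroups R (M - {S'}) \<subseteq> sum_of_subgroups R M"
        unfolding sum_of_subgroups_def by (rule add.mono_generate) auto
      \<comment> \<open>Independence seen from an old summand \<open>S'\<close>. In
        \<open>x = s \<oplus> y\<close> the element \<open>s = x \<ominus> y\<close> lies both in
        \<open>S\<close> and in the sum over \<open>M\<close>, hence is zero; so \<open>x\<close>
        belongs to \<open>S'\<close> and to the sum of the other members of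
        \<open>M\<close>.\<close>
      have "x = \<zero>" if x: "x \<in> S'" "x \<in> sum_of_subgroups R (insert S M - {S'})" for x
      proof -
        obtain s y where sy: "s \<in> S" "y \<in> sum_of_subgroups R (M - {S'})" "x = s \<oplus> y"
          using sum_of_subgroups_insert[OF S.additive_subgroup_axioms sub'] x(2) unfolding eq by metis
        have c: "s \<in> carrier R" "y \<in> carrier R"
          using sy le S.a_subset LM.a_subset by auto
        have "x \<in> sum_of_subgroups R M" "y \<in> sum_of_subgroups R M"
          using x(1) sum_of_subgroups_subgroup(2)[OF Msub S'M] sy le by auto
        then have "x \<ominus> y \<in> sum_of_subgroups R M"
          unfolding minus_eq by (intro LM.a_closed LM.a_inv_closed)
        moreover have "x \<ominus> y = s" using c sy by (simp add: minus_eq a_assoc r_neg)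
        ultimately have "s = \<zero>" using S0 sy by blast
        then have "x \<in> S' \<inter> sum_of_subgroups R (M - {S'})" using x sy c by simp
        moreover have "S' \<inter> sum_of_subgroups R (M - {S'}) = {\<zero>}" using M(1) S'M by (simp add: indep_def)
        ultimately show ?thesis by blast
      qed
      moreover have "\<zero> \<in> S'"
        using additive_subgroup.zero_closed rng_left_ideal_additive_subgroup
          simple_left_ideal_left_ideal[OF Ms[OF S'M]] by blast
      moreover have "\<zero> \<in> sum_of_subgroups R (insert S M - {S'})"
        by (rule additive_subgroup.zero_closed[OF sum_of_subgroups_subgroup(1)])
           (use sub S Ms in blast)
      ultimately show ?thesis by blast
    qed
    then have "insert S M \<in> indep" using S Ms by (simp add: indep_def)
    then have "insert S M = M" by (rule M(2)) blast
    then show False using SM by blast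
  qed
  moreover have socsub: "S \<subseteq> carrier R" if "S \<in> {S. simple_left_ideal S R}" for S
    using sub that by blast
  ultimately have "socle R \<subseteq> sum_of_subgroups R M"
    unfolding socle_def by (intro sum_of_subgroups_subgroup(3)[OF socsub] LM.additive_subgroup_axioms) auto
  moreover have "sum_of_subgroups R M \<subseteq> socle R"
    unfolding socle_def sum_of_subgroups_def by (rule add.mono_generate) (use Ms in blast)
  ultimately have "internal_direct_sum R M (socle R)"
    using M(1) by (auto simp: internal_direct_sum_def indep_def)
  then show ?thesis using Ms by blast
qed

text \<open>The data extracted from a relation vertex: an idempotent whose corner is a division
  ring, inside an elementwise prime ring. Left inverses are assumed; \<open>division_right\<close>
  supplies the right ones.\<close>

locale division_corner = rng R for R (structure) +
  fixes w
  assumes w: "w \<in> carrier R" "w \<otimes> w = w" "w \<noteq> \<zero>"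
    and prime: "elementwise_prime"
    and division: "\<lbrakk>x \<in> corner w; x \<noteq> \<zero>\<rbrakk> \<Longrightarrow> \<exists>y\<in>corner w. y \<otimes> x = w"
begin

lemma corner_mem: "t \<in> carrier R \<Longrightarrow> w \<otimes> t \<otimes> w \<in> corner w"
  using w mult_assoc[of w w "t \<otimes> w"] by (simp add: corner_def mult_closed mult_assoc)

text \<open>The left inverse \<open>y\<close> of \<open>x\<close> is nonzero, so it has a left
  inverse \<open>z\<close> in turn, and \<open>z = z (y x) = x\<close>.\<close>

lemma division_right:
  assumes x: "x \<in> corner w" "x \<noteq> \<zero>"
  obtains y where "y \<in> corner w" "x \<otimes> y = w"
proof -
  obtain y where y: "y \<in> corner w" "y \<otimes> x = w" using division[OF x] by blast
  have c: "x \<in> carrier R" "y \<in> carrier R" "w \<otimes> x = x" "y \<otimes> w = y"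
    using x y by (auto simp: corner_def)
  have "y \<noteq> \<zero>" using y c w mult_zero_left[of x] by auto
  then obtain z where z: "z \<in> corner w" "z \<otimes> y = w" using division[OF y(1)] by blast
  have zc: "z \<in> carrier R" "z \<otimes> w = z" using z by (auto simp: corner_def)
  have "z = z \<otimes> (y \<otimes> x)" using y(2) zc by simp
  also have "\<dots> = x" using mult_assoc[of z y x] c zc z(2) by simp
  finally have "x \<otimes> y = w" using z(2) by simp
  then show thesis using that y(1) by blast
qed

text \<open>The left ideal \<open>R w t\<close>, the image of \<open>R w\<close> under right
  multiplication by \<open>t\<close>. Every simple left ideal turns out to have this form.\<close>

definition orbit :: "'a \<Rightarrow> 'a set" where
  "orbit t = {a \<otimes> w \<otimes> t |a. a \<in> carrier R}"

lemma orbitI: "a \<in> carrier R \<Longrightarrow> a \<otimes> w \<otimes> t \<in> orbit t"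
  by (auto simp: orbit_def)

lemma orbit_left_ideal:
  assumes t: "t \<in> carrier R"
  shows "rng_left_ideal (orbit t) R"
proof (rule rng_left_idealI)
  show "orbit t \<subseteq> carrier R" using t w by (auto simp: orbit_def mult_closed)
  have "\<zero> = \<zero> \<otimes> w \<otimes> t" using t w by (simp add: mult_zero_left)
  then show "\<zero> \<in> orbit t" using orbitI[of \<zero> t] by simp
next
  fix x y assume "x \<in> orbit t" "y \<in> orbit t"
  then obtain a b where ab: "a \<in> carrier R" "b \<in> carrier R" "x = a \<otimes> w \<otimes> t" "y = b \<otimes> w \<otimes> t"
    by (auto simp: orbit_def)
  then have "x \<oplus> y = (a \<oplus> b) \<otimes> w \<otimes> t" using w t by (simp add: distrib_right mult_closed)
  then show "x \<oplus> y \<in> orbit t" using orbitI[of "a \<oplus> b" t] ab by simp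
next
  fix x assume "x \<in> orbit t"
  then obtain a where ab: "a \<in> carrier R" "x = a \<otimes> w \<otimes> t" by (auto simp: orbit_def)
  then have "\<ominus> x = (\<ominus> a) \<otimes> w \<otimes> t" using w t by (simp add: mult_minus_left mult_closed)
  then show "\<ominus> x \<in> orbit t" using orbitI[of "\<ominus> a" t] ab by simp
next
  fix x b assume "x \<in> orbit t" and b: "b \<in> carrier R"
  then obtain a where ab: "a \<in> carrier R" "x = a \<otimes> w \<otimes> t" by (auto simp: orbit_def)
  then have "b \<otimes> x = (b \<otimes> a) \<otimes> w \<otimes> t" using w t b by (simp add: mult_assoc mult_closed)
  then show "b \<otimes> x \<in> orbit t" using orbitI[of "b \<otimes> a" t] ab b by (simp add: mult_closed)
qed

lemma orbit_mem: "t \<in> carrier R \<Longrightarrow> w \<otimes> t \<in> orbit t"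
  using orbitI[OF w(1), of t] w by simp

lemma orbit_subset:
  assumes "rng_left_ideal J R" "t \<in> carrier R" "w \<otimes> t \<in> J"
  shows "orbit t \<subseteq> J"
proof
  interpret J: rng_left_ideal J R by fact
  fix x assume "x \<in> orbit t"
  then obtain a where "a \<in> carrier R" "x = a \<otimes> w \<otimes> t" by (auto simp: orbit_def)
  then show "x \<in> J" using J.left_closed[OF assms(3), of a] assms w by (simp add: mult_assoc)
qed

text \<open>For a nonzero \<open>x = a w t\<close>, primeness gives \<open>s\<close> with
  \<open>w s x\<close> nonzero. Now \<open>w s x = d t\<close> with \<open>d = w s a w\<close> in
  the corner, and dividing by \<open>d\<close> brings \<open>w t\<close> back into the left ideal
  generated by \<open>x\<close>.\<close>

lemma orbit_simple:
  assumes t: "t \<in> carrier R" "w \<otimes> t \<noteq> \<zero>"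
  shows "simple_left_ideal (orbit t) R"
  unfolding simple_left_ideal_def
proof (intro conjI allI impI)
  show "rng_left_ideal (orbit t) R" by (rule orbit_left_ideal[OF t(1)])
  show "orbit t \<noteq> {\<zero>}" using orbit_mem[OF t(1)] t(2) by auto
  fix J assume J: "rng_left_ideal J R" "J \<subseteq> orbit t"
  interpret J: rng_left_ideal J R by (rule J(1))
  show "J = {\<zero>} \<or> J = orbit t"
  proof (cases "J \<subseteq> {\<zero>}")
    case True
    then show ?thesis using J.zero_closed by blast
  next
    case False
    then obtain x where x: "x \<in> J" "x \<noteq> \<zero>" by blast
    then obtain a where a: "a \<in> carrier R" "x = a \<otimes> w \<otimes> t" using J(2) by (auto simp: orbit_def)
    have xc: "x \<in> carrier R" using x J.a_subset by blast
    obtain s where s: "s \<in> carrier R" "w \<otimes> s \<otimes> x \<noteq> \<zero>"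
      using elementwise_primeE[OF prime w(1) xc w(3) x(2)] by blast
    let ?d = "w \<otimes> (s \<otimes> a) \<otimes> w"
    have d: "?d \<in> corner w" using corner_mem s a by (simp add: mult_closed)
    have eq: "w \<otimes> s \<otimes> x = ?d \<otimes> t"
      using a s t w by (simp add: mult_assoc mult_closed)
    then have "?d \<noteq> \<zero>" using s(2) t mult_zero_left by auto
    then obtain e where e: "e \<in> corner w" "e \<otimes> ?d = w" using division[OF d] by blast
    have ec: "e \<in> carrier R" using e by (simp add: corner_def)
    have "w \<otimes> t = (e \<otimes> ?d) \<otimes> t" using e by simp
    also have "\<dots> = e \<otimes> (w \<otimes> s \<otimes> x)" unfolding eq using ec d t by (simp add: mult_assoc corner_def)
    also have "\<dots> = (e \<otimes> w \<otimes> s) \<otimes> x" using ec s w xc by (simp add: mult_assoc mult_closed)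
    finally have "w \<otimes> t \<in> J" using J.left_closed[OF x(1), of "e \<otimes> w \<otimes> s"] ec s w by (simp add: mult_closed)
    then have "orbit t \<subseteq> J" by (rule orbit_subset[OF J(1) t(1)])
    then show ?thesis using J(2) by blast
  qed
qed

text \<open>For a nonzero \<open>x\<close> in \<open>S\<close>, primeness gives \<open>s\<close>
  with \<open>w s x\<close> nonzero; then \<open>orbit (s \<otimes> x)\<close> is a nonzero left
  ideal inside \<open>S\<close>.\<close>

lemma simple_left_ideal_orbit:
  assumes "simple_left_ideal S R"
  obtains t where "t \<in> carrier R" "w \<otimes> t \<noteq> \<zero>" "S = orbit t"
proof -
  have LS: "rng_left_ideal S R" and ne: "S \<noteq> {\<zero>}"
    and min: "\<And>J. rng_left_ideal J R \<Longrightarrow> J \<subseteq> S \<Longrightarrow> J = {\<zero>} \<or> J = S"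
    using assms by (auto simp: simple_left_ideal_def)
  interpret S: rng_left_ideal S R by (rule LS)
  obtain x where x: "x \<in> S" "x \<noteq> \<zero>" using ne S.zero_closed by blast
  have xc: "x \<in> carrier R" using x S.a_subset by blast
  obtain s where s: "s \<in> carrier R" "w \<otimes> s \<otimes> x \<noteq> \<zero>"
    using elementwise_primeE[OF prime w(1) xc w(3) x(2)] by blast
  let ?t = "s \<otimes> x"
  have t: "?t \<in> carrier R" "w \<otimes> ?t \<noteq> \<zero>" using s xc w by (auto simp: mult_closed mult_assoc)
  have "w \<otimes> ?t \<in> S" using S.left_closed[OF S.left_closed[OF x(1) s(1)] w(1)] .
  then have "orbit ?t \<subseteq> S" by (rule orbit_subset[OF LS t(1)])
  then have "orbit ?t = S"
    using min[OF orbit_left_ideal[OF t(1)]] orbit_mem[OF t(1)] t(2) by blast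
  then show thesis using that t by blast
qed

text \<open>Primeness provides a nonzero element \<open>w t r w\<close> of the corner, and dividing
  by it on the right gives \<open>s\<close>. Right multiplication by \<open>s\<close> then undoes
  right multiplication by \<open>t\<close> on \<open>R w\<close>.\<close>

lemma orbit_map:
  assumes t: "t \<in> carrier R" "w \<otimes> t \<noteq> \<zero>"
  obtains s where "s \<in> carrier R" "w \<otimes> t \<otimes> s = w"
proof -
  have wt: "w \<otimes> t \<in> carrier R" using w t by (simp add: mult_closed)
  obtain r where r: "r \<in> carrier R" "(w \<otimes> t) \<otimes> r \<otimes> w \<noteq> \<zero>"
    using elementwise_primeE[OF prime wt w(1) t(2) w(3)] by blast
  have "(w \<otimes> t) \<otimes> r \<otimes> w = w \<otimes> (t \<otimes> r) \<otimes> w" using w t r by (simp add: mult_assoc mult_closed)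
  then have "(w \<otimes> t) \<otimes> r \<otimes> w \<in> corner w" using corner_mem[of "t \<otimes> r"] t r by (simp add: mult_closed)
  then obtain e where e: "e \<in> corner w" "((w \<otimes> t) \<otimes> r \<otimes> w) \<otimes> e = w"
    using division_right r(2) by blast
  then have "w \<otimes> t \<otimes> (r \<otimes> w \<otimes> e) = w"
    using w t r by (simp add: mult_assoc mult_closed corner_def)
  moreover have "r \<otimes> w \<otimes> e \<in> carrier R" using e r w by (simp add: mult_closed corner_def)
  ultimately show thesis using that by blast
qed

text \<open>Right multiplication by \<open>s w t'\<close> is left linear and sends
  \<open>a w t\<close> to \<open>a w t'\<close>, because \<open>w t s = w\<close>; exchanging the
  roles of \<open>t\<close> and \<open>t'\<close> gives the inverse.\<close>

lemma orbits_isomorphic: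
  assumes t: "t \<in> carrier R" "w \<otimes> t \<noteq> \<zero>" and t': "t' \<in> carrier R" "w \<otimes> t' \<noteq> \<zero>"
  shows "isomorphic_left_ideals R (orbit t) (orbit t')"
proof -
  obtain s where s: "s \<in> carrier R" "w \<otimes> t \<otimes> s = w" by (rule orbit_map[OF t])
  obtain s' where s': "s' \<in> carrier R" "w \<otimes> t' \<otimes> s' = w" by (rule orbit_map[OF t'])
  define \<phi> where "\<phi> x = x \<otimes> (s \<otimes> w \<otimes> t')" for x
  define \<psi> where "\<psi> x = x \<otimes> (s' \<otimes> w \<otimes> t)" for x
  have gen: "(a \<otimes> w \<otimes> u) \<otimes> (r \<otimes> w \<otimes> u') = a \<otimes> w \<otimes> u'"
    if "a \<in> carrier R" "u \<in> carrier R" "u' \<in> carrier R" "r \<in> carrier R" "w \<otimes> u \<otimes> r = w" for a u u' r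
  proof -
    have "(a \<otimes> w \<otimes> u) \<otimes> (r \<otimes> w \<otimes> u') = a \<otimes> ((w \<otimes> u \<otimes> r) \<otimes> w) \<otimes> u'"
      using that(1-4) w by (simp add: mult_assoc mult_closed)
    then show ?thesis using that(5) w by simp
  qed
  have \<phi>: "\<phi> (a \<otimes> w \<otimes> t) = a \<otimes> w \<otimes> t'" and \<psi>: "\<psi> (a \<otimes> w \<otimes> t') = a \<otimes> w \<otimes> t"
    if "a \<in> carrier R" for a
    using gen[OF that t(1) t'(1) s] gen[OF that t'(1) t(1) s'] by (auto simp: \<phi>_def \<psi>_def)
  have sub: "orbit t \<subseteq> carrier R" by (rule left_ideal_subset[OF orbit_left_ideal[OF t(1)]])
  have m: "s \<otimes> w \<otimes> t' \<in> carrier R" using s w t' by (simp add: mult_closed)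
  have "bij_betw \<phi> (orbit t) (orbit t')"
    by (rule bij_betw_byWitness[of _ \<psi>]) (auto simp: orbit_def \<phi> \<psi>)
  moreover have "\<phi> x \<in> orbit t'" if "x \<in> orbit t" for x
    using that \<phi> by (auto simp: orbit_def)
  moreover have "\<phi> (x \<oplus> y) = \<phi> x \<oplus> \<phi> y" if "x \<in> orbit t" "y \<in> orbit t" for x y
    using that sub m by (simp add: \<phi>_def distrib_right subset_iff)
  moreover have "\<phi> (a \<otimes> x) = a \<otimes> \<phi> x" if "a \<in> carrier R" "x \<in> orbit t" for a x
    using that sub m by (simp add: \<phi>_def mult_assoc subset_iff)
  ultimately show ?thesis
    unfolding isomorphic_left_ideals_def iso_def hom_def by (intro bexI[of _ \<phi>]) auto
qed

lemma simple_subset: "S \<in> {S. simple_left_ideal S R} \<Longrightarrow> S \<subseteq> carrier R"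
  by (simp add: left_ideal_subset simple_left_ideal_left_ideal)

lemma socle_subgroup: "additive_subgroup (socle R) R"
  unfolding socle_def by (rule sum_of_subgroups_subgroup(1)[OF simple_subset])

lemma socle_mem:
  assumes "a \<in> carrier R" "t \<in> carrier R"
  shows "a \<otimes> w \<otimes> t \<in> socle R"
proof (cases "w \<otimes> t = \<zero>")
  case True
  then have "a \<otimes> w \<otimes> t = \<zero>" using assms w by (simp add: mult_assoc mult_zero_right)
  then show ?thesis using additive_subgroup.zero_closed[OF socle_subgroup] by simp
next
  case False
  then have "orbit t \<in> {S. simple_left_ideal S R}" using orbit_simple assms by simp
  then have "orbit t \<subseteq> socle R"
    unfolding socle_def by (rule sum_of_subgroups_subgroup(2)[rotated]) (rule simple_subset)
  then show ?thesis using orbitI[OF assms(1)] by blast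
qed

lemma w_socle: "w \<in> socle R"
  using socle_mem[of w w] w by simp

text \<open>All simple left ideals are orbits, so the socle is additively generated by the products
  \<open>a w t\<close>, that is, it equals \<open>R w R\<close>. This description makes it two-sided
  and lets it be lifted along a surjection.\<close>

lemma socle_least:
  assumes "additive_subgroup H R"
    "\<And>a t. a \<in> carrier R \<Longrightarrow> t \<in> carrier R \<Longrightarrow> a \<otimes> w \<otimes> t \<in> H"
  shows "socle R \<subseteq> H"
  unfolding socle_def
proof (rule sum_of_subgroups_subgroup(3)[OF simple_subset assms(1)])
  fix S assume "S \<in> {S. simple_left_ideal S R}"
  then obtain t where "t \<in> carrier R" "S = orbit t" using simple_left_ideal_orbit by blast
  then show "S \<subseteq> H" using assms(2) by (auto simp: orbit_def)
qed

lemma socle_ideal: "rng_ideal (socle R) R"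
proof -
  interpret S: additive_subgroup "socle R" R by (rule socle_subgroup)
  have "socle R \<subseteq> {x \<in> carrier R. \<forall>a\<in>carrier R. a \<otimes> x \<in> socle R \<and> x \<otimes> a \<in> socle R}"
  proof (rule socle_least)
    show "additive_subgroup {x \<in> carrier R. \<forall>a\<in>carrier R. a \<otimes> x \<in> socle R \<and> x \<otimes> a \<in> socle R} R"
      by (rule additive_subgroupI')
         (auto simp: mult_zero_right mult_zero_left distrib_left distrib_right mult_minus_right mult_minus_left)
    fix a t assume at: "a \<in> carrier R" "t \<in> carrier R"
    have "b \<otimes> (a \<otimes> w \<otimes> t) \<in> socle R" "(a \<otimes> w \<otimes> t) \<otimes> b \<in> socle R" if b: "b \<in> carrier R" for b
      using socle_mem[of "b \<otimes> a" t] socle_mem[of a "t \<otimes> b"] at b w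
      by (simp_all add: mult_assoc mult_closed)
    then show "a \<otimes> w \<otimes> t \<in> {x \<in> carrier R. \<forall>a\<in>carrier R. a \<otimes> x \<in> socle R \<and> x \<otimes> a \<in> socle R}"
      using at w by (simp add: mult_closed)
  qed
  then show ?thesis
    using S.a_subset by (intro rng_idealI) auto
qed

lemma direct_sum_socle: "direct_sum_of_isomorphic_simple_left_ideals R (socle R)"
proof -
  obtain \<S> where \<S>: "\<forall>S\<in>\<S>. simple_left_ideal S R" "internal_direct_sum R \<S> (socle R)"
    using socle_direct_sum by blast
  have "isomorphic_left_ideals R S S'" if S: "S \<in> \<S>" and S': "S' \<in> \<S>" for S S'
  proof -
    obtain t where t: "t \<in> carrier R" "w \<otimes> t \<noteq> \<zero>" "S = orbit t"
      using simple_left_ideal_orbit[OF bspec[OF \<S>(1) S]] .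
    obtain t' where t': "t' \<in> carrier R" "w \<otimes> t' \<noteq> \<zero>" "S' = orbit t'"
      using simple_left_ideal_orbit[OF bspec[OF \<S>(1) S']] .
    show ?thesis using orbits_isomorphic[OF t(1,2) t'(1,2)] t t' by simp
  qed
  then show ?thesis
    using \<S> unfolding direct_sum_of_isomorphic_simple_left_ideals_def by blast
qed

text \<open>From a nonzero \<open>x\<close> in \<open>I\<close>, primeness used on both sides gives
  a nonzero \<open>w s x r w\<close>; dividing by it in the corner puts \<open>w\<close> into
  \<open>I\<close>, and \<open>w\<close> generates the socle.\<close>

lemma simple_socle: "simple_rng (R\<lparr>carrier := socle R\<rparr>)"
proof -
  let ?S = "R\<lparr>carrier := socle R\<rparr>"
  interpret S: rng_ideal "socle R" R by (rule socle_ideal)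
  have Sc: "x \<in> carrier R" if "x \<in> socle R" for x using S.a_subset that by blast
  have "abelian_group ?S"
  proof (rule abelian_groupI)
    fix x assume "x \<in> carrier ?S"
    then show "\<exists>y\<in>carrier ?S. y \<oplus>\<^bsub>?S\<^esub> x = \<zero>\<^bsub>?S\<^esub>"
      using Sc by (intro bexI[of _ "\<ominus> x"]) (auto simp: l_neg)
  qed (use Sc in \<open>auto simp: a_ac\<close>)
  then have rng: "rng ?S"
    by (intro rng.intro rng_axioms.intro)
       (use Sc S.left_closed in \<open>auto simp: mult_assoc distrib_left distrib_right\<close>)
  have ideals: "I = {\<zero>} \<or> I = socle R" if I: "rng_ideal I ?S" for I
  proof (cases "I \<subseteq> {\<zero>}")
    case True
    then show ?thesis
      using additive_subgroup.zero_closed[OF rng_ideal_additive_subgroup[OF I]] by auto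
  next
    case False
    then obtain x where x: "x \<in> I" "x \<noteq> \<zero>" by blast
    interpret I: rng_ideal I ?S by (rule I)
    have IS: "I \<subseteq> socle R" using I.a_subset by simp
    have xc: "x \<in> carrier R" using IS Sc x by blast
    have two: "p \<otimes> x' \<otimes> q \<in> I" if "p \<in> socle R" "x' \<in> I" "q \<in> socle R" for p x' q
      using I.right_closed[OF I.left_closed[of x' p], of q] that by simp
    obtain s where s: "s \<in> carrier R" "w \<otimes> s \<otimes> x \<noteq> \<zero>"
      using elementwise_primeE[OF prime w(1) xc w(3) x(2)] by blast
    have wsx: "w \<otimes> s \<otimes> x \<in> carrier R" using s w xc by (simp add: mult_closed)
    obtain r where r: "r \<in> carrier R" "(w \<otimes> s \<otimes> x) \<otimes> r \<otimes> w \<noteq> \<zero>"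
      using elementwise_primeE[OF prime wsx w(1) s(2) w(3)] by blast
    have eq: "(w \<otimes> s \<otimes> x) \<otimes> r \<otimes> w = w \<otimes> (s \<otimes> x \<otimes> r) \<otimes> w"
      using s xc r w by (simp add: mult_assoc mult_closed)
    have d: "w \<otimes> (s \<otimes> x \<otimes> r) \<otimes> w \<in> corner w"
      by (rule corner_mem) (use s xc r in \<open>simp add: mult_closed\<close>)
    obtain e where e: "e \<in> corner w" "e \<otimes> (w \<otimes> (s \<otimes> x \<otimes> r) \<otimes> w) = w"
      using division[OF d] r(2) eq by auto
    have ec: "e \<in> carrier R" using e by (simp add: corner_def)
    have "(e \<otimes> w \<otimes> s) \<otimes> x \<otimes> (r \<otimes> w \<otimes> w) \<in> I"
      by (rule two[OF socle_mem[OF ec s(1)] x(1) socle_mem[OF r(1) w(1)]])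
    moreover have "(e \<otimes> w \<otimes> s) \<otimes> x \<otimes> (r \<otimes> w \<otimes> w) = e \<otimes> (w \<otimes> (s \<otimes> x \<otimes> r) \<otimes> w)"
      using ec s xc r w by (simp add: mult_assoc mult_closed)
    ultimately have wI: "w \<in> I" using e(2) by simp
    have "socle R \<subseteq> I"
    proof (rule socle_least)
      show "additive_subgroup I R"
      proof (rule additive_subgroup.intro)
        have "subgroup (socle R) (add_monoid R)" by (rule S.a_subgroup)
        moreover have "subgroup I ((add_monoid R)\<lparr>carrier := socle R\<rparr>)"
          using I.a_subgroup by simp
        ultimately show "subgroup I (add_monoid R)"
          by (rule group.incl_subgroup[OF add.is_group])
      qed
      fix a t assume at: "a \<in> carrier R" "t \<in> carrier R"
      \<comment> \<open>\<open>I\<close> absorbs factors from the socle, not from all of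
        \<open>R\<close>. The repeated \<open>w\<close> puts both outer factors into the socle
        without changing the product.\<close>
      have "(a \<otimes> w \<otimes> w) \<otimes> w \<otimes> (w \<otimes> w \<otimes> t) \<in> I"
        by (rule two[OF socle_mem[OF at(1) w(1)] wI socle_mem[OF w(1) at(2)]])
      moreover have "(a \<otimes> w \<otimes> w) \<otimes> w \<otimes> (w \<otimes> w \<otimes> t) = a \<otimes> w \<otimes> t"
      proof -
        have "a \<otimes> w \<otimes> w = a \<otimes> w" using at w by (simp add: mult_assoc)
        then show ?thesis using at w by (simp add: mult_assoc[symmetric] mult_closed)
      qed
      ultimately show "a \<otimes> w \<otimes> t \<in> I" by simp
    qed
    then show ?thesis using IS by blast
  qed
  have "\<exists>x\<in>carrier ?S. \<exists>y\<in>carrier ?S. x \<otimes>\<^bsub>?S\<^esub> y \<noteq> \<zero>\<^bsub>?S\<^esub>"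
    using w w_socle by (intro bexI[of _ w]) auto
  then show ?thesis using rng ideals by (simp add: simple_rng_def)
qed

end

section \<open>The graph of a quotient\<close>

text \<open>A family may kill vertices, and may satisfy \<open>v = \<Sum> e e\<^sup>*\<close> at infinite emitters only finitely many
  edges of which survive. At such a vertex, the vertex idempotent is split into the part \<open>\<Sum> e e\<^sup>*\<close>
  below its surviving edges and the remainder, which becomes a sink (the breaking vertices of the
  literature); the same formula turns vertices without surviving edges into sinks.\<close>

context leavitt_family
begin

definition live :: "'v \<Rightarrow> 'e set" where
  "live v = {e \<in> out_arcs E v. vtx (head E e) \<noteq> \<zero>}"

text \<open>For infinite \<open>live v\<close> the vertex is not split: the emitting part is
  \<open>v\<close> and the remainder is zero.\<close>

definition emitting_part :: "'v \<Rightarrow> 'a" where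
  "emitting_part v = (if finite (live v) then \<Oplus>e\<in>live v. edg e \<otimes> gho e else vtx v)"

text \<open>\<open>True\<close> marks the remainder, which becomes a sink, and \<open>False\<close>
  the part from which the surviving edges start.\<close>

definition part :: "'v \<Rightarrow> bool \<Rightarrow> 'a" where
  "part v b = (if b then vtx v \<ominus> emitting_part v else emitting_part v)"

text \<open>An edge is doubled according to the two parts of its range, while both copies start at
  the emitting part of its source. Parts that vanish are left out, which guarantees that the new
  family kills no vertex.\<close>

definition qgraph :: "('v \<times> bool, 'e \<times> bool) pre_digraph" where
  "qgraph = \<lparr>verts = {(v, b). v \<in> verts E \<and> part v b \<noteq> \<zero>},
     arcs = {(e, b). e \<in> arcs E \<and> part (head E e) b \<noteq> \<zero>},
     tail = (\<lambda>(e, b). (tail E e, False)), head = (\<lambda>(e, b). (head E e, b))\<rparr>"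

fun qgen :: "('v \<times> bool, 'e \<times> bool) leavitt_gen \<Rightarrow> 'a" where
  "qgen (Vertex (v, b)) = part v b"
| "qgen (Edge (e, b)) = edg e \<otimes> part (head E e) b"
| "qgen (Ghost (e, b)) = part (head E e) b \<otimes> gho e"

lemma live_arcs: "live v \<subseteq> arcs E" "e \<in> live v \<Longrightarrow> tail E e = v"
  by (auto simp: live_def)

lemma dead_edg: "e \<in> arcs E \<Longrightarrow> vtx (head E e) = \<zero> \<Longrightarrow> edg e = \<zero>"
  using edg_head[of e] mult_zero_right[of "edg e"] by simp

lemma dead_gho: "e \<in> arcs E \<Longrightarrow> vtx (head E e) = \<zero> \<Longrightarrow> gho e = \<zero>"
  using head_gho[of e] mult_zero_left[of "gho e"] by simp

lemma edg_gho_closed: "e \<in> arcs E \<Longrightarrow> edg e \<otimes> gho e \<in> carrier A"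
  by (simp add: mult_closed)

lemma emitting_part_closed: "v \<in> verts E \<Longrightarrow> emitting_part v \<in> carrier A"
  unfolding emitting_part_def using live_arcs(1)[of v]
  by (auto intro!: finsum_closed edg_gho_closed)

text \<open>For a live edge this is \<open>e e\<^sup>* e = e\<close>, the other summands being
  orthogonal to \<open>e\<close>; a dead edge is zero in the algebra because
  \<open>e = e r(e)\<close>.\<close>

lemma emitting_part_edg:
  assumes "e \<in> out_arcs E v"
  shows "emitting_part v \<otimes> edg e = edg e" "gho e \<otimes> emitting_part v = gho e"
proof -
  have e: "e \<in> arcs E" "tail E e = v" using assms by auto
  show "emitting_part v \<otimes> edg e = edg e"
  proof (cases "finite (live v)")
    case False
    then show ?thesis using e tail_edg by (auto simp: emitting_part_def)
  next
    case fin: True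
    show ?thesis
    proof (cases "e \<in> live v")
      case False
      then have "edg e = \<zero>" using assms e dead_edg by (auto simp: live_def)
      then show ?thesis using emitting_part_closed[of v] e by (auto simp: mult_zero_right)
    next
      case True
      have t: "(edg f \<otimes> gho f) \<otimes> edg e = (if f = e then edg e else \<zero>)" if "f \<in> live v" for f
        using that live_arcs(1)[of v] e
        by (auto simp: mult_assoc gho_edg gho_edg_orth edg_head mult_zero_right subset_iff)
      have "emitting_part v \<otimes> edg e = (\<Oplus>f\<in>live v. (edg f \<otimes> gho f) \<otimes> edg e)"
        unfolding emitting_part_def using fin e live_arcs(1)[of v]
        by (simp, intro finsum_mult_left) (auto intro!: edg_gho_closed)
      also have "\<dots> = (edg e \<otimes> gho e) \<otimes> edg e"
        by (rule finsum_single[OF fin True]) (use t e in auto)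
      finally show ?thesis using t[OF True] by simp
    qed
  qed
  show "gho e \<otimes> emitting_part v = gho e"
  proof (cases "finite (live v)")
    case False
    then show ?thesis using e gho_tail by (auto simp: emitting_part_def)
  next
    case fin: True
    show ?thesis
    proof (cases "e \<in> live v")
      case False
      then have "gho e = \<zero>" using assms e dead_gho by (auto simp: live_def)
      then show ?thesis using emitting_part_closed[of v] e by (auto simp: mult_zero_left)
    next
      case True
      have t: "gho e \<otimes> (edg f \<otimes> gho f) = (if f = e then gho e else \<zero>)" if "f \<in> live v" for f
        using that live_arcs(1)[of v] e
        by (auto simp: mult_assoc[symmetric] gho_edg gho_edg_orth head_gho mult_zero_left subset_iff)
      have "gho e \<otimes> emitting_part v = (\<Oplus>f\<in>live v. gho e \<otimes> (edg f \<otimes> gho f))"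
        unfolding emitting_part_def using fin e live_arcs(1)[of v]
        by (simp, intro finsum_mult_right) (auto intro!: edg_gho_closed)
      also have "\<dots> = gho e \<otimes> (edg e \<otimes> gho e)"
        by (rule finsum_single[OF fin True]) (use t e in auto)
      finally show ?thesis using t[OF True] by simp
    qed
  qed
qed

lemma emitting_part_vtx:
  assumes "v \<in> verts E"
  shows "vtx v \<otimes> emitting_part v = emitting_part v" "emitting_part v \<otimes> vtx v = emitting_part v"
    "emitting_part v \<otimes> emitting_part v = emitting_part v"
proof -
  have l: "f \<in> arcs E" "tail E f = v" "f \<in> out_arcs E v" if "f \<in> live v" for f
    using that by (auto simp: live_def)
  have gt: "gho f \<otimes> vtx v = gho f" if "f \<in> live v" for f
    using gho_tail[OF l(1)[OF that]] l(2)[OF that] by simp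
  have sum: "x \<otimes> emitting_part v = emitting_part v"
    if x: "x \<in> carrier A" "\<And>f. f \<in> live v \<Longrightarrow> x \<otimes> edg f = edg f" and fin: "finite (live v)" for x
  proof -
    have "x \<otimes> emitting_part v = (\<Oplus>f\<in>live v. x \<otimes> (edg f \<otimes> gho f))"
      unfolding emitting_part_def using fin x(1) l(1)
      by (simp, intro finsum_mult_right) (auto intro!: edg_gho_closed)
    also have "\<dots> = (\<Oplus>f\<in>live v. edg f \<otimes> gho f)"
      by (rule finsum_cong'[OF refl])
         (use x l(1) in \<open>auto simp: mult_assoc[symmetric] intro!: edg_gho_closed\<close>)
    finally show ?thesis using fin by (simp add: emitting_part_def)
  qed
  show "vtx v \<otimes> emitting_part v = emitting_part v"
  proof (cases "finite (live v)")
    case True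
    then show ?thesis using sum[of "vtx v"] assms tail_edg l by auto
  qed (use assms in \<open>simp add: emitting_part_def vtx_idem\<close>)
  show "emitting_part v \<otimes> vtx v = emitting_part v"
  proof (cases "finite (live v)")
    case fin: True
    have "emitting_part v \<otimes> vtx v = (\<Oplus>f\<in>live v. (edg f \<otimes> gho f) \<otimes> vtx v)"
      unfolding emitting_part_def using fin assms l(1)
      by (simp, intro finsum_mult_left) (auto intro!: edg_gho_closed)
    also have "\<dots> = (\<Oplus>f\<in>live v. edg f \<otimes> gho f)"
      by (rule finsum_cong'[OF refl])
         (use assms l gt in \<open>auto simp: mult_assoc intro!: edg_gho_closed\<close>)
    finally show ?thesis using fin by (simp add: emitting_part_def)
  qed (use assms in \<open>simp add: emitting_part_def vtx_idem\<close>)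
  show "emitting_part v \<otimes> emitting_part v = emitting_part v"
  proof (cases "finite (live v)")
    case True
    then show ?thesis
      using sum[of "emitting_part v"] emitting_part_closed[OF assms] emitting_part_edg(1) l(3) by blast
  qed (use assms in \<open>simp add: emitting_part_def vtx_idem\<close>)
qed

lemma part_closed: "v \<in> verts E \<Longrightarrow> part v b \<in> carrier A"
  by (simp add: part_def emitting_part_closed)

lemma part_sum: "v \<in> verts E \<Longrightarrow> part v False \<oplus> part v True = vtx v"
  using diff_add_cancel[of "vtx v" "emitting_part v"] emitting_part_closed[of v]
  by (simp add: part_def a_comm)

lemma vtx_part: "v \<in> verts E \<Longrightarrow> vtx v \<otimes> part v b = part v b"
  and part_vtx: "v \<in> verts E \<Longrightarrow> part v b \<otimes> vtx v = part v b"
  by (auto simp: part_def mult_diff_left mult_diff_right emitting_part_closed emitting_part_vtx vtx_idem)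

lemma part_part: "v \<in> verts E \<Longrightarrow> part v b \<otimes> part v c = (if b = c then part v b else \<zero>)"
  using emitting_part_closed[of v]
  by (auto simp: part_def mult_diff_left mult_diff_right emitting_part_vtx vtx_idem diff_self diff_zero)

lemma part_orth: "v \<in> verts E \<Longrightarrow> x \<in> verts E \<Longrightarrow> v \<noteq> x \<Longrightarrow> part v b \<otimes> part x c = \<zero>"
proof -
  assume a: "v \<in> verts E" "x \<in> verts E" "v \<noteq> x"
  have "part v b \<otimes> part x c = (part v b \<otimes> vtx v) \<otimes> (vtx x \<otimes> part x c)"
    using a by (simp add: vtx_part part_vtx)
  also have "\<dots> = part v b \<otimes> ((vtx v \<otimes> vtx x) \<otimes> part x c)"
    using a part_closed by (simp add: mult_assoc mult_closed)
  finally show ?thesis using a part_closed by (simp add: vtx_orth mult_zero_left mult_zero_right)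
qed

text \<open>The remainder \<open>v - \<Sum> e e\<^sup>*\<close> annihilates all edges at
  \<open>v\<close>, which is why it can be a sink of \<open>qgraph\<close>.\<close>

lemma part_edg:
  assumes "e \<in> arcs E"
  shows "part (tail E e) b \<otimes> edg e = (if b then \<zero> else edg e)"
    "gho e \<otimes> part (tail E e) b = (if b then \<zero> else gho e)"
  using assms emitting_part_edg[of e "tail E e"] emitting_part_closed[of "tail E e"]
  by (auto simp: part_def mult_diff_left mult_diff_right tail_edg gho_tail diff_self)

lemma part_zero: "v \<in> verts E \<Longrightarrow> vtx v = \<zero> \<Longrightarrow> part v b = \<zero>"
  using part_vtx[of v b] part_closed[of v b] by (simp add: mult_zero_right)

lemma live_iff: "e \<in> out_arcs E v \<Longrightarrow> e \<in> live v \<longleftrightarrow> (\<exists>b. part (head E e) b \<noteq> \<zero>)"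
proof -
  assume e: "e \<in> out_arcs E v"
  then have h: "head E e \<in> verts E" by auto
  have "vtx (head E e) \<noteq> \<zero>" if "part (head E e) b \<noteq> \<zero>" for b
    using that part_zero[OF h] by blast
  moreover have "\<exists>b. part (head E e) b \<noteq> \<zero>" if "vtx (head E e) \<noteq> \<zero>"
  proof (rule ccontr)
    assume "\<not> ?thesis"
    then have "vtx (head E e) = \<zero>" using part_sum[OF h] by simp
    then show False using that by simp
  qed
  ultimately show ?thesis using e by (auto simp: live_def)
qed

text \<open>If the emitting part were zero, then so would be \<open>e\<close>, and with it
  \<open>r(e) = e\<^sup>* e\<close>. Hence the source of every edge of \<open>qgraph\<close> is a
  vertex of \<open>qgraph\<close>.\<close>

lemma live_part: "e \<in> live v \<Longrightarrow> part v False \<noteq> \<zero>"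
proof
  assume e: "e \<in> live v" and "part v False = \<zero>"
  then have a: "e \<in> arcs E" "tail E e = v" "vtx (head E e) \<noteq> \<zero>" by (auto simp: live_def)
  then have "edg e = \<zero>"
    using part_edg(1)[of e False] \<open>part v False = \<zero>\<close> by (simp add: mult_zero_left)
  then show False using gho_edg[of e] a by (simp add: mult_zero_right)
qed

lemma qgraph_simps [simp]:
  "(v, b) \<in> verts qgraph \<longleftrightarrow> v \<in> verts E \<and> part v b \<noteq> \<zero>"
  "(e, b) \<in> arcs qgraph \<longleftrightarrow> e \<in> arcs E \<and> part (head E e) b \<noteq> \<zero>"
  "tail qgraph (e, b) = (tail E e, False)" "head qgraph (e, b) = (head E e, b)"
  by (auto simp: qgraph_def)

lemma wf_qgraph: "wf_digraph qgraph"
proof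
  fix x assume x: "x \<in> arcs qgraph"
  obtain e b where eb: "x = (e, b)" by (cases x)
  have e: "e \<in> arcs E" "part (head E e) b \<noteq> \<zero>" using x eb by auto
  then have "e \<in> live (tail E e)" using live_iff[of e "tail E e"] by auto
  then have "part (tail E e) False \<noteq> \<zero>" by (rule live_part)
  then show "tail qgraph x \<in> verts qgraph" "head qgraph x \<in> verts qgraph" using e eb by auto
qed

lemma out_arcs_qgraph:
  "out_arcs qgraph (v, False) = {(e, b). e \<in> live v \<and> part (head E e) b \<noteq> \<zero>}"
  "out_arcs qgraph (v, True) = {}"
proof -
  have "(e, b) \<in> out_arcs qgraph (v, False) \<longleftrightarrow> e \<in> live v \<and> part (head E e) b \<noteq> \<zero>" for e b
    using live_iff[of e v] by (auto simp: out_arcs_def live_def)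
  then show "out_arcs qgraph (v, False) = {(e, b). e \<in> live v \<and> part (head E e) b \<noteq> \<zero>}"
    by (auto simp del: in_out_arcs_conv)
  show "out_arcs qgraph (v, True) = {}" by (auto simp: out_arcs_def)
qed

lemma finite_out_arcs_qgraph: "finite (out_arcs qgraph (v, False)) \<longleftrightarrow> finite (live v)"
proof
  assume f: "finite (out_arcs qgraph (v, False))"
  have "live v \<subseteq> fst ` out_arcs qgraph (v, False)"
  proof
    fix e assume e: "e \<in> live v"
    then have "e \<in> out_arcs E v" by (simp add: live_def)
    then obtain b where "part (head E e) b \<noteq> \<zero>" using live_iff e by blast
    then show "e \<in> fst ` out_arcs qgraph (v, False)"
      using e by (intro image_eqI[of _ _ "(e, b)"]) (auto simp: out_arcs_qgraph)
  qed
  then show "finite (live v)" using f finite_surj by blast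
next
  assume "finite (live v)"
  then have "finite (live v \<times> (UNIV :: bool set))" by simp
  then show "finite (out_arcs qgraph (v, False))"
    by (rule rev_finite_subset) (auto simp: out_arcs_qgraph)
qed

lemma out_arcs_qgraph_empty: "out_arcs qgraph (v, False) = {} \<longleftrightarrow> live v = {}"
proof
  assume o: "out_arcs qgraph (v, False) = {}"
  have "e \<notin> live v" for e
  proof
    assume e: "e \<in> live v"
    then have "e \<in> out_arcs E v" by (simp add: live_def)
    then obtain b where "part (head E e) b \<noteq> \<zero>" using live_iff e by blast
    then show False using e o by (auto simp: out_arcs_qgraph)
  qed
  then show "live v = {}" by blast
qed (auto simp: out_arcs_qgraph)

text \<open>The target \<open>B\<close> is arbitrary because the sum is needed in \<open>A\<close>
  as well as in algebras carrying a family for \<open>qgraph\<close>. \<open>Z\<close> may be larger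
  than \<open>live v\<close>, as the pairs that are not edges of \<open>qgraph\<close> contribute
  zero.\<close>

lemma out_arcs_qgraph_sum:
  fixes B :: "('k, 'b) module"
  assumes "abelian_group B" and Z: "finite Z" "live v \<subseteq> Z"
    and g: "\<And>e b. e \<in> Z \<Longrightarrow> g (e, b) \<in> carrier B"
      "\<And>e b. e \<in> Z \<Longrightarrow> (e, b) \<notin> out_arcs qgraph (v, False) \<Longrightarrow> g (e, b) = \<zero>\<^bsub>B\<^esub>"
  shows "finsum B g (out_arcs qgraph (v, False)) = (\<Oplus>\<^bsub>B\<^esub>e\<in>Z. g (e, False) \<oplus>\<^bsub>B\<^esub> g (e, True))"
proof -
  interpret B: abelian_group B by fact
  let ?f = "\<lambda>b e. (e, b) :: 'e \<times> bool"
  have Un: "Z \<times> UNIV = ?f False ` Z \<union> ?f True ` Z"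
    by (auto simp: image_iff)
  have "finsum B g (out_arcs qgraph (v, False)) = finsum B g (Z \<times> UNIV)"
  proof (rule B.add.finprod_mono_neutral_cong_left)
    fix x assume x: "x \<in> Z \<times> UNIV - out_arcs qgraph (v, False)"
    obtain e b where "x = (e, b)" by (cases x)
    then show "g x = \<zero>\<^bsub>B\<^esub>" using x g(2)[of e b] by simp
  qed (use Z g(1) in \<open>auto simp: out_arcs_qgraph\<close>)
  also have "\<dots> = finsum B g (?f False ` Z) \<oplus>\<^bsub>B\<^esub> finsum B g (?f True ` Z)"
    unfolding Un by (rule B.finsum_Un_disjoint) (use Z g in auto)
  also have "finsum B g (?f False ` Z) = (\<Oplus>\<^bsub>B\<^esub>e\<in>Z. g (e, False))"
    by (rule B.finsum_reindex) (use g in \<open>auto simp: inj_on_def\<close>)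
  also have "finsum B g (?f True ` Z) = (\<Oplus>\<^bsub>B\<^esub>e\<in>Z. g (e, True))"
    by (rule B.finsum_reindex) (use g in \<open>auto simp: inj_on_def\<close>)
  also have "(\<Oplus>\<^bsub>B\<^esub>e\<in>Z. g (e, False)) \<oplus>\<^bsub>B\<^esub> (\<Oplus>\<^bsub>B\<^esub>e\<in>Z. g (e, True))
    = (\<Oplus>\<^bsub>B\<^esub>e\<in>Z. g (e, False) \<oplus>\<^bsub>B\<^esub> g (e, True))"
    by (rule B.finsum_addf[symmetric]) (use g in auto)
  finally show ?thesis .
qed

text \<open>The two copies of a live edge together contribute
  \<open>e (r' + r'') e\<^sup>* = e e\<^sup>*\<close>, where \<open>r'\<close> and
  \<open>r''\<close> are the parts of its range. This is the regular relation of
  \<open>qgraph\<close> at an emitting part.\<close>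

lemma qgen_sum:
  assumes "finite (live v)"
  shows "(\<Oplus>x\<in>out_arcs qgraph (v, False). qgen (Edge x) \<otimes> qgen (Ghost x)) = part v False"
proof -
  have summand: "qgen (Edge (e, b)) \<otimes> qgen (Ghost (e, b)) = edg e \<otimes> part (head E e) b \<otimes> gho e"
    if "e \<in> arcs E" for e b
  proof -
    have "qgen (Edge (e, b)) \<otimes> qgen (Ghost (e, b))
      = edg e \<otimes> (part (head E e) b \<otimes> part (head E e) b) \<otimes> gho e"
      using that part_closed by (simp add: mult_assoc mult_closed del: part_part)
    then show ?thesis using that by (simp add: part_part)
  qed
  have "(\<Oplus>x\<in>out_arcs qgraph (v, False). qgen (Edge x) \<otimes> qgen (Ghost x))
    = (\<Oplus>e\<in>live v. qgen (Edge (e, False)) \<otimes> qgen (Ghost (e, False)) \<oplus>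
        qgen (Edge (e, True)) \<otimes> qgen (Ghost (e, True)))"
    by (rule out_arcs_qgraph_sum[OF abelian_group_axioms assms order_refl])
       (use live_arcs(1)[of v] part_closed in
         \<open>auto simp: out_arcs_qgraph mult_closed subset_iff mult_zero_left mult_zero_right\<close>)
  also have "\<dots> = (\<Oplus>e\<in>live v. edg e \<otimes> gho e)"
  proof (rule finsum_cong'[OF refl])
    fix e assume "e \<in> live v"
    then have e: "e \<in> arcs E" using live_arcs by auto
    have "edg e \<otimes> part (head E e) False \<otimes> gho e \<oplus> edg e \<otimes> part (head E e) True \<otimes> gho e
      = edg e \<otimes> (part (head E e) False \<oplus> part (head E e) True) \<otimes> gho e"
      using e part_closed by (simp add: distrib_left distrib_right mult_closed)
    also have "\<dots> = edg e \<otimes> gho e" using e by (simp add: part_sum edg_head)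
    finally show "qgen (Edge (e, False)) \<otimes> qgen (Ghost (e, False)) \<oplus>
        qgen (Edge (e, True)) \<otimes> qgen (Ghost (e, True)) = edg e \<otimes> gho e"
      using e by (simp only: summand)
  qed (use live_arcs(1)[of v] in \<open>auto intro!: edg_gho_closed\<close>)
  finally show ?thesis using assms by (simp add: part_def emitting_part_def)
qed

lemma qgen_closed: "qgen \<in> leavitt_gens qgraph \<rightarrow> carrier A"
  by (auto simp: leavitt_gens_def part_closed mult_closed)

lemma qgen_family: "leavitt_family K A qgraph qgen"
proof -
  interpret Q: wf_digraph qgraph by (rule wf_qgraph)
  show ?thesis
  proof (unfold_locales, goal_cases)
    case 1
    show ?case by (rule qgen_closed)
  next
    case (2 x y)
    then show ?case
    proof (cases rule: leavitt_relation.cases)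
      case (vertex_idem v)
      then show ?thesis by (cases v) (simp add: part_part)
    next
      case (vertex_orth v u)
      then show ?thesis by (cases v; cases u; cases "fst v = fst u") (auto simp: part_part part_orth)
    next
      case (source_edge e)
      obtain f b where f: "e = (f, b)" "f \<in> arcs E" using source_edge by (cases e) auto
      have "part (tail E f) False \<otimes> (edg f \<otimes> part (head E f) b) = edg f \<otimes> part (head E f) b"
        using f part_edg(1)[of f False] part_closed by (simp add: mult_assoc[symmetric])
      then show ?thesis using source_edge f by simp
    next
      case (edge_range e)
      obtain f b where f: "e = (f, b)" "f \<in> arcs E" using edge_range by (cases e) auto
      have "(edg f \<otimes> part (head E f) b) \<otimes> part (head E f) b = edg f \<otimes> part (head E f) b"
        using f part_closed by (simp add: mult_assoc part_part)
      then show ?thesis using edge_range f by simp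
    next
      case (range_ghost e)
      obtain f b where f: "e = (f, b)" "f \<in> arcs E" using range_ghost by (cases e) auto
      have "part (head E f) b \<otimes> (part (head E f) b \<otimes> gho f) = part (head E f) b \<otimes> gho f"
        using f part_closed by (simp add: mult_assoc[symmetric] part_part)
      then show ?thesis using range_ghost f by simp
    next
      case (ghost_source e)
      obtain f b where f: "e = (f, b)" "f \<in> arcs E" using ghost_source by (cases e) auto
      have "(part (head E f) b \<otimes> gho f) \<otimes> part (tail E f) False = part (head E f) b \<otimes> gho f"
        using f part_edg(2)[of f False] part_closed by (simp add: mult_assoc)
      then show ?thesis using ghost_source f by simp
    next
      case (ghost_edge e)
      obtain f b where f: "e = (f, b)" "f \<in> arcs E" using ghost_edge by (cases e) auto
      have "(part (head E f) b \<otimes> gho f) \<otimes> (edg f \<otimes> part (head E f) b)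
        = part (head E f) b \<otimes> ((gho f \<otimes> edg f) \<otimes> part (head E f) b)"
        using f part_closed by (simp add: mult_assoc mult_closed)
      also have "\<dots> = part (head E f) b" using f by (simp add: gho_edg vtx_part part_part)
      finally show ?thesis using ghost_edge f by simp
    next
      case (ghost_edge_orth e e')
      obtain f b where f: "e = (f, b)" "f \<in> arcs E" using ghost_edge_orth by (cases e) auto
      obtain g c where g: "e' = (g, c)" "g \<in> arcs E" using ghost_edge_orth by (cases e') auto
      have "(part (head E f) b \<otimes> gho f) \<otimes> (edg g \<otimes> part (head E g) c)
        = part (head E f) b \<otimes> ((gho f \<otimes> edg g) \<otimes> part (head E g) c)"
        using f g part_closed by (simp add: mult_assoc mult_closed)
      also have "\<dots> = \<zero>"
      proof (cases "f = g")
        case True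
        then have "b \<noteq> c" using f g ghost_edge_orth by auto
        then show ?thesis using True f g by (simp add: gho_edg vtx_part part_part)
      next
        case False
        then show ?thesis
          using f g part_closed by (simp add: gho_edg_orth mult_zero_left mult_zero_right)
      qed
      finally show ?thesis using ghost_edge_orth f g by simp
    next
      case (regular v)
      obtain u b where v: "v = (u, b)" by (cases v)
      then have "b = False" using regular out_arcs_qgraph(2)[of u] by (cases b) (auto simp: regular_vertex_def)
      then have u: "v = (u, False)" using v by simp
      have "finite (live u)"
        using regular u finite_out_arcs_qgraph by (simp add: regular_vertex_def)
      then show ?thesis using regular u qgen_sum by simp
    qed
  qed
qed

end

section \<open>Families for the original graph obtained from families for the split graph\<close>

context leavitt_family
begin

text \<open>Generators absent from \<open>qgraph\<close> stand for zero, so that each old generator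
  is the sum of its two copies without case distinctions.\<close>

definition extend_zero ::
    "('k, 'b) module \<Rightarrow> (('v \<times> bool, 'e \<times> bool) leavitt_gen \<Rightarrow> 'b)
      \<Rightarrow> ('v \<times> bool, 'e \<times> bool) leavitt_gen \<Rightarrow> 'b" where
  "extend_zero B \<mu> x = (if x \<in> leavitt_gens qgraph then \<mu> x else \<zero>\<^bsub>B\<^esub>)"

text \<open>Reverses the splitting: every vertex, edge and ghost of \<open>E\<close> becomes the sum
  of its two copies. The dead vertices are sent to zero.\<close>

fun pullback ::
    "('k, 'b) module \<Rightarrow> (('v \<times> bool, 'e \<times> bool) leavitt_gen \<Rightarrow> 'b) \<Rightarrow> ('v, 'e) leavitt_gen \<Rightarrow> 'b" where
  "pullback B \<mu> (Vertex v) =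
     extend_zero B \<mu> (Vertex (v, False)) \<oplus>\<^bsub>B\<^esub> extend_zero B \<mu> (Vertex (v, True))"
| "pullback B \<mu> (Edge e) =
     extend_zero B \<mu> (Edge (e, False)) \<oplus>\<^bsub>B\<^esub> extend_zero B \<mu> (Edge (e, True))"
| "pullback B \<mu> (Ghost e) =
     extend_zero B \<mu> (Ghost (e, False)) \<oplus>\<^bsub>B\<^esub> extend_zero B \<mu> (Ghost (e, True))"

lemma leavitt_gens_iff [simp]:
  "Vertex x \<in> leavitt_gens G \<longleftrightarrow> x \<in> verts G"
  "Edge y \<in> leavitt_gens G \<longleftrightarrow> y \<in> arcs G"
  "Ghost y \<in> leavitt_gens G \<longleftrightarrow> y \<in> arcs G"
  by (auto simp: leavitt_gens_def)

lemma live_if_part: "e \<in> arcs E \<Longrightarrow> part (head E e) b \<noteq> \<zero> \<Longrightarrow> part (tail E e) False \<noteq> \<zero>"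
  using live_iff[of e "tail E e"] live_part by auto

context
  fixes B :: "('k, 'b) module" and \<mu>
  assumes \<mu>: "leavitt_family K B qgraph \<mu>"
begin

interpretation B: leavitt_family K B qgraph \<mu> by (rule \<mu>)

abbreviation "V v b \<equiv> extend_zero B \<mu> (Vertex (v, b))"
abbreviation "G e b \<equiv> extend_zero B \<mu> (Edge (e, b))"
abbreviation "H e b \<equiv> extend_zero B \<mu> (Ghost (e, b))"

lemma extend_zero_closed: "extend_zero B \<mu> x \<in> carrier B"
  using B.gen_closed by (auto simp: extend_zero_def)

lemma extend_vtx_vtx:
  assumes "v \<in> verts E" "u \<in> verts E"
  shows "V v b \<otimes>\<^bsub>B\<^esub> V u c = (if v = u \<and> b = c then V v b else \<zero>\<^bsub>B\<^esub>)"
  using B.vtx_idem[of "(v, b)"] B.vtx_orth[of "(v, b)" "(u, c)"] B.vtx_closed[of "(v, b)"]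
    B.vtx_closed[of "(u, c)"] assms
  by (auto simp: extend_zero_def B.mult_zero_left B.mult_zero_right)

lemma extend_vtx_edg:
  assumes "e \<in> arcs E"
  shows "V (tail E e) b \<otimes>\<^bsub>B\<^esub> G e c = (if b then \<zero>\<^bsub>B\<^esub> else G e c)"
  using B.tail_edg[of "(e, c)"] B.vtx_edg_orth[of "(e, c)" "(tail E e, b)"] assms
    B.vtx_closed[of "(tail E e, b)"] B.edg_closed[of "(e, c)"] live_if_part[of e c]
  by (cases b) (auto simp: extend_zero_def B.mult_zero_left B.mult_zero_right)

lemma extend_edg_vtx:
  assumes "e \<in> arcs E"
  shows "G e c \<otimes>\<^bsub>B\<^esub> V (head E e) b = (if b = c then G e c else \<zero>\<^bsub>B\<^esub>)"
  using B.edg_head[of "(e, c)"] B.edg_vtx_orth[of "(e, c)" "(head E e, b)"] assms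
    B.vtx_closed[of "(head E e, b)"] B.edg_closed[of "(e, c)"]
  by (auto simp: extend_zero_def B.mult_zero_left B.mult_zero_right)

lemma extend_vtx_gho:
  assumes "e \<in> arcs E"
  shows "V (head E e) b \<otimes>\<^bsub>B\<^esub> H e c = (if b = c then H e c else \<zero>\<^bsub>B\<^esub>)"
proof -
  have c: "V (head E e) c \<otimes>\<^bsub>B\<^esub> H e c = H e c"
    using B.head_gho[of "(e, c)"] assms by (auto simp: extend_zero_def B.mult_zero_left)
  have "V (head E e) b \<otimes>\<^bsub>B\<^esub> H e c = (V (head E e) b \<otimes>\<^bsub>B\<^esub> V (head E e) c) \<otimes>\<^bsub>B\<^esub> H e c"
    using c extend_zero_closed by (simp add: B.mult_assoc)
  then show ?thesis
    using c assms extend_zero_closed by (auto simp: extend_vtx_vtx B.mult_zero_left)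
qed

lemma extend_gho_vtx:
  assumes "e \<in> arcs E"
  shows "H e c \<otimes>\<^bsub>B\<^esub> V (tail E e) b = (if b then \<zero>\<^bsub>B\<^esub> else H e c)"
  using B.gho_tail[of "(e, c)"] B.gho_vtx_orth[of "(e, c)" "(tail E e, b)"] assms
    B.vtx_closed[of "(tail E e, b)"] B.gho_closed[of "(e, c)"] live_if_part[of e c]
  by (cases b) (auto simp: extend_zero_def B.mult_zero_left B.mult_zero_right)

lemma extend_gho_edg:
  assumes "e \<in> arcs E" "f \<in> arcs E"
  shows "H e b \<otimes>\<^bsub>B\<^esub> G f c = (if e = f \<and> b = c then V (head E e) b else \<zero>\<^bsub>B\<^esub>)"
  using B.gho_edg[of "(e, b)"] B.gho_edg_orth[of "(e, b)" "(f, c)"] B.gho_closed[of "(e, b)"]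
    B.edg_closed[of "(f, c)"] assms
  by (auto simp: extend_zero_def B.mult_zero_left B.mult_zero_right)

lemma extend_edg_gho_orth: "e \<in> arcs E \<Longrightarrow> b \<noteq> c \<Longrightarrow> G e b \<otimes>\<^bsub>B\<^esub> H e c = \<zero>\<^bsub>B\<^esub>"
proof -
  assume e: "e \<in> arcs E" "b \<noteq> c"
  have "G e b \<otimes>\<^bsub>B\<^esub> H e c = G e b \<otimes>\<^bsub>B\<^esub> (V (head E e) b \<otimes>\<^bsub>B\<^esub> H e c)"
    using extend_edg_vtx[OF e(1), of b b] extend_zero_closed by (simp add: B.mult_assoc[symmetric])
  then show ?thesis using extend_vtx_gho[OF e(1), of b c] e(2) extend_zero_closed by (simp add: B.mult_zero_right)
qed

lemma pullback_edge_ghost: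
  "e \<in> arcs E \<Longrightarrow> pullback B \<mu> (Edge e) \<otimes>\<^bsub>B\<^esub> pullback B \<mu> (Ghost e)
    = G e False \<otimes>\<^bsub>B\<^esub> H e False \<oplus>\<^bsub>B\<^esub> G e True \<otimes>\<^bsub>B\<^esub> H e True"
  using extend_zero_closed
  by (simp add: B.distrib_left B.distrib_right B.mult_closed extend_edg_gho_orth)

text \<open>The relation of \<open>qgraph\<close> at an emitting part, rewritten over edges of
  \<open>E\<close>. The choice \<open>Z = live v\<close> is used for surjectivity of the comparison
  map, and the set of all edges at \<open>v\<close> for the relation at a regular vertex of
  \<open>E\<close>.\<close>

lemma pullback_sum:
  assumes v: "v \<in> verts E" and Z: "finite Z" "live v \<subseteq> Z" "Z \<subseteq> out_arcs E v"
  shows "V v False = (\<Oplus>\<^bsub>B\<^esub>e\<in>Z. pullback B \<mu> (Edge e) \<otimes>\<^bsub>B\<^esub> pullback B \<mu> (Ghost e))"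
proof -
  have fin: "finite (live v)" using Z finite_subset by blast
  define g where "g = (\<lambda>(e, b). G e b \<otimes>\<^bsub>B\<^esub> H e b)"
  have "V v False = (\<Oplus>\<^bsub>B\<^esub>x\<in>out_arcs qgraph (v, False). \<mu> (Edge x) \<otimes>\<^bsub>B\<^esub> \<mu> (Ghost x))"
  proof (cases "live v = {}")
    case True
    then have "part v False = \<zero>" by (simp add: part_def emitting_part_def)
    then show ?thesis using True by (simp add: extend_zero_def out_arcs_qgraph)
  next
    case False
    then have "regular_vertex qgraph (v, False)"
      using v live_part fin finite_out_arcs_qgraph out_arcs_qgraph_empty
      by (auto simp: regular_vertex_def)
    moreover from this have "V v False = \<mu> (Vertex (v, False))"
      by (simp add: extend_zero_def regular_vertex_def)
    ultimately show ?thesis using B.vtx_regular by simp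
  qed
  also have "\<dots> = finsum B g (out_arcs qgraph (v, False))"
  proof (rule B.finsum_cong'[OF refl])
    show "g \<in> out_arcs qgraph (v, False) \<rightarrow> carrier B"
      using extend_zero_closed by (auto simp: g_def B.mult_closed)
    fix x assume "x \<in> out_arcs qgraph (v, False)"
    then show "\<mu> (Edge x) \<otimes>\<^bsub>B\<^esub> \<mu> (Ghost x) = g x"
      by (cases x) (simp add: g_def extend_zero_def)
  qed
  also have "\<dots> = (\<Oplus>\<^bsub>B\<^esub>e\<in>Z. g (e, False) \<oplus>\<^bsub>B\<^esub> g (e, True))"
  proof (rule out_arcs_qgraph_sum[OF B.abelian_group_axioms Z(1,2)])
    fix e b assume e: "e \<in> Z"
    show "g (e, b) \<in> carrier B"
      using extend_zero_closed by (simp add: g_def B.mult_closed)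
    assume "(e, b) \<notin> out_arcs qgraph (v, False)"
    then have "(e, b) \<notin> arcs qgraph" using e Z(3) by auto
    then have "G e b = \<zero>\<^bsub>B\<^esub>" by (auto simp: extend_zero_def)
    then show "g (e, b) = \<zero>\<^bsub>B\<^esub>" using extend_zero_closed by (simp add: g_def B.mult_zero_left)
  qed
  also have "\<dots> = (\<Oplus>\<^bsub>B\<^esub>e\<in>Z. pullback B \<mu> (Edge e) \<otimes>\<^bsub>B\<^esub> pullback B \<mu> (Ghost e))"
  proof (rule B.finsum_cong'[OF refl])
    show "(\<lambda>e. pullback B \<mu> (Edge e) \<otimes>\<^bsub>B\<^esub> pullback B \<mu> (Ghost e)) \<in> Z \<rightarrow> carrier B"
      using extend_zero_closed by (auto intro!: B.mult_closed)
    fix e assume "e \<in> Z"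
    then have "e \<in> arcs E" using Z(3) by auto
    then show "g (e, False) \<oplus>\<^bsub>B\<^esub> g (e, True) = pullback B \<mu> (Edge e) \<otimes>\<^bsub>B\<^esub> pullback B \<mu> (Ghost e)"
      by (simp only: pullback_edge_ghost) (simp add: g_def)
  qed
  finally show ?thesis .
qed

text \<open>Dead edges are zero in \<open>A\<close>, so omitting them does not change the sum that
  equals \<open>v\<close>, and no remainder is left at a regular vertex.\<close>

lemma part_True_regular: "regular_vertex E v \<Longrightarrow> part v True = \<zero>"
proof -
  assume r: "regular_vertex E v"
  then have v: "v \<in> verts E" "finite (out_arcs E v)" by (auto simp: regular_vertex_def)
  have l: "live v \<subseteq> out_arcs E v" by (auto simp: live_def)
  have "(\<Oplus>e\<in>live v. edg e \<otimes> gho e) = (\<Oplus>e\<in>out_arcs E v. edg e \<otimes> gho e)"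
    by (rule add.finprod_mono_neutral_cong_left[OF v(2) l])
       (use dead_edg in \<open>auto simp: live_def mult_zero_left intro!: edg_gho_closed\<close>)
  then have "emitting_part v = vtx v"
    using vtx_regular[OF r] finite_subset[OF l v(2)] by (simp add: emitting_part_def)
  then show ?thesis using v by (simp add: part_def diff_self)
qed

lemma pullback_family: "leavitt_family K B E (pullback B \<mu>)"
proof -
  note cl = extend_zero_closed
  note expand = B.distrib_left B.distrib_right B.mult_closed
  show ?thesis
  proof (unfold_locales, goal_cases)
    case 1
    show ?case using cl by (auto simp: leavitt_gens_def)
  next
    case (2 x y)
    then show ?case
    proof (cases rule: leavitt_relation.cases)
      case (regular v)
      then have v: "v \<in> verts E" "finite (out_arcs E v)" by (auto simp: regular_vertex_def)
      have "V v True = \<zero>\<^bsub>B\<^esub>"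
        using part_True_regular[OF regular(3)] by (simp add: extend_zero_def)
      then have "pullback B \<mu> (Vertex v) = V v False" using cl by simp
      moreover have "live v \<subseteq> out_arcs E v" by (auto simp: live_def)
      ultimately show ?thesis
        using pullback_sum[OF v _ order_refl] regular by (simp del: pullback.simps)
    qed (use cl in \<open>simp_all add: expand extend_vtx_vtx extend_vtx_edg extend_edg_vtx extend_vtx_gho extend_gho_vtx extend_gho_edg\<close>)
  qed
qed

end

lemma pullback_dead:
  "v \<in> verts E \<Longrightarrow> vtx v = \<zero> \<Longrightarrow> abelian_group B \<Longrightarrow> pullback B \<mu> (Vertex v) = \<zero>\<^bsub>B\<^esub>"
  by (simp add: extend_zero_def part_zero abelian_group.axioms(1) abelian_monoid.l_zero
      abelian_monoid.zero_closed)

end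

context leavitt_generating_family
begin

text \<open>Each old generator is a sum of two new ones, where a copy missing from
  \<open>qgraph\<close> is zero in \<open>A\<close>. So closure under the new generators implies
  closure under the old ones.\<close>

lemma qgen_generating: "leavitt_generating_family K A qgraph qgen"
proof -
  interpret Q: leavitt_family K A qgraph qgen by (rule qgen_family)
  show ?thesis
  proof (unfold_locales, goal_cases)
    case (1 S)
    have S0: "\<zero> \<in> S" and Sadd: "\<And>x y. x \<in> S \<Longrightarrow> y \<in> S \<Longrightarrow> x \<oplus> y \<in> S"
      and Sc: "\<And>x. x \<in> S \<Longrightarrow> x \<in> carrier A"
      using 1(1) by (auto simp: subspace_def)
    have gen: "qgen x \<in> S" if "x \<in> leavitt_gens qgraph \<or> qgen x = \<zero>" for x
      using that 1(2) S0 by auto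
    have left: "qgen x \<otimes> y \<in> S" if "x \<in> leavitt_gens qgraph \<or> qgen x = \<zero>" "y \<in> S" for x y
      using that 1(3)[of x y] S0 Sc[of y] by (auto simp: mult_zero_left)
    have V: "Vertex (v, b) \<in> leavitt_gens qgraph \<or> qgen (Vertex (v, b)) = \<zero>" if "v \<in> verts E" for v b
      using that by auto
    have G: "Edge (e, b) \<in> leavitt_gens qgraph \<or> qgen (Edge (e, b)) = \<zero>" if "e \<in> arcs E" for e b
      using that by (auto simp: mult_zero_right)
    have H: "Ghost (e, b) \<in> leavitt_gens qgraph \<or> qgen (Ghost (e, b)) = \<zero>" if "e \<in> arcs E" for e b
      using that by (auto simp: mult_zero_left)
    have qc: "v \<in> verts E \<Longrightarrow> qgen (Vertex (v, b)) \<in> carrier A"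
      "e \<in> arcs E \<Longrightarrow> qgen (Edge (e, b)) \<in> carrier A"
      "e \<in> arcs E \<Longrightarrow> qgen (Ghost (e, b)) \<in> carrier A" for v e b
      by (auto simp: part_closed mult_closed)
    have dec: "\<exists>x y. (x \<in> leavitt_gens qgraph \<or> qgen x = \<zero>) \<and> (y \<in> leavitt_gens qgraph \<or> qgen y = \<zero>) \<and>
        qgen x \<in> carrier A \<and> qgen y \<in> carrier A \<and> \<iota> z = qgen x \<oplus> qgen y"
      if z: "z \<in> leavitt_gens E" for z
    proof (cases z)
      case (Vertex v)
      then have v: "v \<in> verts E" using z by simp
      have "\<iota> z = qgen (Vertex (v, False)) \<oplus> qgen (Vertex (v, True))"
        using Vertex v by (simp add: part_sum)
      then show ?thesis using V[OF v] qc(1)[OF v] by blast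
    next
      case (Edge e)
      then have e: "e \<in> arcs E" using z by simp
      have "\<iota> z = qgen (Edge (e, False)) \<oplus> qgen (Edge (e, True))"
        using Edge e by (simp add: distrib_left[symmetric] part_closed part_sum edg_head)
      then show ?thesis using G[OF e] qc(2)[OF e] by blast
    next
      case (Ghost e)
      then have e: "e \<in> arcs E" using z by simp
      have "\<iota> z = qgen (Ghost (e, False)) \<oplus> qgen (Ghost (e, True))"
        using Ghost e by (simp add: distrib_right[symmetric] part_closed part_sum head_gho)
      then show ?thesis using H[OF e] qc(3)[OF e] by blast
    qed
    show ?case
    proof (rule generated[OF 1(1)])
      fix z assume "z \<in> leavitt_gens E"
      then show "\<iota> z \<in> S" using dec[of z] gen Sadd by metis
    next
      fix z y assume "z \<in> leavitt_gens E" and y: "y \<in> S"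
      then obtain a b where ab: "a \<in> leavitt_gens qgraph \<or> qgen a = \<zero>"
        "b \<in> leavitt_gens qgraph \<or> qgen b = \<zero>"
        "qgen a \<in> carrier A" "qgen b \<in> carrier A" "\<iota> z = qgen a \<oplus> qgen b"
        using dec by metis
      have "\<iota> z \<otimes> y = qgen a \<otimes> y \<oplus> qgen b \<otimes> y"
        using ab(3-5) Sc[OF y] by (simp add: distrib_right)
      then show "\<iota> z \<otimes> y \<in> S" using Sadd left[OF ab(1) y] left[OF ab(2) y] by simp
    qed
  qed
qed

text \<open>The premise \<open>ker\<close> says that the kernel of \<phi> lies in the ideal
  generated by the dead vertices. The pulled back family gives a surjection \<psi> onto the Leavitt
  path algebra of \<open>qgraph\<close> with \<open>\<rho> \<circ> \<psi> = \<phi>\<close>. As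
  \<psi> kills the dead vertices, it kills the kernel of \<phi>, and so \<rho> is injective.\<close>

theorem qgraph_isomorphism:
  assumes \<phi>: "rng_algebra_hom K (leavitt_path_algebra K E) A \<phi>"
    and \<phi>_gen: "\<And>x. x \<in> leavitt_gens E \<Longrightarrow> \<phi> (leavitt_element K E x) = \<iota> x"
    and ker: "\<And>I y. \<lbrakk>rng_algebra.alg_ideal K (leavitt_path_algebra K E) I;
        \<And>v. v \<in> verts E \<Longrightarrow> vtx v = \<zero> \<Longrightarrow> leavitt_element K E (Vertex v) \<in> I;
        y \<in> carrier (leavitt_path_algebra K E); \<phi> y = \<zero>\<rbrakk> \<Longrightarrow> y \<in> I"
  obtains \<rho> where "rng_algebra_hom K (leavitt_path_algebra K qgraph) A \<rho>"
    "bij_betw \<rho> (carrier (leavitt_path_algebra K qgraph)) (carrier A)"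
    "\<And>x. x \<in> leavitt_gens qgraph \<Longrightarrow> \<rho> (leavitt_element K qgraph x) = qgen x"
proof -
  let ?L = "leavitt_path_algebra K E" and ?M = "leavitt_path_algebra K qgraph"
  let ?\<mu> = "leavitt_element K qgraph"
  interpret L: leavitt_generating_family K ?L E "leavitt_element K E"
    by (rule K.leavitt_path_algebra_family[OF E.wf_digraph_axioms])
  interpret M: leavitt_generating_family K ?M qgraph ?\<mu>
    by (rule K.leavitt_path_algebra_family[OF wf_qgraph])
  interpret Q: leavitt_generating_family K A qgraph qgen by (rule qgen_generating)
  interpret P: leavitt_family K ?M E "pullback ?M ?\<mu>"
    by (rule pullback_family[OF M.leavitt_family_axioms])
  obtain \<rho> where \<rho>: "rng_algebra_hom K ?M A \<rho>"
    "\<And>x. x \<in> leavitt_gens qgraph \<Longrightarrow> \<rho> (?\<mu> x) = qgen x"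
    using Q.leavitt_lift by blast
  interpret \<rho>: rng_algebra_hom K ?M A \<rho> by (rule \<rho>(1))
  obtain \<psi> where \<psi>: "rng_algebra_hom K ?L ?M \<psi>"
    "\<And>x. x \<in> leavitt_gens E \<Longrightarrow> \<psi> (leavitt_element K E x) = pullback ?M ?\<mu> x"
    using P.leavitt_lift by blast
  interpret \<psi>: rng_algebra_hom K ?L ?M \<psi> by (rule \<psi>(1))
  have ec: "extend_zero ?M ?\<mu> x \<in> carrier ?M" for x
    by (rule extend_zero_closed[OF M.leavitt_family_axioms])
  have \<rho>e: "\<rho> (extend_zero ?M ?\<mu> x) = (if x \<in> leavitt_gens qgraph then qgen x else \<zero>)" for x
    by (simp add: extend_zero_def \<rho>(2) \<rho>.hom_zero)
  have comp: "\<rho> (\<psi> y) = \<phi> y" if "y \<in> carrier ?L" for y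
  proof (rule L.hom_eqI[OF rng_algebra_hom_comp[OF \<psi>(1) \<rho>(1)] \<phi> _ that])
    fix x assume x: "x \<in> leavitt_gens E"
    have "\<rho> (pullback ?M ?\<mu> x) = \<iota> x"
    proof (cases x)
      case (Vertex v)
      then have v: "v \<in> verts E" using x by simp
      have "\<rho> (extend_zero ?M ?\<mu> (Vertex (v, b))) = part v b" for b
        using v by (simp add: \<rho>e)
      then show ?thesis using Vertex v ec by (simp add: \<rho>.hom_add part_sum)
    next
      case (Edge e)
      then have e: "e \<in> arcs E" using x by simp
      have "\<rho> (extend_zero ?M ?\<mu> (Edge (e, b))) = edg e \<otimes> part (head E e) b" for b
        using e by (auto simp: \<rho>e mult_zero_right)
      then show ?thesis
        using Edge e ec by (simp add: \<rho>.hom_add distrib_left[symmetric] part_closed part_sum edg_head)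
    next
      case (Ghost e)
      then have e: "e \<in> arcs E" using x by simp
      have "\<rho> (extend_zero ?M ?\<mu> (Ghost (e, b))) = part (head E e) b \<otimes> gho e" for b
        using e by (auto simp: \<rho>e mult_zero_left)
      then show ?thesis
        using Ghost e ec by (simp add: \<rho>.hom_add distrib_right[symmetric] part_closed part_sum head_gho)
    qed
    then show "\<rho> (\<psi> (leavitt_element K E x)) = \<phi> (leavitt_element K E x)"
      using \<psi>(2)[OF x] \<phi>_gen[OF x] by simp
  qed
  let ?I = "\<psi> ` carrier ?L"
  have sub: "M.subspace ?I" by (rule \<psi>.subspace_image[OF L.subspace_carrier])
  have pI: "pullback ?M ?\<mu> x \<in> ?I" if "x \<in> leavitt_gens E" for x
    using \<psi>(2)[OF that] funcset_mem[OF L.gen_closed that] by (metis image_eqI)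
  have mI: "x \<otimes>\<^bsub>?M\<^esub> y \<in> ?I" if "x \<in> ?I" "y \<in> ?I" for x y
  proof -
    obtain a b where "a \<in> carrier ?L" "b \<in> carrier ?L" "x = \<psi> a" "y = \<psi> b" using \<open>x \<in> ?I\<close> \<open>y \<in> ?I\<close> by blast
    then have "x \<otimes>\<^bsub>?M\<^esub> y = \<psi> (a \<otimes>\<^bsub>?L\<^esub> b)" "a \<otimes>\<^bsub>?L\<^esub> b \<in> carrier ?L"
      by (simp_all add: \<psi>.hom_mult L.mult_closed)
    then show ?thesis by blast
  qed
  \<comment> \<open>The image of \<psi> contains the sums of the two copies, and these have to be
    separated: for finitely many live edges the emitting copy is \<open>\<Sum> e e\<^sup>*\<close>,
    otherwise it is the whole vertex; the other copy is the difference.\<close>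
  have VF: "extend_zero ?M ?\<mu> (Vertex (v, False)) \<in> ?I" if v: "v \<in> verts E" for v
  proof (cases "finite (live v)")
    case True
    have "extend_zero ?M ?\<mu> (Vertex (v, False))
      = (\<Oplus>\<^bsub>?M\<^esub>e\<in>live v. pullback ?M ?\<mu> (Edge e) \<otimes>\<^bsub>?M\<^esub> pullback ?M ?\<mu> (Ghost e))"
      by (rule pullback_sum[OF M.leavitt_family_axioms v True order_refl]) (auto simp: live_def)
    also have "\<dots> \<in> ?I"
    proof (rule M.subspace_finsum[OF sub])
      fix e assume "e \<in> live v"
      then have "e \<in> arcs E" using live_arcs by blast
      then show "pullback ?M ?\<mu> (Edge e) \<otimes>\<^bsub>?M\<^esub> pullback ?M ?\<mu> (Ghost e) \<in> ?I"
        by (intro mI pI) simp_all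
    qed
    finally show ?thesis .
  next
    case False
    then have "part v True = \<zero>" using v by (simp add: part_def emitting_part_def diff_self)
    then have "pullback ?M ?\<mu> (Vertex v) = extend_zero ?M ?\<mu> (Vertex (v, False))"
      using ec[of "Vertex (v, False)"] by (simp add: extend_zero_def[of _ _ "Vertex (v, True)"])
    then show ?thesis using pI[of "Vertex v"] v by simp
  qed
  have Vb: "extend_zero ?M ?\<mu> (Vertex (v, b)) \<in> ?I" if v: "v \<in> verts E" for v b
  proof (cases b)
    case True
    have "extend_zero ?M ?\<mu> (Vertex (v, True))
      = pullback ?M ?\<mu> (Vertex v) \<ominus>\<^bsub>?M\<^esub> extend_zero ?M ?\<mu> (Vertex (v, False))"
      using ec by (simp add: M.add_diff_cancel_left)
    moreover have "\<dots> \<in> ?I"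
      by (rule M.subspace_diff[OF sub pI VF]) (use v in auto)
    ultimately show ?thesis using True by simp
  qed (use VF[OF v] in simp)
  have "\<psi> ` carrier ?L = carrier ?M"
  proof (rule M.surj_if_gens[OF \<psi>(1)])
    fix x assume x: "x \<in> leavitt_gens qgraph"
    then have ex: "?\<mu> x = extend_zero ?M ?\<mu> x" by (simp add: extend_zero_def)
    note mu = M.leavitt_family_axioms
    show "?\<mu> x \<in> ?I"
    proof (cases x)
      case (Vertex u)
      then obtain v b where "u = (v, b)" "v \<in> verts E" using x by (cases u) auto
      then show ?thesis using ex Vertex Vb by simp
    next
      case (Edge u)
      then obtain e b where e: "u = (e, b)" "e \<in> arcs E" using x by (cases u) auto
      have "extend_zero ?M ?\<mu> (Edge (e, b))
        = pullback ?M ?\<mu> (Edge e) \<otimes>\<^bsub>?M\<^esub> extend_zero ?M ?\<mu> (Vertex (head E e, b))"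
        using ec e(2) by (cases b) (simp_all add: M.distrib_right extend_edg_vtx[OF mu])
      moreover have "pullback ?M ?\<mu> (Edge e) \<otimes>\<^bsub>?M\<^esub> extend_zero ?M ?\<mu> (Vertex (head E e, b)) \<in> ?I"
        by (intro mI pI Vb) (use e(2) in simp_all)
      ultimately show ?thesis using ex Edge e(1) by (simp del: pullback.simps)
    next
      case (Ghost u)
      then obtain e b where e: "u = (e, b)" "e \<in> arcs E" using x by (cases u) auto
      have "extend_zero ?M ?\<mu> (Ghost (e, b))
        = extend_zero ?M ?\<mu> (Vertex (head E e, b)) \<otimes>\<^bsub>?M\<^esub> pullback ?M ?\<mu> (Ghost e)"
        using ec e(2) by (cases b) (simp_all add: M.distrib_left extend_vtx_gho[OF mu])
      moreover have "extend_zero ?M ?\<mu> (Vertex (head E e, b)) \<otimes>\<^bsub>?M\<^esub> pullback ?M ?\<mu> (Ghost e) \<in> ?I"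
        by (intro mI pI Vb) (use e(2) in simp_all)
      ultimately show ?thesis using ex Ghost e(1) by (simp del: pullback.simps)
    qed
  qed
  note surj = this
  have "inj_on \<rho> (carrier ?M)"
  proof (rule \<rho>.inj_on_kernel, rule subsetI)
    fix z assume "z \<in> \<rho>.kernel"
    then have z: "z \<in> carrier ?M" "\<rho> z = \<zero>" by (auto simp: \<rho>.kernel_def)
    then obtain y where y: "y \<in> carrier ?L" "z = \<psi> y" using surj by blast
    have "y \<in> \<psi>.kernel"
    proof (rule ker[OF \<psi>.alg_ideal_kernel _ y(1)])
      show "\<phi> y = \<zero>" using comp[OF y(1)] y z by simp
      fix v assume v: "v \<in> verts E" "vtx v = \<zero>"
      then show "leavitt_element K E (Vertex v) \<in> \<psi>.kernel"
        using \<psi>(2)[of "Vertex v"] pullback_dead[OF v M.abelian_group_axioms, of ?\<mu>]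
        by (simp add: \<psi>.kernel_def)
    qed
    then show "z \<in> {\<zero>\<^bsub>?M\<^esub>}" using y by (simp add: \<psi>.kernel_def)
  qed
  moreover have "\<rho> ` carrier ?M = carrier A"
  proof (rule Q.surj_if_gens[OF \<rho>(1)])
    fix x assume x: "x \<in> leavitt_gens qgraph"
    show "qgen x \<in> \<rho> ` carrier ?M"
      using \<rho>(2)[OF x] funcset_mem[OF M.gen_closed x] by (metis image_eqI)
  qed
  ultimately show thesis using that[OF \<rho>(1) _ \<rho>(2)] by (simp add: bij_betw_def)
qed

end

section \<open>Relabelling\<close>

lemma leavitt_relation_relabel:
  fixes f :: "'v \<Rightarrow> 'w" and g :: "'e \<Rightarrow> 'f"
  assumes B: "rng B" and E: "wf_digraph E" and F: "wf_digraph F"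
    and f: "inj_on f (verts E)" "verts F = f ` verts E"
    and g: "inj_on g (arcs E)" "arcs F = g ` arcs E"
    and ends: "\<And>e. e \<in> arcs E \<Longrightarrow> tail F (g e) = f (tail E e)"
      "\<And>e. e \<in> arcs E \<Longrightarrow> head F (g e) = f (head E e)"
    and \<iota>: "\<iota> \<in> leavitt_gens F \<rightarrow> carrier B"
    and rel: "leavitt_relation B (\<lambda>x. \<iota> (map_leavitt_gen f g x)) E a b"
  shows "leavitt_relation B \<iota> F a b"
proof -
  interpret B: rng B by fact
  interpret E: wf_digraph E by fact
  interpret F: wf_digraph F by fact
  have v: "v \<in> verts E \<Longrightarrow> f v \<in> verts F" and e: "e \<in> arcs E \<Longrightarrow> g e \<in> arcs F" for v e
    using f g by auto
  from rel show ?thesis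
  proof (cases rule: leavitt_relation.cases)
    case (vertex_idem x)
    then show ?thesis using leavitt_relation.vertex_idem[OF v, of x B \<iota>] by simp
  next
    case (vertex_orth x y)
    then have "f x \<noteq> f y" using f(1) by (auto simp: inj_on_def)
    then show ?thesis using leavitt_relation.vertex_orth[OF v v, of x y B \<iota>] vertex_orth by simp
  next
    case (source_edge x)
    then show ?thesis using leavitt_relation.source_edge[OF e, of x B \<iota>] by (simp add: ends)
  next
    case (edge_range x)
    then show ?thesis using leavitt_relation.edge_range[OF e, of x B \<iota>] by (simp add: ends)
  next
    case (range_ghost x)
    then show ?thesis using leavitt_relation.range_ghost[OF e, of x B \<iota>] by (simp add: ends)
  next
    case (ghost_source x)
    then show ?thesis using leavitt_relation.ghost_source[OF e, of x B \<iota>] by (simp add: ends)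
  next
    case (ghost_edge x)
    then show ?thesis using leavitt_relation.ghost_edge[OF e, of x B \<iota>] by (simp add: ends)
  next
    case (ghost_edge_orth x y)
    then have "g x \<noteq> g y" using g(1) by (auto simp: inj_on_def)
    then show ?thesis
      using leavitt_relation.ghost_edge_orth[OF e e, of x y B \<iota>] ghost_edge_orth by simp
  next
    case (regular x)
    then have x: "x \<in> verts E" "out_arcs E x \<noteq> {}" "finite (out_arcs E x)"
      by (auto simp: regular_vertex_def)
    have out: "out_arcs F (f x) = g ` out_arcs E x"
      using x f(1) g(2) ends(1) E.tail_in_verts
      by (auto simp: out_arcs_def inj_on_def image_iff)
    then have r: "regular_vertex F (f x)" using x v by (simp add: regular_vertex_def)
    have "(\<Oplus>\<^bsub>B\<^esub>y\<in>out_arcs F (f x). \<iota> (Edge y) \<otimes>\<^bsub>B\<^esub> \<iota> (Ghost y))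
      = (\<Oplus>\<^bsub>B\<^esub>y\<in>out_arcs E x. \<iota> (Edge (g y)) \<otimes>\<^bsub>B\<^esub> \<iota> (Ghost (g y)))"
      unfolding out
    proof (rule B.finsum_reindex)
      show "inj_on g (out_arcs E x)" using g(1) by (auto simp: inj_on_def)
      show "(\<lambda>y. \<iota> (Edge y) \<otimes>\<^bsub>B\<^esub> \<iota> (Ghost y)) \<in> g ` out_arcs E x \<rightarrow> carrier B"
        using \<iota> e by (auto simp: leavitt_gens_def intro!: B.mult_closed)
    qed
    then show ?thesis using leavitt_relation.regular[OF r, of B \<iota>] regular by simp
  qed
qed

lemma algebra_isomorphic_bij:
  assumes h: "rng_algebra_hom K B A h" and bij: "bij_betw h (carrier B) (carrier A)"
  shows "algebra_isomorphic K A B"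
proof -
  interpret h: rng_algebra_hom K B A h by fact
  let ?g = "inv_into (carrier B) h"
  have g: "?g x \<in> carrier B" "h (?g x) = x" if "x \<in> carrier A" for x
    using that bij by (auto simp: bij_betw_def inv_into_into f_inv_into_f)
  have inj: "x = y" if "x \<in> carrier B" "y \<in> carrier B" "h x = h y" for x y
    using that bij by (auto simp: bij_betw_def inj_on_def)
  have "?g (x \<oplus>\<^bsub>A\<^esub> y) = ?g x \<oplus>\<^bsub>B\<^esub> ?g y" if "x \<in> carrier A" "y \<in> carrier A" for x y
    by (rule inj) (use that g in \<open>simp_all add: h.hom_add\<close>)
  moreover have "?g (x \<otimes>\<^bsub>A\<^esub> y) = ?g x \<otimes>\<^bsub>B\<^esub> ?g y" if "x \<in> carrier A" "y \<in> carrier A" for x y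
    by (rule inj) (use that g in \<open>simp_all add: h.hom_mult h.A.mult_closed h.B.mult_closed\<close>)
  moreover have "?g (k \<odot>\<^bsub>A\<^esub> x) = k \<odot>\<^bsub>B\<^esub> ?g x" if "k \<in> carrier K" "x \<in> carrier A" for k x
    by (rule inj) (use that g in \<open>simp_all add: h.hom_smult h.A.smult_closed h.B.smult_closed\<close>)
  moreover have "bij_betw ?g (carrier A) (carrier B)" by (rule bij_betw_inv_into[OF bij])
  ultimately show ?thesis
    unfolding algebra_isomorphic_def iso_def hom_def using g by (intro exI[of _ ?g]) auto
qed

text \<open>The required graph has elements of \<open>A\<close> as vertices and edges, so the given
  one is relabelled by its images. Distinct vertices stay distinct as nonzero orthogonal
  idempotents, and distinct edges because \<open>e\<^sup>* e\<close> is a nonzero vertex. Since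
  \<open>\<rho> = \<sigma> \<circ> \<theta>\<close> with \<theta> onto, bijectivity passes from
  \<rho> to \<sigma>.\<close>

theorem (in leavitt_generating_family) isomorphic_to_leavitt_path_algebraI:
  assumes nonzero: "\<And>v. v \<in> verts E \<Longrightarrow> vtx v \<noteq> \<zero>"
    and \<rho>: "rng_algebra_hom K (leavitt_path_algebra K E) A \<rho>"
    and bij: "bij_betw \<rho> (carrier (leavitt_path_algebra K E)) (carrier A)"
    and \<rho>_gen: "\<And>x. x \<in> leavitt_gens E \<Longrightarrow> \<rho> (leavitt_element K E x) = \<iota> x"
  shows "isomorphic_to_leavitt_path_algebra K A"
proof -
  have f: "inj_on vtx (verts E)"
  proof (rule inj_onI)
    fix v x assume "v \<in> verts E" "x \<in> verts E" "vtx v = vtx x"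
    then show "v = x" using vtx_idem[of v] vtx_orth[of v x] nonzero[of v] by metis
  qed
  have g: "inj_on edg (arcs E)"
  proof (rule inj_onI)
    fix e e' assume "e \<in> arcs E" "e' \<in> arcs E" "edg e = edg e'"
    then show "e = e'"
      using gho_edg[of e] gho_edg_orth[of e e'] nonzero[of "head E e"] by (metis E.head_in_verts)
  qed
  let ?f' = "inv_into (verts E) vtx" and ?g' = "inv_into (arcs E) edg"
  have fi: "?f' (vtx v) = v" if "v \<in> verts E" for v
    by (rule inv_into_f_f[OF f that])
  have gi: "?g' (edg e) = e" if "e \<in> arcs E" for e
    by (rule inv_into_f_f[OF g that])
  define F where "F = \<lparr>verts = vtx ` verts E, arcs = edg ` arcs E,
    tail = (\<lambda>x. vtx (tail E (?g' x))), head = (\<lambda>x. vtx (head E (?g' x)))\<rparr>"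
  have Fs: "verts F = vtx ` verts E" "arcs F = edg ` arcs E"
    "\<And>e. e \<in> arcs E \<Longrightarrow> tail F (edg e) = vtx (tail E e)"
    "\<And>e. e \<in> arcs E \<Longrightarrow> head F (edg e) = vtx (head E e)"
    using gi by (auto simp: F_def)
  have wfF: "wf_digraph F"
    by unfold_locales (auto simp: Fs)
  have f': "inj_on ?f' (verts F)" "verts E = ?f' ` verts F"
    using fi by (auto simp: Fs inj_on_inv_into image_image)
  have g': "inj_on ?g' (arcs F)" "arcs E = ?g' ` arcs F"
    using gi by (auto simp: Fs inj_on_inv_into image_image)
  have ends': "tail E (?g' x) = ?f' (tail F x)" "head E (?g' x) = ?f' (head F x)"
    if "x \<in> arcs F" for x
    using that fi gi by (auto simp: Fs)
  let ?m = "map_leavitt_gen vtx edg" and ?m' = "map_leavitt_gen ?f' ?g'"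
  have mg: "?m x \<in> leavitt_gens F \<and> ?m' (?m x) = x" if "x \<in> leavitt_gens E" for x
    using that fi gi by (cases x) (auto simp: leavitt_gens_def Fs)
  have m'g: "?m' y \<in> leavitt_gens E \<and> ?m (?m' y) = y" if "y \<in> leavitt_gens F" for y
    using that fi gi by (cases y) (auto simp: leavitt_gens_def Fs)
  let ?L = "leavitt_path_algebra K E" and ?M = "leavitt_path_algebra K F"
  interpret L: leavitt_generating_family K ?L E "leavitt_element K E"
    by (rule K.leavitt_path_algebra_family[OF E.wf_digraph_axioms])
  interpret M: leavitt_generating_family K ?M F "leavitt_element K F"
    by (rule K.leavitt_path_algebra_family[OF wfF])
  interpret \<rho>: rng_algebra_hom K ?L A \<rho> by (rule \<rho>)
  have "leavitt_family K A F (\<lambda>x. \<iota> (?m' x))"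
  proof (intro leavitt_family.intro rng_algebra_axioms wfF leavitt_family_axioms.intro)
    show "(\<lambda>x. \<iota> (?m' x)) \<in> leavitt_gens F \<rightarrow> carrier A"
      using m'g gen_closed by auto
    fix x y assume r: "leavitt_relation A (\<lambda>x. \<iota> (?m' x)) F x y"
    have "leavitt_relation A \<iota> E x y"
      by (rule leavitt_relation_relabel[OF rng_axioms wfF E.wf_digraph_axioms f' g' _ _ gen_closed r])
         (simp_all only: ends')
    then show "x = y" by (rule relations)
  qed
  then interpret F: leavitt_family K A F "\<lambda>x. \<iota> (?m' x)" .
  obtain \<sigma> where \<sigma>: "rng_algebra_hom K ?M A \<sigma>"
    "\<And>x. x \<in> leavitt_gens F \<Longrightarrow> \<sigma> (leavitt_element K F x) = \<iota> (?m' x)"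
    using F.leavitt_lift by blast
  interpret \<sigma>: rng_algebra_hom K ?M A \<sigma> by (rule \<sigma>(1))
  have "leavitt_family K ?M E (\<lambda>x. leavitt_element K F (?m x))"
  proof (intro leavitt_family.intro M.rng_algebra_axioms E.wf_digraph_axioms leavitt_family_axioms.intro)
    show "(\<lambda>x. leavitt_element K F (?m x)) \<in> leavitt_gens E \<rightarrow> carrier ?M"
      using mg M.gen_closed by auto
    fix x y assume r: "leavitt_relation ?M (\<lambda>x. leavitt_element K F (?m x)) E x y"
    have "leavitt_relation ?M (leavitt_element K F) F x y"
      by (rule leavitt_relation_relabel[OF M.rng_axioms E.wf_digraph_axioms wfF f Fs(1) g Fs(2) _ _
            M.gen_closed r])
         (simp_all only: Fs(3,4))
    then show "x = y" by (rule M.relations)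
  qed
  then interpret T: leavitt_family K ?M E "\<lambda>x. leavitt_element K F (?m x)" .
  obtain \<theta> where \<theta>: "rng_algebra_hom K ?L ?M \<theta>"
    "\<And>x. x \<in> leavitt_gens E \<Longrightarrow> \<theta> (leavitt_element K E x) = leavitt_element K F (?m x)"
    using T.leavitt_lift by blast
  have comp: "\<sigma> (\<theta> y) = \<rho> y" if "y \<in> carrier ?L" for y
  proof (rule L.hom_eqI[OF rng_algebra_hom_comp[OF \<theta>(1) \<sigma>(1)] \<rho> _ that])
    fix x assume "x \<in> leavitt_gens E"
    then show "\<sigma> (\<theta> (leavitt_element K E x)) = \<rho> (leavitt_element K E x)"
      using \<theta>(2)[of x] \<sigma>(2)[of "?m x"] mg[of x] \<rho>_gen[of x] by simp
  qed
  have surj: "\<theta> ` carrier ?L = carrier ?M"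
  proof (rule M.surj_if_gens[OF \<theta>(1)])
    fix y assume "y \<in> leavitt_gens F"
    then have y: "?m' y \<in> leavitt_gens E" "?m (?m' y) = y" using m'g by auto
    then have "leavitt_element K F y = \<theta> (leavitt_element K E (?m' y))" using \<theta>(2) by simp
    then show "leavitt_element K F y \<in> \<theta> ` carrier ?L"
      using funcset_mem[OF L.gen_closed y(1)] by blast
  qed
  have "bij_betw \<sigma> (carrier ?M) (carrier A)"
    unfolding bij_betw_def
  proof
    show "inj_on \<sigma> (carrier ?M)"
    proof (rule inj_onI)
      fix x y assume "x \<in> carrier ?M" "y \<in> carrier ?M" and eq: "\<sigma> x = \<sigma> y"
      then obtain a b where ab: "a \<in> carrier ?L" "b \<in> carrier ?L" "x = \<theta> a" "y = \<theta> b"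
        unfolding surj[symmetric] by auto
      then have "\<rho> a = \<rho> b" using eq comp by simp
      then have "a = b" using bij ab(1,2) by (auto simp: bij_betw_def inj_on_def)
      then show "x = y" using ab by simp
    qed
    have "\<sigma> ` carrier ?M = (\<lambda>y. \<sigma> (\<theta> y)) ` carrier ?L" unfolding surj[symmetric] by (rule image_image)
    also have "\<dots> = \<rho> ` carrier ?L" using comp by (rule image_cong[OF refl])
    finally show "\<sigma> ` carrier ?M = carrier A" using bij by (simp add: bij_betw_def)
  qed
  then have "algebra_isomorphic K A ?M" by (rule algebra_isomorphic_bij[OF \<sigma>(1)])
  then show ?thesis
    unfolding isomorphic_to_leavitt_path_algebra_def using wfF by blast
qed

section \<open>Prime quotients\<close>

text \<open>A right local unit \<open>u\<close> of \<open>x\<close> gives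
  \<open>k \<odot> x = x \<otimes> (k \<odot> u)\<close>. The prime ideal and the socle, known to be
  ring ideals, become algebra ideals in this way.\<close>

lemma (in leavitt_generating_family) alg_ideal_if_ideal:
  assumes "rng_ideal I A"
  shows "alg_ideal I"
proof -
  interpret I: rng_ideal I A by fact
  have Ic: "x \<in> carrier A" if "x \<in> I" for x using I.a_subset that by blast
  show ?thesis
  proof (rule alg_idealI)
    show "subspace I"
      unfolding subspace_def
    proof (intro conjI ballI)
      fix k x assume k: "k \<in> carrier K" and x: "x \<in> I"
      obtain u where u: "u \<in> carrier A" "x \<otimes> u = x" using right_local_unit[OF Ic[OF x]] by blast
      have "k \<odot> x = x \<otimes> (k \<odot> u)" using k u Ic[OF x] by (simp add: smult_mult_right)
      then show "k \<odot> x \<in> I" using I.right_closed[OF x] k u by (simp add: smult_closed)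
    qed (use I.a_subset in auto)
  qed (use I.left_closed I.right_closed in auto)
qed

text \<open>Let \<open>I\<close> consist of the \<open>a\<close> with \<open>a t y\<close> in
  \<open>P\<close> for all \<open>t\<close>, and \<open>J\<close> of the \<open>b\<close> with
  \<open>a b\<close> in \<open>P\<close> for all \<open>a\<close> in \<open>I\<close>. Both are
  ideals and their product lies in \<open>P\<close>. Here \<open>x\<close> is in \<open>I\<close>,
  and \<open>y\<close> is in \<open>J\<close> because \<open>a y = a u y\<close> for a right local
  unit \<open>u\<close> of \<open>a\<close>.\<close>

lemma (in leavitt_generating_family) prime_ideal_elementwise:
  assumes P: "rng_prime_ideal P A" and x: "x \<in> carrier A" and y: "y \<in> carrier A"
    and xy: "\<And>t. t \<in> carrier A \<Longrightarrow> x \<otimes> t \<otimes> y \<in> P"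
  shows "x \<in> P \<or> y \<in> P"
proof -
  interpret P: rng_ideal P A using P by (simp add: rng_prime_ideal_def)
  define I where "I = {a \<in> carrier A. \<forall>t\<in>carrier A. a \<otimes> t \<otimes> y \<in> P}"
  have I_iff: "a \<in> I \<longleftrightarrow> a \<in> carrier A \<and> (\<forall>t\<in>carrier A. a \<otimes> t \<otimes> y \<in> P)" for a
    by (simp add: I_def)
  define J where "J = {b \<in> carrier A. \<forall>a\<in>I. a \<otimes> b \<in> P}"
  have "rng_ideal I A"
  proof (rule rng_idealI)
    fix a b assume "a \<in> I" and b: "b \<in> carrier A"
    then have a: "a \<in> carrier A" "\<And>t. t \<in> carrier A \<Longrightarrow> a \<otimes> t \<otimes> y \<in> P"
      by (auto simp: I_def)
    have "b \<otimes> a \<otimes> t \<otimes> y \<in> P" if t: "t \<in> carrier A" for t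
      using P.left_closed[OF a(2)[OF t] b] a(1) b t y by (simp add: mult_assoc mult_closed)
    then show "b \<otimes> a \<in> I" using a b by (simp add: mult_closed I_def)
    have "a \<otimes> b \<otimes> t \<otimes> y \<in> P" if t: "t \<in> carrier A" for t
      using a(2)[of "b \<otimes> t"] a(1) b t y by (simp add: mult_assoc mult_closed)
    then show "a \<otimes> b \<in> I" using a b by (simp add: mult_closed I_def)
  qed (use y in \<open>auto simp: mult_zero_left distrib_right mult_minus_left mult_closed I_def\<close>)
  then interpret I: rng_ideal I A .
  have Ic: "a \<in> carrier A" if "a \<in> I" for a
    using I.a_subset that by (rule subsetD)
  have J: "rng_ideal J A"
  proof (rule rng_idealI)
    fix b c assume "b \<in> J" and c: "c \<in> carrier A"
    then have b: "b \<in> carrier A" "\<And>a. a \<in> I \<Longrightarrow> a \<otimes> b \<in> P"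
      by (auto simp: J_def)
    have "a \<otimes> (c \<otimes> b) \<in> P" if a: "a \<in> I" for a
      using b(2)[OF I.right_closed[OF a c]] Ic[OF a] b(1) c by (simp add: mult_assoc)
    then show "c \<otimes> b \<in> J" using b(1) c by (simp add: mult_closed J_def)
    have "a \<otimes> (b \<otimes> c) \<in> P" if a: "a \<in> I" for a
      using P.right_closed[OF b(2)[OF a] c] Ic[OF a] b(1) c by (simp add: mult_assoc)
    then show "b \<otimes> c \<in> J" using b(1) c by (simp add: mult_closed J_def)
  qed (auto simp: J_def Ic mult_zero_right distrib_left mult_minus_right)
  have "y \<in> J"
  proof -
    have "a \<otimes> y \<in> P" if "a \<in> I" for a
    proof -
      have a: "a \<in> carrier A" "\<forall>t\<in>carrier A. a \<otimes> t \<otimes> y \<in> P" using \<open>a \<in> I\<close> I_iff by blast+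
      obtain u where "u \<in> carrier A" "a \<otimes> u = a" using right_local_unit[OF a(1)] by blast
      then show ?thesis using a(2) by metis
    qed
    then show ?thesis using y by (simp add: J_def)
  qed
  moreover have "x \<in> I" using x xy I_iff by blast
  moreover have "I \<cdot>\<^bsub>A\<^esub> J \<subseteq> P"
  proof
    fix z assume "z \<in> I \<cdot>\<^bsub>A\<^esub> J"
    then show "z \<in> P" by (induction rule: ideal_prod.induct) (auto simp: J_def)
  qed
  ultimately show ?thesis using P \<open>rng_ideal I A\<close> J unfolding rng_prime_ideal_def by blast
qed

lemma (in leavitt_family) hom_path:
  assumes h: "rng_algebra_hom K B A h" and \<kappa>: "leavitt_family K B E \<kappa>"
    and eq: "\<And>x. x \<in> leavitt_gens E \<Longrightarrow> h (\<kappa> x) = \<iota> x"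
    and p: "E.awalk u p v"
  shows "h (leavitt_family.path B \<kappa> p v) = path p v"
proof -
  interpret h: rng_algebra_hom K B A h by fact
  interpret B: leavitt_family K B E \<kappa> by fact
  show ?thesis
    using p
  proof (induction p arbitrary: u)
    case Nil
    then have "v \<in> verts E" by auto
    then show ?case using eq[of "Vertex v"] by simp
  next
    case (Cons e p)
    then have e: "e \<in> arcs E" and p: "E.awalk (head E e) p v" by auto
    then show ?case
      using Cons.IH[OF p] eq[of "Edge e"] B.path_closed[OF p] by (simp add: h.hom_mult)
  qed
qed

theorem proposition10p1:
  fixes K :: "('k, 'm) ring_scheme"
    and E :: "('v, 'e) pre_digraph"
    and P :: "(('v, 'e) leavitt_gen list \<Rightarrow> 'k) set set"
  defines "T \<equiv> quotient_algebra (leavitt_path_algebra K E) P"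
  assumes "field K"
    and "wf_digraph E"
    and "rng_prime_ideal P (leavitt_path_algebra K E)"
  shows "isomorphic_to_leavitt_path_algebra K T \<or>
         (isomorphic_to_leavitt_path_algebra K (quotient_algebra T (socle T)) \<and>
          simple_rng (T\<lparr>carrier := socle T\<rparr>) \<and>
          direct_sum_of_isomorphic_simple_left_ideals T (socle T))"
proof -
  let ?A = "leavitt_path_algebra K E"
  interpret K: field K by fact
  interpret A: leavitt_generating_family K ?A E "leavitt_element K E"
    by (rule K.leavitt_path_algebra_family) fact
  have PI: "A.alg_ideal P"
    using assms(4) by (intro A.alg_ideal_if_ideal) (simp add: rng_prime_ideal_def)
  note q = A.quotient_hom[OF PI, folded T_def]
  interpret T: leavitt_generating_family K T E "\<lambda>x. P +>\<^bsub>?A\<^esub> leavitt_element K E x"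
    by (rule A.generating_image[OF q(1,2)])
  interpret q: rng_algebra_hom K ?A T "\<lambda>x. P +>\<^bsub>?A\<^esub> x" by (rule q(1))
  have prime: "T.elementwise_prime"
    unfolding T.elementwise_prime_def
  proof (intro ballI impI)
    fix x y assume "x \<in> carrier T" "y \<in> carrier T" and xy: "\<forall>t\<in>carrier T. x \<otimes>\<^bsub>T\<^esub> t \<otimes>\<^bsub>T\<^esub> y = \<zero>\<^bsub>T\<^esub>"
    then obtain a b where ab: "a \<in> carrier ?A" "b \<in> carrier ?A"
      "x = P +>\<^bsub>?A\<^esub> a" "y = P +>\<^bsub>?A\<^esub> b" unfolding q(2)[symmetric] by auto
    have "a \<in> P \<or> b \<in> P"
    proof (rule A.prime_ideal_elementwise[OF assms(4) ab(1,2)])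
      fix t assume t: "t \<in> carrier ?A"
      have "P +>\<^bsub>?A\<^esub> (a \<otimes>\<^bsub>?A\<^esub> t \<otimes>\<^bsub>?A\<^esub> b) = x \<otimes>\<^bsub>T\<^esub> (P +>\<^bsub>?A\<^esub> t) \<otimes>\<^bsub>T\<^esub> y"
        using ab t by (simp add: q.hom_mult A.mult_closed)
      also have "\<dots> = \<zero>\<^bsub>T\<^esub>" using xy q.hom_closed[OF t] by blast
      finally show "a \<otimes>\<^bsub>?A\<^esub> t \<otimes>\<^bsub>?A\<^esub> b \<in> P" using q(3) ab t by (simp add: A.mult_closed)
    qed
    then show "x = \<zero>\<^bsub>T\<^esub> \<or> y = \<zero>\<^bsub>T\<^esub>" using q(3) ab by auto
  qed
  \<comment> \<open>The kernel of the map onto \<open>T\<close> is not known to be generated by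
    vertices, so \<open>qgraph_isomorphism\<close> cannot be applied here; \<rho> is merely a
    surjection killing no vertex.\<close>
  let ?F = "T.qgraph"
  let ?L = "leavitt_path_algebra K ?F"
  interpret F: leavitt_generating_family K T ?F T.qgen by (rule T.qgen_generating)
  have nonzero: "F.vtx v \<noteq> \<zero>\<^bsub>T\<^esub>" if "v \<in> verts ?F" for v
    using that by (cases v) auto
  interpret L: leavitt_generating_family K ?L ?F "leavitt_element K ?F"
    by (rule K.leavitt_path_algebra_family[OF T.wf_qgraph])
  obtain \<rho> where \<rho>: "rng_algebra_hom K ?L T \<rho>"
    "\<And>x. x \<in> leavitt_gens ?F \<Longrightarrow> \<rho> (leavitt_element K ?F x) = T.qgen x"
    using F.leavitt_lift by blast
  interpret \<rho>: rng_algebra_hom K ?L T \<rho> by (rule \<rho>(1))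
  have \<rho>surj: "\<rho> ` carrier ?L = carrier T"
  proof (rule F.surj_if_gens[OF \<rho>(1)])
    fix x assume x: "x \<in> leavitt_gens ?F"
    show "T.qgen x \<in> \<rho> ` carrier ?L"
      using \<rho>(2)[OF x] funcset_mem[OF L.gen_closed x] by (metis image_eqI)
  qed
  have \<rho>vtx: "\<rho> (L.vtx v) = F.vtx v" if "v \<in> verts ?F" for v
    using \<rho>(2)[of "Vertex v"] that by simp
  have novert: "L.vtx v \<notin> \<rho>.kernel" if "v \<in> verts ?F" for v
    using \<rho>vtx[OF that] nonzero[OF that] by (simp add: \<rho>.kernel_def)
  let ?D = "L.relation_vertices \<rho>.kernel"
  note kernel_subset = L.vertexfree_ideal_subset[OF \<rho>.alg_ideal_kernel novert]
  show ?thesis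
  proof (cases "?D = {}")
    case True
    \<comment> \<open>Without relation vertices the zero ideal can be taken for \<open>I\<close>, so
      the kernel vanishes.\<close>
    have "L.alg_ideal {\<zero>\<^bsub>?L\<^esub>}"
      by (rule L.alg_idealI)
         (auto simp: L.subspace_def L.mult_zero_left L.mult_zero_right L.smult_zero_right)
    then have "\<rho>.kernel \<subseteq> {\<zero>\<^bsub>?L\<^esub>}" using kernel_subset True by blast
    then have "bij_betw \<rho> (carrier ?L) (carrier T)"
      using \<rho>.inj_on_kernel \<rho>surj by (simp add: bij_betw_def)
    then show ?thesis
      using F.isomorphic_to_leavitt_path_algebraI[OF nonzero \<rho>(1) _ \<rho>(2)] by blast
  next
    case False
    \<comment> \<open>\<rho> carries a relation modulo its kernel to a relation with value zero in
      \<open>T\<close>, where all vertices of \<open>?F\<close> survive; hence the corner there is a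
      field.\<close>
    have corner: "division_corner T (F.vtx v)" if v: "v \<in> ?D" for v
    proof -
      obtain k C l where rel: "v \<in> verts ?F" "k \<in> carrier K" "k \<noteq> \<zero>\<^bsub>K\<^esub>" "finite C"
        "\<forall>\<tau>\<in>C. \<tau> \<noteq> [] \<and> F.E.awalk v \<tau> v" "l \<in> UNIV \<rightarrow> carrier K"
        "k \<odot>\<^bsub>?L\<^esub> L.vtx v \<oplus>\<^bsub>?L\<^esub> (\<Oplus>\<^bsub>?L\<^esub>\<tau>\<in>C. l \<tau> \<odot>\<^bsub>?L\<^esub> L.path \<tau> v) \<in> \<rho>.kernel"
        using v unfolding L.relation_vertices_def by blast
      have pc: "L.path \<tau> v \<in> carrier ?L" "\<rho> (L.path \<tau> v) = F.path \<tau> v" if "\<tau> \<in> C" for \<tau>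
        using bspec[OF rel(5) that] L.path_closed[of v \<tau> v]
          F.hom_path[OF \<rho>(1) L.leavitt_family_axioms \<rho>(2), of v \<tau> v]
        by simp_all
      have lk: "l \<tau> \<in> carrier K" for \<tau> using rel(6) by auto
      have sc: "l \<tau> \<odot>\<^bsub>?L\<^esub> L.path \<tau> v \<in> carrier ?L" if "\<tau> \<in> C" for \<tau>
        using pc(1)[OF that] lk by (simp add: L.smult_closed)
      have "(\<Oplus>\<^bsub>?L\<^esub>\<tau>\<in>C. l \<tau> \<odot>\<^bsub>?L\<^esub> L.path \<tau> v) \<in> carrier ?L"
        by (rule L.finsum_closed) (use sc in auto)
      moreover have "\<rho> (\<Oplus>\<^bsub>?L\<^esub>\<tau>\<in>C. l \<tau> \<odot>\<^bsub>?L\<^esub> L.path \<tau> v) = (\<Oplus>\<^bsub>T\<^esub>\<tau>\<in>C. \<rho> (l \<tau> \<odot>\<^bsub>?L\<^esub> L.path \<tau> v))"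
        by (rule \<rho>.hom_finsum) (use sc in auto)
      moreover have "\<dots> = (\<Oplus>\<^bsub>T\<^esub>\<tau>\<in>C. l \<tau> \<odot>\<^bsub>T\<^esub> F.path \<tau> v)"
      proof (rule T.finsum_cong'[OF refl])
        have "F.path \<tau> v \<in> carrier T" if "\<tau> \<in> C" for \<tau>
          using \<rho>.hom_closed[OF pc(1)[OF that]] pc(2)[OF that] by simp
        then show "(\<lambda>\<tau>. l \<tau> \<odot>\<^bsub>T\<^esub> F.path \<tau> v) \<in> C \<rightarrow> carrier T"
          using lk by (auto intro!: T.smult_closed)
        fix \<tau> assume \<tau>: "\<tau> \<in> C"
        show "\<rho> (l \<tau> \<odot>\<^bsub>?L\<^esub> L.path \<tau> v) = l \<tau> \<odot>\<^bsub>T\<^esub> F.path \<tau> v"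
          using pc[OF \<tau>] lk by (simp add: \<rho>.hom_smult)
      qed
      ultimately have "k \<odot>\<^bsub>T\<^esub> F.vtx v \<oplus>\<^bsub>T\<^esub> (\<Oplus>\<^bsub>T\<^esub>\<tau>\<in>C. l \<tau> \<odot>\<^bsub>T\<^esub> F.path \<tau> v) \<in> {\<zero>\<^bsub>T\<^esub>}"
        using rel(1,2,7) by (simp add: \<rho>.kernel_def \<rho>.hom_add \<rho>.hom_smult L.smult_closed \<rho>vtx)
      then have "v \<in> F.relation_vertices {\<zero>\<^bsub>T\<^esub>}"
        unfolding F.relation_vertices_def using rel(1-6) by blast
      then interpret V: relation_vertex K T ?F T.qgen v
        by unfold_locales (use nonzero in auto)
      show ?thesis
        by unfold_locales (use V.w_idempotent prime V.corner_division[OF prime] in auto)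
    qed
    \<comment> \<open>One relation vertex suffices to describe the socle as \<open>T w T\<close>.
      The other relation vertices lie in the socle by the same argument.\<close>
    obtain w where w: "w \<in> ?D" using False by blast
    have Dverts: "v \<in> verts ?F" if "v \<in> ?D" for v
      using that by (simp add: L.relation_vertices_def)
    interpret S: division_corner T "F.vtx w" by (rule corner[OF w])
    have Dsoc: "F.vtx v \<in> socle T" if "v \<in> ?D" for v
      by (rule division_corner.w_socle[OF corner[OF that]])
    let ?U = "quotient_algebra T (socle T)"
    have SI: "T.alg_ideal (socle T)" by (rule T.alg_ideal_if_ideal[OF S.socle_ideal])
    note r = T.quotient_hom[OF SI]
    interpret U: leavitt_generating_family K ?U ?F "\<lambda>x. socle T +>\<^bsub>T\<^esub> T.qgen x"
      by (rule F.generating_image[OF r(1,2)])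
    let ?\<kappa> = "\<lambda>y. socle T +>\<^bsub>T\<^esub> \<rho> y"
    have \<kappa>: "rng_algebra_hom K ?L ?U ?\<kappa>" by (rule rng_algebra_hom_comp[OF \<rho>(1) r(1)])
    \<comment> \<open>The kernel of the composite onto \<open>T/Soc(T)\<close> is generated by
      vertices. Relation vertices die there, so \<open>I\<close> contains them and with them the
      kernel of \<rho>; the socle \<open>T w T\<close> is covered by the elements
      \<open>a' w t'\<close> of \<open>I\<close>. Thus \<open>y\<close> differs from some
      \<open>z\<close> in \<open>I\<close> by an element of the kernel of \<rho>.\<close>
    have ker: "y \<in> I"
      if I: "L.alg_ideal I" "\<And>v. v \<in> verts ?F \<Longrightarrow> U.vtx v = \<zero>\<^bsub>?U\<^esub> \<Longrightarrow> L.vtx v \<in> I"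
        and y: "y \<in> carrier ?L" "?\<kappa> y = \<zero>\<^bsub>?U\<^esub>" for I y
    proof -
      have DI: "L.vtx v \<in> I" if "v \<in> ?D" for v
        using I(2)[OF Dverts[OF that]] r(3)[of "F.vtx v"] Dsoc[OF that] F.vtx_closed[OF Dverts[OF that]]
        by simp
      have NI: "\<rho>.kernel \<subseteq> I" by (rule kernel_subset[OF _ I(1) DI])
      have "socle T \<subseteq> \<rho> ` I"
      proof (rule S.socle_least)
        have sub: "T.subspace (\<rho> ` I)" by (rule \<rho>.subspace_image[OF L.alg_ideal_subspace[OF I(1)]])
        show "additive_subgroup (\<rho> ` I) T"
          by (rule T.additive_subgroupI')
             (use sub T.subspace_minus[OF sub] in \<open>auto simp: T.subspace_def\<close>)
        fix a t assume "a \<in> carrier T" "t \<in> carrier T"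
        then obtain a' t' where at: "a' \<in> carrier ?L" "t' \<in> carrier ?L" "a = \<rho> a'" "t = \<rho> t'"
          unfolding \<rho>surj[symmetric] by auto
        have "a \<otimes>\<^bsub>T\<^esub> F.vtx w \<otimes>\<^bsub>T\<^esub> t = \<rho> (a' \<otimes>\<^bsub>?L\<^esub> L.vtx w \<otimes>\<^bsub>?L\<^esub> t')"
          using at Dverts[OF w] by (simp add: \<rho>.hom_mult L.mult_closed \<rho>vtx)
        moreover have "a' \<otimes>\<^bsub>?L\<^esub> L.vtx w \<otimes>\<^bsub>?L\<^esub> t' \<in> I"
          using L.alg_ideal_right[OF I(1) L.alg_ideal_left[OF I(1) DI[OF w] at(1)] at(2)] .
        ultimately show "a \<otimes>\<^bsub>T\<^esub> F.vtx w \<otimes>\<^bsub>T\<^esub> t \<in> \<rho> ` I" by blast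
      qed
      moreover have "\<rho> y \<in> socle T" using r(3)[OF \<rho>.hom_closed[OF y(1)]] y(2) by simp
      ultimately obtain z where z: "z \<in> I" "\<rho> y = \<rho> z" by blast
      have zc: "z \<in> carrier ?L"
        using L.alg_ideal_subspace[OF I(1)] z(1) by (auto simp: L.subspace_def)
      have "y \<ominus>\<^bsub>?L\<^esub> z \<in> \<rho>.kernel"
        using y(1) zc z(2) \<rho>.hom_closed by (simp add: \<rho>.kernel_def \<rho>.hom_diff T.diff_self)
      then have "(y \<ominus>\<^bsub>?L\<^esub> z) \<oplus>\<^bsub>?L\<^esub> z \<in> I"
        using NI z(1) L.alg_ideal_subspace[OF I(1)] by (auto simp: L.subspace_def)
      then show ?thesis using L.diff_add_cancel[OF y(1) zc] by simp
    qed
    \<comment> \<open>Second use of the splitting, now over \<open>?F\<close> and with the condition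
      on the kernel satisfied.\<close>
    obtain \<sigma> where \<sigma>: "rng_algebra_hom K (leavitt_path_algebra K U.qgraph) ?U \<sigma>"
      "bij_betw \<sigma> (carrier (leavitt_path_algebra K U.qgraph)) (carrier ?U)"
      "\<And>x. x \<in> leavitt_gens U.qgraph \<Longrightarrow> \<sigma> (leavitt_element K U.qgraph x) = U.qgen x"
      by (rule U.qgraph_isomorphism[OF \<kappa> _ ker]) (simp_all add: \<rho>(2))
    interpret Q: leavitt_generating_family K ?U U.qgraph U.qgen by (rule U.qgen_generating)
    have "Q.vtx v \<noteq> \<zero>\<^bsub>?U\<^esub>" if "v \<in> verts U.qgraph" for v
      using that by (cases v) auto
    then have "isomorphic_to_leavitt_path_algebra K ?U"
      by (rule Q.isomorphic_to_leavitt_path_algebraI[OF _ \<sigma>])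
    then show ?thesis using S.simple_socle S.direct_sum_socle by blast
  qed
qed

end
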